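(* Let $n\ge 14$ be even and let $\mathfrak S$ be a commutative Schur ring over $G_n=\mathrm{Sp}(n,2)$ for which the set $\mathcal T$ of all symplectic transvections of $G_n$ is an $\mathfrak S$-set. Suppose that $C_1,\dots,C_r$ are the principal sets of $\mathfrak S$ that are contained in $\mathcal T$. Then $r=1$ and $C_1=\mathcal T$.
   Context: Let $n$ be even and let $V=\mathbb F_2^n$ carry a non-degenerate symplectic (alternating) form $(u,v)\mapsto u\cdot v\in\mathbb F_2$. $G_n=\mathrm{Sp}(n,2)=\mathrm{Sp}(V)$ is the group of linear maps of $V$ preserving the form. For $0\ne v\in V$ the symplectic transvection $t_v\in G_n$ is the map $w\mapsto w+(v\cdot w)v$, and $\mathcal T=\{t_v: 0\neq v\in V\}$ (a conjugacy class of involutions of $G_n$). For a finite group $G$ and $X\subseteq G$ put $\overline X=\sum_{x\in X}x\in\mathbb QG$ and $X^{(-1)}=\{x^{-1}:x\in X\}$. A Schur ring over $G$ is a subalgebra $\mathfrak S$ of $\mathbb QG$ spanned by $\overline{D_1},\dots,\overline{D_s}$, where $D_1=\{1\},D_2,\dots,D_s$ is a partition of $G$ such that (i) for each $i$ there is $i'$ with $D_i^{(-1)}=D_{i'}$, and (ii) there are integers $\lambda_{ijk}\ge0$ with $\overline{D_i}\,\overline{D_j}=\sum_k\lambda_{ijk}\overline{D_k}$. The $D_i$ are the principal sets of $\mathfrak S$; an $\mathfrak S$-set is a union of principal sets. $\mathfrak S$ is commutative if it is commutative as an algebra. *)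

theory Defs
  imports
    "HOL-Analysis.Cartesian_Space"
    "HOL-Algebra.Subrings"
    "HOL-Algebra.Coset"
    "HOL-Algebra.Module"
    "HOL-Library.Z2"
    "HOL-Library.Disjoint_Sets"
    "HOL-Library.Indicator_Function"
begin

subsection \<open>The group algebra over the rationals and Schur rings\<close>

text \<open>
  An element of the group algebra of a finite group \<open>G\<close> over the rationals is represented by
  its coefficient function, which vanishes outside \<open>carrier G\<close>.
\<close>

definition group_algebra :: "('g, 'm) monoid_scheme \<Rightarrow> (rat, 'g \<Rightarrow> rat) module" where
  "group_algebra G =
    \<lparr>carrier = {a. \<forall>g. g \<notin> carrier G \<longrightarrow> a g = 0},
     mult = (\<lambda>a b g. \<Sum>(x, y) \<in> {(x, y). x \<in> carrier G \<and> y \<in> carrier G \<and> x \<otimes>\<^bsub>G\<^esub> y = g}. a x * b y),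
     one = (\<lambda>g. if g = \<one>\<^bsub>G\<^esub> then 1 else 0),
     zero = (\<lambda>g. 0),
     add = (\<lambda>a b g. a g + b g),
     smult = (\<lambda>c a g. c * a g)\<rparr>"

text \<open>The sum of the elements of \<open>X\<close>, as an element of the group algebra.\<close>

definition set_sum :: "'g set \<Rightarrow> 'g \<Rightarrow> rat" where
  "set_sum X = indicator X"

definition subalgebra_of_group_algebra ::
    "('g, 'm) monoid_scheme \<Rightarrow> ('g \<Rightarrow> rat) set \<Rightarrow> bool" where
  "subalgebra_of_group_algebra G S \<longleftrightarrow>
     subring S (group_algebra G) \<and> (\<forall>c. \<forall>a\<in>S. c \<odot>\<^bsub>group_algebra G\<^esub> a \<in> S)"

text \<open>
  \<open>schur_ring G S P\<close>: \<open>S\<close> is a Schur ring over the finite group \<open>G\<close> whose set of principal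
  sets is \<open>P\<close>. By \<open>schur_ring_principal_sets_unique\<close> below, \<open>S\<close> determines \<open>P\<close>.
\<close>

definition schur_ring ::
    "('g, 'm) monoid_scheme \<Rightarrow> ('g \<Rightarrow> rat) set \<Rightarrow> 'g set set \<Rightarrow> bool" where
  "schur_ring G S P \<longleftrightarrow>
     partition_on (carrier G) P \<and>
     {\<one>\<^bsub>G\<^esub>} \<in> P \<and>
     (\<forall>D\<in>P. set_inv\<^bsub>G\<^esub> D \<in> P) \<and>
     (\<exists>l :: 'g set \<Rightarrow> 'g set \<Rightarrow> 'g set \<Rightarrow> nat. \<forall>D\<in>P. \<forall>E\<in>P.
        set_sum D \<otimes>\<^bsub>group_algebra G\<^esub> set_sum E =
          (\<Oplus>\<^bsub>group_algebra G\<^esub>F\<in>P. of_nat (l D E F) \<odot>\<^bsub>group_algebra G\<^esub> set_sum F)) \<and>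
     subalgebra_of_group_algebra G S \<and>
     S = {(\<Oplus>\<^bsub>group_algebra G\<^esub>D\<in>P. c D \<odot>\<^bsub>group_algebra G\<^esub> set_sum D) | c. True}"

definition commutative_schur_ring ::
    "('g, 'm) monoid_scheme \<Rightarrow> ('g \<Rightarrow> rat) set \<Rightarrow> 'g set set \<Rightarrow> bool" where
  "commutative_schur_ring G S P \<longleftrightarrow>
     schur_ring G S P \<and>
     (\<forall>a\<in>S. \<forall>b\<in>S. a \<otimes>\<^bsub>group_algebra G\<^esub> b = b \<otimes>\<^bsub>group_algebra G\<^esub> a)"

definition schur_set :: "'g set set \<Rightarrow> 'g set \<Rightarrow> bool" where
  "schur_set P X \<longleftrightarrow> (\<exists>Q\<subseteq>P. X = \<Union>Q)"

subsection \<open>The symplectic group over the field with two elements\<close>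

definition symplectic_form :: "(bit ^ 'n \<Rightarrow> bit ^ 'n \<Rightarrow> bit) \<Rightarrow> bool" where
  "symplectic_form B \<longleftrightarrow>
     (\<forall>u. Vector_Spaces.linear (*s) (*) (\<lambda>v. B u v)) \<and>
     (\<forall>v. Vector_Spaces.linear (*s) (*) (\<lambda>u. B u v)) \<and>
     (\<forall>v. B v v = 0) \<and>
     (\<forall>u. (\<forall>v. B u v = 0) \<longrightarrow> u = 0)"

definition Sp :: "(bit ^ 'n \<Rightarrow> bit ^ 'n \<Rightarrow> bit) \<Rightarrow> (bit ^ 'n \<Rightarrow> bit ^ 'n) monoid" where
  "Sp B =
    \<lparr>carrier = {f. Vector_Spaces.linear (*s) (*s) f \<and> (\<forall>u v. B (f u) (f v) = B u v)},
     mult = (\<circ>),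
     one = id\<rparr>"

definition transvection :: "(bit ^ 'n \<Rightarrow> bit ^ 'n \<Rightarrow> bit) \<Rightarrow> bit ^ 'n \<Rightarrow> bit ^ 'n \<Rightarrow> bit ^ 'n" where
  "transvection B v = (\<lambda>w. w + B v w *s v)"

definition transvections :: "(bit ^ 'n \<Rightarrow> bit ^ 'n \<Rightarrow> bit) \<Rightarrow> (bit ^ 'n \<Rightarrow> bit ^ 'n) set" where
  "transvections B = {transvection B v | v. v \<noteq> 0}"

subsection \<open>Basic facts\<close>

lemma group_algebra_simps:
  "carrier (group_algebra G) = {a. \<forall>g. g \<notin> carrier G \<longrightarrow> a g = 0}"
  "\<one>\<^bsub>group_algebra G\<^esub> = (\<lambda>g. if g = \<one>\<^bsub>G\<^esub> then 1 else 0)"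
  "\<zero>\<^bsub>group_algebra G\<^esub> = (\<lambda>g. 0)"
  "a \<oplus>\<^bsub>group_algebra G\<^esub> b = (\<lambda>g. a g + b g)"
  "c \<odot>\<^bsub>group_algebra G\<^esub> a = (\<lambda>g. c * a g)"
  by (simp_all add: group_algebra_def)

lemma abelian_group_group_algebra: "abelian_group (group_algebra G)"
proof (rule abelian_groupI)
  fix x assume "x \<in> carrier (group_algebra G)"
  then show "\<exists>y\<in>carrier (group_algebra G). y \<oplus>\<^bsub>group_algebra G\<^esub> x = \<zero>\<^bsub>group_algebra G\<^esub>"
    by (intro bexI[of _ "\<lambda>g. - x g"]) (auto simp: group_algebra_simps)
qed (auto simp: group_algebra_simps)

lemma group_algebra_mult:
  assumes "group G" "g \<in> carrier G"
  shows "(a \<otimes>\<^bsub>group_algebra G\<^esub> b) g = (\<Sum>x\<in>carrier G. a x * b (inv\<^bsub>G\<^esub> x \<otimes>\<^bsub>G\<^esub> g))"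
proof -
  interpret group G by fact
  let ?f = "\<lambda>x. (x, inv\<^bsub>G\<^esub> x \<otimes>\<^bsub>G\<^esub> g)"
  have "{(x, y). x \<in> carrier G \<and> y \<in> carrier G \<and> x \<otimes>\<^bsub>G\<^esub> y = g} = ?f ` carrier G"
    using assms(2) by (auto simp: image_iff inv_solve_left inv_solve_left' m_assoc[symmetric])
  moreover have "inj_on ?f (carrier G)" by (auto simp: inj_on_def)
  ultimately show ?thesis by (simp add: group_algebra_def sum.reindex)
qed

lemma group_algebra_mult_outside:
  assumes "group G" "g \<notin> carrier G"
  shows "(a \<otimes>\<^bsub>group_algebra G\<^esub> b) g = 0"
proof -
  interpret group G by fact
  have *: "{(x, y). x \<in> carrier G \<and> y \<in> carrier G \<and> x \<otimes>\<^bsub>G\<^esub> y = g} = {}"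
    using assms(2) by auto
  show ?thesis unfolding group_algebra_def by (simp add: *)
qed

lemma ring_group_algebra:
  assumes "group G" "finite (carrier G)"
  shows "ring (group_algebra G)"
proof (rule ringI)
  interpret group G by fact
  let ?A = "group_algebra G"
  note out = group_algebra_mult_outside[OF assms(1)]
  note inn = group_algebra_mult[OF assms(1)]
  show "abelian_group ?A" by (rule abelian_group_group_algebra)
  show "monoid ?A"
  proof (rule monoidI)
    fix x y assume "x \<in> carrier ?A" "y \<in> carrier ?A"
    then show "x \<otimes>\<^bsub>?A\<^esub> y \<in> carrier ?A" by (auto simp: group_algebra_simps(1) out)
  next
    show "\<one>\<^bsub>?A\<^esub> \<in> carrier ?A" by (auto simp: group_algebra_simps)
  next
    fix x y z assume "x \<in> carrier ?A" "y \<in> carrier ?A" "z \<in> carrier ?A"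
    show "x \<otimes>\<^bsub>?A\<^esub> y \<otimes>\<^bsub>?A\<^esub> z = x \<otimes>\<^bsub>?A\<^esub> (y \<otimes>\<^bsub>?A\<^esub> z)"
    proof
      fix g
      show "(x \<otimes>\<^bsub>?A\<^esub> y \<otimes>\<^bsub>?A\<^esub> z) g = (x \<otimes>\<^bsub>?A\<^esub> (y \<otimes>\<^bsub>?A\<^esub> z)) g"
      proof (cases "g \<in> carrier G")
        case True
        have "(x \<otimes>\<^bsub>?A\<^esub> y \<otimes>\<^bsub>?A\<^esub> z) g =
            (\<Sum>h\<in>carrier G. \<Sum>k\<in>carrier G. x k * y (inv\<^bsub>G\<^esub> k \<otimes>\<^bsub>G\<^esub> h) * z (inv\<^bsub>G\<^esub> h \<otimes>\<^bsub>G\<^esub> g))"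
          using True by (simp add: inn sum_distrib_right)
        also have "\<dots> = (\<Sum>k\<in>carrier G. \<Sum>h\<in>carrier G. x k * (y (inv\<^bsub>G\<^esub> k \<otimes>\<^bsub>G\<^esub> h) * z (inv\<^bsub>G\<^esub> h \<otimes>\<^bsub>G\<^esub> g)))"
          by (subst sum.swap) (simp add: mult.assoc)
        also have "\<dots> = (\<Sum>k\<in>carrier G. \<Sum>h\<in>carrier G. x k * (y h * z (inv\<^bsub>G\<^esub> h \<otimes>\<^bsub>G\<^esub> (inv\<^bsub>G\<^esub> k \<otimes>\<^bsub>G\<^esub> g))))"
        proof (rule sum.cong[OF refl])
          fix k assume k: "k \<in> carrier G"
          have c: "h \<otimes>\<^bsub>G\<^esub> k \<otimes>\<^bsub>G\<^esub> inv\<^bsub>G\<^esub> k = h" if "h \<in> carrier G" for h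
            using k that by (simp add: m_assoc)
          show "(\<Sum>h\<in>carrier G. x k * (y (inv\<^bsub>G\<^esub> k \<otimes>\<^bsub>G\<^esub> h) * z (inv\<^bsub>G\<^esub> h \<otimes>\<^bsub>G\<^esub> g))) =
                (\<Sum>h\<in>carrier G. x k * (y h * z (inv\<^bsub>G\<^esub> h \<otimes>\<^bsub>G\<^esub> (inv\<^bsub>G\<^esub> k \<otimes>\<^bsub>G\<^esub> g))))"
            using k True
            by (intro sum.reindex_bij_witness[of _ "\<lambda>h. k \<otimes>\<^bsub>G\<^esub> h" "\<lambda>h. inv\<^bsub>G\<^esub> k \<otimes>\<^bsub>G\<^esub> h"])
              (auto simp: m_assoc[symmetric] inv_mult_group c)
        qed
        also have "\<dots> = (x \<otimes>\<^bsub>?A\<^esub> (y \<otimes>\<^bsub>?A\<^esub> z)) g"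
          using True by (simp add: inn sum_distrib_left)
        finally show ?thesis .
      qed (simp add: out)
    qed
  next
    fix x assume x: "x \<in> carrier ?A"
    show "\<one>\<^bsub>?A\<^esub> \<otimes>\<^bsub>?A\<^esub> x = x"
    proof
      fix g
      show "(\<one>\<^bsub>?A\<^esub> \<otimes>\<^bsub>?A\<^esub> x) g = x g"
      proof (cases "g \<in> carrier G")
        case True
        have "(\<one>\<^bsub>?A\<^esub> \<otimes>\<^bsub>?A\<^esub> x) g =
            (\<Sum>k\<in>carrier G. if k = \<one>\<^bsub>G\<^esub> then x (inv\<^bsub>G\<^esub> k \<otimes>\<^bsub>G\<^esub> g) else 0)"
          using True by (simp add: inn group_algebra_simps if_distrib[of "\<lambda>t. t * _"] cong: if_cong)
        then show ?thesis using True assms(2) by simp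
      qed (use x in \<open>simp add: out group_algebra_simps(1)\<close>)
    qed
    show "x \<otimes>\<^bsub>?A\<^esub> \<one>\<^bsub>?A\<^esub> = x"
    proof
      fix g
      show "(x \<otimes>\<^bsub>?A\<^esub> \<one>\<^bsub>?A\<^esub>) g = x g"
      proof (cases "g \<in> carrier G")
        case True
        have "(x \<otimes>\<^bsub>?A\<^esub> \<one>\<^bsub>?A\<^esub>) g = (\<Sum>k\<in>carrier G. if k = g then x k else 0)"
          unfolding inn[OF True]
        proof (rule sum.cong[OF refl])
          fix k assume k: "k \<in> carrier G"
          have "inv\<^bsub>G\<^esub> k \<otimes>\<^bsub>G\<^esub> g = \<one>\<^bsub>G\<^esub> \<longleftrightarrow> k = g"
            using k True by (metis inv_closed inv_equality inv_inv l_inv)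
          then show "x k * \<one>\<^bsub>?A\<^esub> (inv\<^bsub>G\<^esub> k \<otimes>\<^bsub>G\<^esub> g) = (if k = g then x k else 0)"
            by (simp add: group_algebra_simps)
        qed
        then show ?thesis using True assms(2) by simp
      qed (use x in \<open>simp add: out group_algebra_simps(1)\<close>)
    qed
  qed
next
  fix x y z
  let ?A = "group_algebra G"
  show "(x \<oplus>\<^bsub>?A\<^esub> y) \<otimes>\<^bsub>?A\<^esub> z = x \<otimes>\<^bsub>?A\<^esub> z \<oplus>\<^bsub>?A\<^esub> y \<otimes>\<^bsub>?A\<^esub> z"
    "z \<otimes>\<^bsub>?A\<^esub> (x \<oplus>\<^bsub>?A\<^esub> y) = z \<otimes>\<^bsub>?A\<^esub> x \<oplus>\<^bsub>?A\<^esub> z \<otimes>\<^bsub>?A\<^esub> y"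
    by (simp_all add: group_algebra_def fun_eq_iff sum.distrib[symmetric] algebra_simps
        case_prod_beta)
qed

lemma group_algebra_finsum:
  assumes "finite I" "\<And>i. i \<in> I \<Longrightarrow> f i \<in> carrier (group_algebra G)"
  shows "(\<Oplus>\<^bsub>group_algebra G\<^esub>i\<in>I. f i) = (\<lambda>g. \<Sum>i\<in>I. f i g)"
proof -
  interpret abelian_group "group_algebra G" by (rule abelian_group_group_algebra)
  show ?thesis using assms
    by (induction I rule: finite_induct) (auto simp: group_algebra_simps Pi_iff)
qed

lemma schur_ring_mem_iff:
  assumes "finite (carrier G)" "schur_ring G S P"
  shows "a \<in> S \<longleftrightarrow> a \<in> carrier (group_algebra G) \<and> (\<forall>D\<in>P. \<forall>x\<in>D. \<forall>y\<in>D. a x = a y)"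
proof -
  let ?A = "group_algebra G"
  have part: "\<Union>P = carrier G" "disjoint P" "{} \<notin> P"
    and S: "S = {(\<Oplus>\<^bsub>?A\<^esub>D\<in>P. c D \<odot>\<^bsub>?A\<^esub> set_sum D) | c. True}"
    using assms(2) by (auto simp: schur_ring_def partition_on_def)
  have fin: "finite P" using assms(1) part(1) by (metis finite_UnionD)
  have eq: "(\<Oplus>\<^bsub>?A\<^esub>D\<in>P. c D \<odot>\<^bsub>?A\<^esub> set_sum D) = (\<lambda>g. \<Sum>D\<in>P. c D * indicator D g)" for c
    using part(1) fin
    by (subst group_algebra_finsum) (auto simp: group_algebra_simps set_sum_def indicator_def)
  have val: "(\<Sum>D\<in>P. c D * indicator D x) = c E" if "E \<in> P" "x \<in> E" for c :: "'a set \<Rightarrow> rat" and E x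
  proof -
    have "(\<Sum>D\<in>P. c D * indicator D x) = (\<Sum>D\<in>P. if D = E then c D else 0)"
      using that part(2) by (intro sum.cong) (auto simp: indicator_def disjoint_def)
    then show ?thesis using fin that by simp
  qed
  have zero: "(\<Sum>D\<in>P. c D * indicator D x) = 0" if "x \<notin> carrier G" for c :: "'a set \<Rightarrow> rat" and x
    using that part(1) by (intro sum.neutral) (auto simp: indicator_def)
  show ?thesis
  proof
    assume "a \<in> S"
    then obtain c where "a = (\<lambda>g. \<Sum>D\<in>P. c D * indicator D g)" unfolding S eq by auto
    then show "a \<in> carrier ?A \<and> (\<forall>D\<in>P. \<forall>x\<in>D. \<forall>y\<in>D. a x = a y)"
      by (simp add: group_algebra_simps val zero)
  next
    assume a: "a \<in> carrier ?A \<and> (\<forall>D\<in>P. \<forall>x\<in>D. \<forall>y\<in>D. a x = a y)"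
    have "a = (\<lambda>g. \<Sum>D\<in>P. a (SOME x. x \<in> D) * indicator D g)"
    proof
      fix g
      show "a g = (\<Sum>D\<in>P. a (SOME x. x \<in> D) * indicator D g)"
      proof (cases "g \<in> carrier G")
        case True
        then obtain E where E: "E \<in> P" "g \<in> E" using part(1) by auto
        then have "a (SOME x. x \<in> E) = a g" using a by (meson someI)
        then show ?thesis using val[OF E] by simp
      qed (use a in \<open>simp add: group_algebra_simps zero\<close>)
    qed
    then show "a \<in> S"
      unfolding S eq by (intro CollectI exI[of _ "\<lambda>D. a (SOME x. x \<in> D)"] conjI TrueI)
  qed
qed

lemma schur_ring_principal_sets_unique:
  assumes "finite (carrier G)" "schur_ring G S P" "schur_ring G S Q"
  shows "P = Q"
proof -
  have sub: "P \<subseteq> Q" if P: "schur_ring G S P" and Q: "schur_ring G S Q" for P Q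
  proof
    fix D assume D: "D \<in> P"
    have pP: "\<Union>P = carrier G" "disjoint P" "{} \<notin> P" and pQ: "\<Union>Q = carrier G" "disjoint Q" "{} \<notin> Q"
      using P Q by (auto simp: schur_ring_def partition_on_def)
    have ind: "indicator D \<in> S"
      if "D \<in> P" "schur_ring G S P" "\<Union>P = carrier G" "disjoint P" for D P
      unfolding schur_ring_mem_iff[OF assms(1) that(2)] using that(1,3,4)
      by (auto simp: group_algebra_simps indicator_def disjoint_def)
    obtain x where x: "x \<in> D" using D pP by (metis all_not_in_conv)
    then obtain E where E: "E \<in> Q" "x \<in> E" using D pP(1) pQ(1) by blast
    have 1: "\<forall>y\<in>E. (indicator D y :: rat) = indicator D x"
      using ind[OF D P pP(1,2)] schur_ring_mem_iff[OF assms(1) Q] E by blast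
    have 2: "\<forall>y\<in>D. (indicator E y :: rat) = indicator E x"
      using ind[OF E(1) Q pQ(1,2)] schur_ring_mem_iff[OF assms(1) P] D x by blast
    have "D = E" using 1 2 x E(2) by (auto simp: indicator_def split: if_splits)
    then show "D \<in> Q" using E by simp
  qed
  show ?thesis using sub assms(2,3) by blast
qed

lemma finite_UNIV_bit_vec: "finite (UNIV :: (bit ^ 'n) set)"
proof -
  have "x \<in> {0, 1}" for x :: bit by (cases x) simp_all
  then have "UNIV = {0, 1 :: bit}" by (rule UNIV_eq_I)
  moreover have "finite {0, 1 :: bit}" by simp
  ultimately have "finite (UNIV :: bit set)" by simp
  then have "finite (UNIV :: ('n \<Rightarrow> bit) set)" by (simp add: finite_UNIV_fun)
  then have "finite (range (vec_lambda :: ('n \<Rightarrow> bit) \<Rightarrow> bit ^ 'n))" by (rule finite_imageI)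
  moreover have "range vec_lambda = (UNIV :: (bit ^ 'n) set)"
    by (metis surj_def vec_lambda_eta)
  ultimately show ?thesis by (rule subst[rotated])
qed

lemma finite_carrier_Sp: "finite (carrier (Sp B))"
  by (rule finite_subset[OF subset_UNIV]) (simp add: finite_UNIV_fun finite_UNIV_bit_vec)

lemma group_Sp:
  assumes "symplectic_form B"
  shows "group (Sp B)"
proof (rule groupI)
  fix f assume "f \<in> carrier (Sp B)"
  then have lin: "Vector_Spaces.linear (*s) (*s) f" and pres: "\<And>u v. B (f u) (f v) = B u v"
    by (auto simp: Sp_def)
  have nondeg: "u = 0" if "\<And>v. B u v = 0" for u
    using assms that by (auto simp: symplectic_form_def)
  have B0: "B 0 v = 0" for v
  proof -
    interpret l: Vector_Spaces.linear "(*s)" "(*)" "\<lambda>u. B u v"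
      using assms by (simp add: symplectic_form_def)
    show ?thesis by (rule l.zero)
  qed
  interpret f: Vector_Spaces.linear "(*s)" "(*s)" f by (rule lin)
  have "u = 0" if "f u = 0" for u
    using nondeg pres[of u] that B0 by metis
  then have "inj f" by (metis f.inj_iff_eq_0)
  then have bij: "bij f" using finite_UNIV_inj_surj[OF finite_UNIV_bit_vec] by (simp add: bij_def)
  then have fi: "f (inv_into UNIV f v) = v" "inv_into UNIV f (f v) = v" for v
    by (simp_all add: bij_is_surj surj_f_inv_f bij_is_inj)
  have "Vector_Spaces.linear (*s) (*s) (inv_into UNIV f)"
    unfolding Vector_Spaces.linear_iff
    by (intro conjI allI; (rule vec.vector_space_axioms)?) (metis fi f.add f.scale)+
  then show "\<exists>g\<in>carrier (Sp B). g \<otimes>\<^bsub>Sp B\<^esub> f = \<one>\<^bsub>Sp B\<^esub>"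
    using pres fi by (intro bexI[of _ "inv_into UNIV f"]) (auto simp: Sp_def fun_eq_iff, metis)
qed (auto simp: Sp_def comp_assoc vec.linear_id id_def[symmetric] intro: Vector_Spaces.linear_compose)

end

theory Submission
  imports Defs "HOL-Combinatorics.Transposition"
begin

text \<open>
  An S-set of transvections is a set \<open>X\<close> of non-zero vectors, that is, a 2-colouring of them. An element of
  \<open>Sp(n,2)\<close> is a product of few transvections in few ways only, so the commutativity of S-sets of such
  products turns into local conditions on the colouring. In a subgroup \<open>S\<^sub>4\<close> they force \<open>X\<close> or its complement
  to be closed under the sum of two non-orthogonal vectors. In a subgroup \<open>S\<^sub>7\<close>, evaluating both products
  of two S-sets of 4-cycles at a 7-cycle excludes certain colourings of the complete graph on seven points.
  One of the excluded colourings occurs if \<open>X\<close> is a hyperplane, a totally isotropic subspace of dimension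
  at least 2, a quadric or a sparse closed set containing two non-orthogonal vectors; the first two and
  non-degenerate subspaces of small dimension exclude every proper non-zero subspace. It follows that a minimal
  closed \<open>X\<close> and its complement are atoms, so that each vector has a number of neighbours in \<open>X\<close> which only
  depends on its colour. By Fourier analysis such an \<open>X\<close> is a quadric or sparse.
\<close>

section \<open>Symplectic geometry over the field with two elements\<close>

text \<open>Commutativity enters only in the form that an element of \<open>prods E F\<close> also
  lies in \<open>prods F E\<close>. This is informative at elements with few factorizations: a
  product of two non-commuting transvections has three into transvections, a 4-cycle two into a
  transvection and a commuting pair, the 7-cycle seven into two 4-cycles. The obstacle is that every
  hyperplane satisfies the colour condition found in \<open>S_4\<close>: an edge belongs to it iff
  both ends lie on the same side. Hence the longer cycle. Its factorizations are rotations of one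
  another, so a colouring is excluded as soon as one rotation passes a test in one order and no
  rotation passes it in the other. The bound on the dimension \<open>n = 2 m\<close> comes from the
  sparse case. There the size of \<open>X\<close> plus its degree is below
  \<open>2 ^ (m + 2)\<close>, and the points of the excluded colouring are found by solving up to
  five independent linear equations while avoiding that many vectors. This needs
  \<open>m + 2 \<le> n - 5\<close>, that is, \<open>m \<ge> 7\<close>.\<close>

lemma bit_cases: "x = 0 \<or> x = (1 :: bit)"
  by (cases x) auto

lemma bit_vec_add_self [simp]: "x + x = (0 :: bit ^ 'n)"
proof -
  have "b + b = 0" for b :: bit by (cases b) auto
  then show ?thesis by (simp add: vec_eq_iff)
qed

lemma bit_vec_add_self_left [simp]: "x + (x + y) = (y :: bit ^ 'n)"
  by (metis add.assoc add.left_neutral bit_vec_add_self)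

lemma bit_vec_add_self_mid [simp]: "x + y + x = (y :: bit ^ 'n)" "x + (y + x) = y"
  by (metis add.commute bit_vec_add_self_left)+

lemma bit_vec_add_eq_0_iff [simp]: "x + y = 0 \<longleftrightarrow> x = (y :: bit ^ 'n)"
  by (metis bit_vec_add_self bit_vec_add_self_left add.right_neutral)

lemma bit_vec_add_eq_iff: "x + y = z \<longleftrightarrow> x = y + (z :: bit ^ 'n)"
  by (metis bit_vec_add_self_left add.commute)

lemma card_bit [simp]: "CARD(bit) = 2"
proof -
  have "(UNIV :: bit set) = {0, 1}" using bit_cases by auto
  then show ?thesis by (metis card_2_iff zero_neq_one)
qed

lemma finite_bit_vec_set [simp]: "finite (A :: (bit ^ 'n) set)"
  using finite_UNIV_bit_vec by (rule finite_subset[OF subset_UNIV])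

lemma finite_bit_vec_maps [simp]: "finite (A :: (bit ^ 'n \<Rightarrow> bit ^ 'n) set)"
  by (rule finite_subset[OF subset_UNIV]) (simp add: finite_UNIV_fun finite_UNIV_bit_vec)

text \<open>Lists rather than subspaces, because vectors are later chosen one at a time and only the
  bound \<open>2 ^ length us\<close> on the size of the span matters.\<close>

fun list_span :: "'a::ab_group_add list \<Rightarrow> 'a set" where
  "list_span [] = {0}"
| "list_span (u # us) = list_span us \<union> (+) u ` list_span us"

fun indep :: "'a::ab_group_add list \<Rightarrow> bool" where
  "indep [] \<longleftrightarrow> True"
| "indep (u # us) \<longleftrightarrow> u \<notin> list_span us \<and> indep us"

lemma zero_in_list_span: "0 \<in> list_span us"
  by (induction us) auto

lemma list_span_add:
  fixes us :: "(bit ^ 'n) list"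
  shows "x \<in> list_span us \<Longrightarrow> y \<in> list_span us \<Longrightarrow> x + y \<in> list_span us"
proof (induction us arbitrary: x y)
  case (Cons u us)
  obtain x' s where x: "x' \<in> list_span us" "x = (if s then u + x' else x')"
    using Cons.prems(1) by (metis (full_types) Un_iff list_span.simps(2) imageE)
  obtain y' t where y: "y' \<in> list_span us" "y = (if t then u + y' else y')"
    using Cons.prems(2) by (metis (full_types) Un_iff list_span.simps(2) imageE)
  have *: "x' + y' \<in> list_span us" using Cons.IH x(1) y(1) .
  have "x + y = (if s \<longleftrightarrow> t then x' + y' else u + (x' + y'))"
    unfolding x(2) y(2) by (cases s; cases t) (simp_all add: ac_simps)
  then show ?case using * by auto
qed simp

lemma set_subset_list_span: "set us \<subseteq> list_span us"
proof (induction us)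
  case (Cons u us)
  then show ?case using zero_in_list_span[of us] by force
qed simp

lemma card_list_span_le:
  fixes us :: "(bit ^ 'n) list"
  shows "card (list_span us) \<le> 2 ^ length us"
proof (induction us)
  case (Cons u us)
  have "card (list_span (u # us)) \<le> card (list_span us) + card ((+) u ` list_span us)"
    by (simp add: card_Un_le)
  also have "\<dots> \<le> card (list_span us) + card (list_span us)"
    by (intro add_left_mono card_image_le) simp
  finally show ?case using Cons by simp
qed simp

section \<open>Adjacency, transvections and isometries\<close>

locale symplectic =
  fixes B :: "bit ^ 'n \<Rightarrow> bit ^ 'n \<Rightarrow> bit"
  assumes symplectic_form: "symplectic_form B"
begin

definition adj :: "bit ^ 'n \<Rightarrow> bit ^ 'n \<Rightarrow> bool" (infix "\<bowtie>" 50)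
  where "u \<bowtie> v \<longleftrightarrow> B u v = 1"

abbreviation tv :: "bit ^ 'n \<Rightarrow> bit ^ 'n \<Rightarrow> bit ^ 'n" where "tv \<equiv> transvection B"

lemma B_add: "B (u + v) w = B u w + B v w" "B w (u + v) = B w u + B w v"
  using symplectic_form
  by (auto simp: symplectic_form_def Vector_Spaces.linear_iff)

lemma B_self: "B v v = 0"
  using symplectic_form by (simp add: symplectic_form_def)

lemma adj_irrefl [simp]: "\<not> u \<bowtie> u"
  by (simp add: adj_def B_self)

lemma adj_add_left [simp]: "u + v \<bowtie> w \<longleftrightarrow> (u \<bowtie> w) \<noteq> (v \<bowtie> w)"
  unfolding adj_def B_add by (cases "B u w"; cases "B v w") auto

lemma adj_add_right [simp]: "w \<bowtie> u + v \<longleftrightarrow> (w \<bowtie> u) \<noteq> (w \<bowtie> v)"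
  unfolding adj_def B_add by (cases "B w u"; cases "B w v") auto

lemma adj_sym: "u \<bowtie> v \<longleftrightarrow> v \<bowtie> u"
  using adj_irrefl[of "u + v"] unfolding adj_add_left adj_add_right by simp

lemma adj_0 [simp]: "\<not> 0 \<bowtie> u" "\<not> u \<bowtie> 0"
  using adj_add_left[of 0 0 u] adj_add_right[of u 0 0] by auto

lemma adj_nondegenerate: "u \<noteq> 0 \<Longrightarrow> \<exists>v. u \<bowtie> v"
proof -
  assume "u \<noteq> 0"
  then obtain v where "B u v \<noteq> 0" using symplectic_form unfolding symplectic_form_def by blast
  then show ?thesis using bit_cases unfolding adj_def by blast
qed

lemma tv_apply: "tv v w = (if v \<bowtie> w then w + v else w)"
  using bit_cases[of "B v w"] by (auto simp: transvection_def adj_def)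

lemma tv_add: "tv v (x + y) = tv v x + tv v y"
  by (auto simp: tv_apply ac_simps)

lemma tv_tv [simp]: "tv v (tv v w) = w"
  by (auto simp: tv_apply ac_simps)

lemma tv_comp_self [simp]: "tv v \<circ> tv v = id"
  by (simp add: fun_eq_iff)

lemma tv_comp_self_left [simp]: "tv v \<circ> (tv v \<circ> f) = f"
  by (simp add: fun_eq_iff)

lemma tv_cancel: "tv v \<circ> f = tv v \<circ> g \<longleftrightarrow> f = g"
  by (metis tv_comp_self_left)

lemma tv_adj: "tv v x \<bowtie> tv v y \<longleftrightarrow> x \<bowtie> y"
  by (auto simp: tv_apply adj_sym[of x v])

text \<open>These are the elements of Sp(n,2): scalars and values of the form are only 0 and 1, so
  additivity gives linearity and adjacency determines the form.\<close>

definition isom :: "(bit ^ 'n \<Rightarrow> bit ^ 'n) \<Rightarrow> bool"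
  where "isom f \<longleftrightarrow> (\<forall>x y. f (x + y) = f x + f y) \<and> (\<forall>x y. f x \<bowtie> f y \<longleftrightarrow> x \<bowtie> y)"

lemma isom_add: "isom f \<Longrightarrow> f (x + y) = f x + f y"
  by (simp add: isom_def)

lemma isom_adj: "isom f \<Longrightarrow> f x \<bowtie> f y \<longleftrightarrow> x \<bowtie> y"
  by (simp add: isom_def)

lemma isom_tv [simp]: "isom (tv v)"
  by (simp add: isom_def tv_add tv_adj)

lemma isom_comp [simp]: "isom f \<Longrightarrow> isom g \<Longrightarrow> isom (f \<circ> g)"
  by (simp add: isom_def)

lemma isom_conj: "isom f \<Longrightarrow> f \<circ> tv v = tv (f v) \<circ> f"
  by (auto simp: fun_eq_iff tv_apply isom_add isom_adj)

lemma tv_conj: "tv u \<circ> tv v = tv (tv u v) \<circ> tv u"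
  by (rule isom_conj) simp

text \<open>The double perp of a subspace is the subspace itself. If some \<open>z\<close>
  orthogonal to \<open>us\<close> is adjacent to \<open>u\<close>, then \<open>v\<close> is
  corrected by \<open>u\<close> so as to become orthogonal to \<open>z\<close>, and the induction
  hypothesis applies to the corrected vector.\<close>

lemma list_span_perp:
  assumes "\<And>w. (\<forall>u\<in>set us. \<not> u \<bowtie> w) \<Longrightarrow> \<not> v \<bowtie> w"
  shows "v \<in> list_span us"
  using assms
proof (induction us arbitrary: v)
  case Nil
  then show ?case using adj_nondegenerate by auto
next
  case (Cons u us)
  show ?case
  proof (cases "\<exists>w. (\<forall>x\<in>set us. \<not> x \<bowtie> w) \<and> u \<bowtie> w")
    case False
    then have "v \<in> list_span us" using Cons by (metis set_ConsD)
    then show ?thesis by simp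
  next
    case True
    then obtain z where z: "\<forall>x\<in>set us. \<not> x \<bowtie> z" "u \<bowtie> z" by blast
    define v' where "v' = (if v \<bowtie> z then u + v else v)"
    have "v' \<in> list_span us"
    proof (rule Cons.IH)
      fix w assume w: "\<forall>x\<in>set us. \<not> x \<bowtie> w"
      show "\<not> v' \<bowtie> w"
      proof (cases "u \<bowtie> w")
        case True
        \<comment> \<open>Both \<open>w\<close> and \<open>z\<close> are adjacent to
          \<open>u\<close>, so their sum is orthogonal to it and the hypothesis on \<open>v\<close>
          applies.\<close>
        then have "\<not> v \<bowtie> w + z" using Cons.prems[of "w + z"] z w by auto
        then show ?thesis using True by (auto simp: v'_def)
      next
        case False
        then show ?thesis using Cons.prems[of w] w by (auto simp: v'_def)
      qed
    qed
    then show ?thesis unfolding v'_def by (cases "v \<bowtie> z") (auto simp: image_iff intro!: bexI[of _ "u + v"])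
  qed
qed

definition sols :: "(bit ^ 'n) list \<Rightarrow> bool list \<Rightarrow> (bit ^ 'n) set"
  where "sols us \<beta> = {v. list_all2 (\<lambda>u b. (u \<bowtie> v) = b) us \<beta>}"

text \<open>Each independent equation halves the solution set: translation by a vector
  \<open>z\<close> orthogonal to \<open>us\<close> and adjacent to \<open>u\<close> exchanges the
  two halves.\<close>

lemma card_sols:
  "indep us \<Longrightarrow> length us = length \<beta> \<Longrightarrow> card (sols us \<beta>) * 2 ^ length us = 2 ^ CARD('n)"
proof (induction us \<beta> rule: list_induct2')
  case 1
  then show ?case by (simp add: sols_def)
next
  case (4 u us b \<beta>)
  obtain z where z: "\<forall>x\<in>set us. \<not> x \<bowtie> z" "u \<bowtie> z"
    using list_span_perp[of us u] 4(2) by auto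
  let ?A = "\<lambda>c. {v \<in> sols us \<beta>. (u \<bowtie> v) = c}"
  have sh: "v + z \<in> sols us \<beta>" if "v \<in> sols us \<beta>" for v
    using that z(1) unfolding sols_def list_all2_conv_all_nth by auto
  have "bij_betw (\<lambda>v. v + z) (?A b) (?A (\<not> b))"
    by (rule bij_betwI[of _ _ _ "\<lambda>v. v + z"]) (auto simp: sh z(2) add.assoc)
  from bij_betw_same_card[OF this] have eq: "card (?A (\<not> b)) = card (?A b)" by (rule sym)
  have "card (?A b \<union> ?A (\<not> b)) = card (?A b) + card (?A (\<not> b))"
    by (rule card_Un_disjoint) auto
  moreover have "?A b \<union> ?A (\<not> b) = sols us \<beta>" by auto
  ultimately have "card (sols us \<beta>) = card (?A b) + card (?A (\<not> b))" by simp
  moreover have "sols (u # us) (b # \<beta>) = ?A b" by (auto simp: sols_def)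
  ultimately show ?case using 4 eq by (simp add: algebra_simps)
qed simp_all

text \<open>The source of the later choices of vectors in general position: the solutions outnumber
  the forbidden vectors.\<close>

lemma sols_avoiding:
  assumes "indep us" "length us = length \<beta>" "card Bad * 2 ^ length us < 2 ^ CARD('n)"
  obtains v where "v \<notin> Bad" "list_all2 (\<lambda>u b. (u \<bowtie> v) = b) us \<beta>"
proof -
  have "card Bad < card (sols us \<beta>)"
    using assms(3) card_sols[OF assms(1,2)] by (metis mult_less_cancel2)
  then have "\<not> sols us \<beta> \<subseteq> Bad" by (meson card_mono finite_bit_vec_set leD)
  then show ?thesis using that by (auto simp: sols_def)
qed

lemma sols_exists:
  assumes "indep us" "length us = length \<beta>"
  obtains v where "list_all2 (\<lambda>u b. (u \<bowtie> v) = b) us \<beta>"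
  using sols_avoiding[OF assms, of "{}"] by auto

lemma obtain_adj2:
  assumes "a \<noteq> 0" "b \<noteq> 0" "a \<noteq> b"
  obtains w where "(a \<bowtie> w) = \<alpha>" "(b \<bowtie> w) = \<beta>"
  using sols_exists[of "[a, b]" "[\<alpha>, \<beta>]"] assms by auto

lemma tv_inj: 
  assumes "tv a = tv b" shows "a = b"
proof (rule ccontr)
  assume ab: "a \<noteq> b"
  have *: False if h: "tv a = tv b" "a \<noteq> 0" "a \<noteq> b" for a b
  proof (cases "b = 0")
    case True
    obtain w where "a \<bowtie> w" using adj_nondegenerate[OF h(2)] by blast
    then show False using fun_cong[OF h(1), of w] True h(2) by (simp add: tv_apply)
  next
    case False
    obtain w where "a \<bowtie> w" "\<not> b \<bowtie> w" using obtain_adj2[of a b True False] h False by metis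
    then show False using fun_cong[OF h(1), of w] h(2) by (simp add: tv_apply)
  qed
  show False using * assms ab by metis
qed

lemma tv_eq_iff [simp]: "tv a = tv b \<longleftrightarrow> a = b"
  using tv_inj by blast

lemma tv_comp_tv_moves:
  "tv a (tv b w) + w \<in> {0, a, b, a + b}"
  by (auto simp: tv_apply add.assoc add.commute[of b a])

text \<open>Both \<open>a\<close> and \<open>b\<close> occur among the displacements
  \<open>g w + w\<close> of the product \<open>g\<close>, while the displacements of
  \<open>tv x \<circ> tv y\<close> are sums of \<open>x\<close> and \<open>y\<close>. Hence the
  product determines the plane spanned by \<open>a\<close> and \<open>b\<close>.\<close>

lemma tv_comp_tv_cases:
  assumes "tv x \<circ> tv y = tv a \<circ> tv b" "a \<noteq> 0" "b \<noteq> 0" "a \<noteq> b"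
  shows "x \<noteq> 0" "y \<noteq> 0" "x \<noteq> y" "{x, y} \<subseteq> {a, b, a + b}"
proof -
  have e: "tv x (tv y w) = tv a (tv b w)" for w using fun_cong[OF assms(1), of w] by simp
  obtain w where w: "\<not> b \<bowtie> w" "a \<bowtie> w" using obtain_adj2[of a b True False] assms by metis
  obtain w' where w': "b \<bowtie> w'" "a \<bowtie> w' + b" 
    using obtain_adj2[of a b "\<not> a \<bowtie> b" True] assms by (metis adj_add_right)
  obtain w'' where w'': "b \<bowtie> w''" "\<not> a \<bowtie> w'' + b" 
    using obtain_adj2[of a b "a \<bowtie> b" True] assms by (metis adj_add_right)
  have 1: "a \<in> {0, x, y, x + y}" using tv_comp_tv_moves[of x y w] w unfolding e by (simp add: tv_apply)
  have 2: "b \<in> {0, x, y, x + y}" using tv_comp_tv_moves[of x y w''] w'' unfolding e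
    by (simp add: tv_apply ac_simps)
  show "x \<noteq> 0" "y \<noteq> 0" "x \<noteq> y" using 1 2 assms(2-4) by auto
  show "{x, y} \<subseteq> {a, b, a + b}" using 1 2 assms(2-4) by (auto simp: ac_simps)
qed

text \<open>The three transvections of a totally isotropic plane commute. If \<open>a + b\<close>
  occurred as a factor, cancelling the other one would identify two different transvections.\<close>

lemma tv_pair_perp:
  assumes "tv x \<circ> tv y = tv a \<circ> tv b" "a \<noteq> 0" "b \<noteq> 0" "a \<noteq> b" "\<not> a \<bowtie> b"
  shows "(x, y) = (a, b) \<or> (x, y) = (b, a)"
proof -
  note c = tv_comp_tv_cases[OF assms(1-4)]
  have comm: "tv a \<circ> tv b = tv b \<circ> tv a" using tv_conj[of a b] assms(5) by (simp add: tv_apply)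
  have 1: "x \<noteq> a + b" 
  proof
    assume x: "x = a + b"
    have "tv x \<circ> tv y = tv y \<circ> tv x" using tv_conj[of x y] c(4) x assms(5)
      by (auto simp: tv_apply adj_sym[of b a])
    then have "y = a \<or> y = b" using c(3,4) x by auto
    then show False
    proof
      assume "y = a"
      then have "tv x = tv b" using assms(1) comm \<open>tv x \<circ> tv y = tv y \<circ> tv x\<close> by (metis tv_cancel)
      then show False using x assms(2) by (simp add: bit_vec_add_eq_iff)
    next
      assume "y = b"
      then have "tv x = tv a" using assms(1) comm \<open>tv x \<circ> tv y = tv y \<circ> tv x\<close> by (metis tv_cancel)
      then show False using x assms(3) by (simp add: bit_vec_add_eq_iff)
    qed
  qed
  have "x = a \<or> x = b" using 1 c by auto
  then show ?thesis using assms(1) comm by (metis tv_cancel tv_eq_iff)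
qed

text \<open>The transvections along \<open>a\<close>, \<open>b\<close>, \<open>a + b\<close> are the
  transpositions of an \<open>S_3\<close>, in which a 3-cycle is a product of two transpositions in
  three ways.\<close>

lemma tv_pair_adj:
  assumes "tv x \<circ> tv y = tv a \<circ> tv b" "a \<bowtie> b"
  shows "(x, y) = (a, b) \<or> (x, y) = (b, a + b) \<or> (x, y) = (a + b, a)"
proof -
  have n: "a \<noteq> 0" "b \<noteq> 0" "a \<noteq> b" using assms(2) by auto
  note c = tv_comp_tv_cases[OF assms(1) n]
  have 1: "tv a \<circ> tv b = tv b \<circ> tv (a + b)" 
    using tv_conj[of b "a + b"] assms(2) adj_sym[of a b] by (simp add: tv_apply add.assoc)
  have 2: "tv a \<circ> tv b = tv (a + b) \<circ> tv a" 
    using tv_conj[of a b] assms(2) by (simp add: tv_apply add.commute)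
  have "x = a \<or> x = b \<or> x = a + b" using c by auto
  then show ?thesis using assms(1) 1 2 by (metis tv_cancel tv_eq_iff)
qed

lemma tv_pair_adj_eqs:
  assumes "a \<bowtie> b"
  shows "tv b \<circ> tv (a + b) = tv a \<circ> tv b" "tv (a + b) \<circ> tv a = tv a \<circ> tv b"
proof -
  show "tv b \<circ> tv (a + b) = tv a \<circ> tv b"
    using tv_conj[of b "a + b"] assms adj_sym[of a b] by (simp add: tv_apply add.assoc)
  show "tv (a + b) \<circ> tv a = tv a \<circ> tv b"
    using tv_conj[of a b] assms by (simp add: tv_apply add.commute)
qed

lemma tv_commute: "\<not> a \<bowtie> b \<Longrightarrow> tv a \<circ> tv b = tv b \<circ> tv a"
  using tv_conj[of a b] by (simp add: tv_apply)

end

section \<open>Products of two and three transvections\<close>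

text \<open>The coefficient of \<open>g\<close> in the product of the two set sums in the group
  algebra; \<open>prods\<close> is the support of that product.\<close>

definition conv :: "('a \<Rightarrow> 'a) set \<Rightarrow> ('a \<Rightarrow> 'a) set \<Rightarrow> ('a \<Rightarrow> 'a) \<Rightarrow> nat"
  where "conv E F g = card {(x, y). x \<in> E \<and> y \<in> F \<and> x \<circ> y = g}"

definition prods :: "('a \<Rightarrow> 'a) set \<Rightarrow> ('a \<Rightarrow> 'a) set \<Rightarrow> ('a \<Rightarrow> 'a) set"
  where "prods E F = {x \<circ> y | x y. x \<in> E \<and> y \<in> F}"

lemma finite_conv: "finite {(x, y :: bit ^ 'n \<Rightarrow> bit ^ 'n). x \<in> E \<and> y \<in> F \<and> x \<circ> y = (g :: bit ^ 'n \<Rightarrow> bit ^ 'n)}"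
  by (rule finite_subset[of _ "E \<times> F"]) auto

lemma conv_pos_iff: "conv E F g > 0 \<longleftrightarrow> g \<in> prods E (F :: (bit ^ 'n \<Rightarrow> bit ^ 'n) set)"
  unfolding conv_def prods_def card_gt_0_iff using finite_conv[of E F g] by auto

lemma conv_ge:
  assumes "\<And>q. q \<in> Q \<Longrightarrow> fst q \<in> E \<and> snd q \<in> F \<and> fst q \<circ> snd q = (g :: bit ^ 'n \<Rightarrow> bit ^ 'n)"
  shows "card Q \<le> conv E F g"
  unfolding conv_def by (rule card_mono[OF finite_conv]) (use assms in force)

context symplectic
begin

definition V0 :: "(bit ^ 'n) set" where "V0 = UNIV - {0}"

lemma V0_iff [simp]: "v \<in> V0 \<longleftrightarrow> v \<noteq> 0"
  by (simp add: V0_def)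

text \<open>The condition \<open>a \<noteq> b\<close> keeps out the identity, whose number of
  factorizations is of a different order.\<close>

definition perp_pairs :: "(bit ^ 'n) set \<Rightarrow> (bit ^ 'n) set \<Rightarrow> (bit ^ 'n \<Rightarrow> bit ^ 'n) set"
  where "perp_pairs X Y = {tv a \<circ> tv b | a b. a \<in> X \<and> b \<in> Y \<and> a \<noteq> b \<and> \<not> a \<bowtie> b}"

definition adj_pairs :: "(bit ^ 'n \<Rightarrow> bit ^ 'n) set"
  where "adj_pairs = {tv a \<circ> tv b | a b. a \<bowtie> b}"

definition four_cycles :: "(bit ^ 'n \<Rightarrow> bit ^ 'n) set"
  where "four_cycles =
    {tv b \<circ> (tv c \<circ> tv d) | b c d. b \<bowtie> c \<and> b \<bowtie> d \<and> \<not> c \<bowtie> d \<and> c \<noteq> d}"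

lemma perp_pairs_iff:
  assumes "a \<noteq> 0" "b \<noteq> 0" "a \<noteq> b" "\<not> a \<bowtie> b" "0 \<notin> X" "0 \<notin> Y"
  shows "tv a \<circ> tv b \<in> perp_pairs X Y \<longleftrightarrow> a \<in> X \<and> b \<in> Y \<or> b \<in> X \<and> a \<in> Y"
proof
  assume "tv a \<circ> tv b \<in> perp_pairs X Y"
  then obtain x y where xy: "x \<in> X" "y \<in> Y" "tv x \<circ> tv y = tv a \<circ> tv b" unfolding perp_pairs_def by force
  show "a \<in> X \<and> b \<in> Y \<or> b \<in> X \<and> a \<in> Y" using tv_pair_perp[OF xy(3) assms(1-4)] xy by auto
next
  assume "a \<in> X \<and> b \<in> Y \<or> b \<in> X \<and> a \<in> Y"
  then show "tv a \<circ> tv b \<in> perp_pairs X Y"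
    using assms tv_commute[of a b] adj_sym[of a b] unfolding perp_pairs_def by auto metis
qed

lemma conv_tv_id: "conv (tv ` V0) (tv ` V0) id \<ge> 2 ^ CARD('n) - 1"
proof -
  have "card ((\<lambda>a. (tv a, tv a)) ` V0) = card V0" by (rule card_image) (auto simp: inj_on_def)
  also have "\<dots> = 2 ^ CARD('n) - 1" by (simp add: V0_def)
  finally show ?thesis using conv_ge[of "(\<lambda>a. (tv a, tv a)) ` V0" "tv ` V0" "tv ` V0" id] by force
qed

lemma conv_tv_perp:
  assumes "a \<noteq> 0" "b \<noteq> 0" "a \<noteq> b" "\<not> a \<bowtie> b"
  shows "conv (tv ` V0) (tv ` V0) (tv a \<circ> tv b) = 2"
proof -
  have "{(x, y). x \<in> tv ` V0 \<and> y \<in> tv ` V0 \<and> x \<circ> y = tv a \<circ> tv b} = {(tv a, tv b), (tv b, tv a)}"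
    using tv_pair_perp[OF _ assms] tv_commute[of a b] assms by auto
  then show ?thesis using assms by (simp add: conv_def)
qed

lemma conv_tv_adj:
  assumes "a \<bowtie> b"
  shows "conv (tv ` V0) (tv ` V0) (tv a \<circ> tv b) = 3"
proof -
  have n: "a \<noteq> 0" "b \<noteq> 0" "a \<noteq> b" using assms by auto
  have "{(x, y). x \<in> tv ` V0 \<and> y \<in> tv ` V0 \<and> x \<circ> y = tv a \<circ> tv b} =
      {(tv a, tv b), (tv b, tv (a + b)), (tv (a + b), tv a)}"
    using tv_pair_adj[OF _ assms] tv_pair_adj_eqs[OF assms] n by auto
  then show ?thesis using n by (simp add: conv_def bit_vec_add_eq_iff)
qed

text \<open>In \<open>S_4\<close> this is the identity
  \<open>(j l)(j k)(l i) = (i k)(i j)(k l)\<close>: a 4-cycle can be built from either diagonal,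
  \<open>b\<close> or \<open>b + c + d\<close>, of its square.\<close>

lemma four_cycle_eq:
  assumes "b \<bowtie> c" "b \<bowtie> d" "\<not> c \<bowtie> d"
  shows "tv (b + c + d) \<circ> (tv (b + c) \<circ> tv (b + d)) = tv b \<circ> (tv c \<circ> tv d)"
  using assms adj_sym[of c b] adj_sym[of d b] adj_sym[of d c]
  by (auto simp: fun_eq_iff tv_apply ac_simps)

lemma four_cycle_factors:
  assumes h: "b \<bowtie> c" "b \<bowtie> d" "\<not> c \<bowtie> d" "c \<noteq> d"
    and eq: "tv x \<circ> (tv y \<circ> tv z) = tv b \<circ> (tv c \<circ> tv d)" and yz: "\<not> y \<bowtie> z"
  shows "x = b \<and> tv y \<circ> tv z = tv c \<circ> tv d \<or>
    x = b + c + d \<and> tv y \<circ> tv z = tv (b + c) \<circ> tv (b + d)"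
proof -
  define f where "f = tv b \<circ> (tv c \<circ> tv d)"
  have f: "isom f" unfolding f_def by simp
  \<comment> \<open>As \<open>tv y \<circ> tv z\<close> is an involution, \<open>f \<circ> f\<close> is a product of two transvections, which determines them.\<close>
  have sq: "f \<circ> f = tv (f x) \<circ> tv x" if "f = tv x \<circ> (tv y \<circ> tv z)" "\<not> y \<bowtie> z" for x y z
  proof -
    define e where "e = tv y \<circ> tv z"
    have e: "e \<circ> e = id" unfolding e_def using tv_commute[OF that(2)] by (metis comp_assoc tv_comp_self tv_comp_self_left)
    have fe: "f = tv x \<circ> e" using that(1) by (simp add: e_def)
    have "tv x \<circ> f = e" by (simp add: fe)
    then have "f \<circ> (tv x \<circ> f) = tv x" using e by (simp add: fe comp_assoc)
    moreover have "f \<circ> (tv x \<circ> f) = tv (f x) \<circ> (f \<circ> f)" using isom_conj[OF f, of x] by (metis comp_assoc)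
    ultimately show ?thesis by (metis tv_comp_self_left)
  qed
  \<comment> \<open>The quarter turn \<open>f\<close> of the square takes one diagonal to the
    other.\<close>
  have fb: "f b = b + c + d" using h adj_sym[of c b] adj_sym[of d b] adj_sym[of d c]
    by (auto simp: f_def tv_apply ac_simps)
  have eq2: "tv (f x) \<circ> tv x = tv (b + c + d) \<circ> tv b"
    using sq[of b c d] sq[of x y z] h(3) yz eq fb by (simp add: f_def)
  have nz: "b + c + d \<noteq> 0" "b \<noteq> 0" "b + c + d \<noteq> b" "\<not> b + c + d \<bowtie> b"
    using h adj_sym[of c b] adj_sym[of d b] by (auto simp: bit_vec_add_eq_iff add.assoc) 
  have "x = b \<or> x = b + c + d" using tv_pair_perp[OF eq2 nz] by auto
  then show ?thesis
  proof
    assume "x = b"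
    then show ?thesis using eq tv_cancel by metis
  next
    assume x: "x = b + c + d"
    have "tv x \<circ> (tv y \<circ> tv z) = tv x \<circ> (tv (b + c) \<circ> tv (b + d))"
      using four_cycle_eq[OF h(1-3)] eq x by simp
    then show ?thesis using x tv_cancel by metis
  qed
qed

lemma conv_four_cycle:
  assumes h: "b \<bowtie> c" "b \<bowtie> d" "\<not> c \<bowtie> d" "c \<noteq> d"
  shows "conv (tv ` V0) (perp_pairs V0 V0) (tv b \<circ> (tv c \<circ> tv d)) = 2"
proof -
  let ?b = "b + c + d"
  have nz: "b \<noteq> 0" "c \<noteq> 0" "d \<noteq> 0" "b \<noteq> c" "b \<noteq> d" using h by auto
  have 1: "tv c \<circ> tv d \<in> perp_pairs V0 V0" using h nz by (auto simp: perp_pairs_def)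
  have n2: "b + c \<noteq> b + d" "\<not> b + c \<bowtie> b + d" "?b \<noteq> 0" "b \<noteq> ?b"
    using h adj_sym[of c b] adj_sym[of d b] by (auto simp: add.assoc)
  have 2: "tv (b + c) \<circ> tv (b + d) \<in> perp_pairs V0 V0"
    unfolding perp_pairs_def by (intro CollectI exI[of _ "b + c"] exI[of _ "b + d"]) (use n2 nz in auto)
  have "{(x, y). x \<in> tv ` V0 \<and> y \<in> perp_pairs V0 V0 \<and> x \<circ> y = tv b \<circ> (tv c \<circ> tv d)} =
      {(tv b, tv c \<circ> tv d), (tv ?b, tv (b + c) \<circ> tv (b + d))}" (is "?L = ?R")
  proof
    show "?L \<subseteq> ?R" using four_cycle_factors[OF h] by (fastforce simp: perp_pairs_def)
    show "?R \<subseteq> ?L" using 1 2 nz n2 four_cycle_eq[OF h(1-3)] by auto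
  qed
  then show ?thesis using n2 by (simp add: conv_def)
qed

end

context symplectic
begin

lemma perp_pairsI: "a \<in> X \<Longrightarrow> b \<in> Y \<Longrightarrow> a \<noteq> b \<Longrightarrow> \<not> a \<bowtie> b \<Longrightarrow> tv a \<circ> tv b \<in> perp_pairs X Y"
  unfolding perp_pairs_def by blast

lemma card_le_conv_perp_pairs:
  assumes "\<And>i. i \<in> I \<Longrightarrow> x i \<noteq> 0 \<and> y i \<noteq> 0 \<and> z i \<noteq> 0 \<and> y i \<noteq> z i \<and> \<not> y i \<bowtie> z i \<and> tv (x i) \<circ> (tv (y i) \<circ> tv (z i)) = h"
    and "inj_on x I"
  shows "card I \<le> conv (tv ` V0) (perp_pairs V0 V0) h"
proof -
  let ?f = "\<lambda>i. (tv (x i), tv (y i) \<circ> tv (z i))"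
  have "inj_on ?f I" using assms(2) by (auto simp: inj_on_def)
  then have "card I = card (?f ` I)" by (simp add: card_image)
  also have "\<dots> \<le> conv (tv ` V0) (perp_pairs V0 V0) h"
    by (rule conv_ge) (use assms(1) in \<open>auto intro!: perp_pairsI\<close>)
  finally show ?thesis .
qed

text \<open>Any other product of a transvection and a commuting pair has at least three
  factorizations: mutually commuting factors can be permuted, a 3-cycle can be rotated next to a
  factor commuting with it, and a single \<open>tv w\<close> equals
  \<open>tv q \<circ> (tv q \<circ> tv w)\<close> for each \<open>q\<close> orthogonal to
  \<open>w\<close>.\<close>

lemma four_cycles_eq_level:
  assumes n: "CARD('n) \<ge> 4"
  shows "four_cycles = {h. conv (tv ` V0) (perp_pairs V0 V0) h = 2}"
proof
  show "four_cycles \<subseteq> {h. conv (tv ` V0) (perp_pairs V0 V0) h = 2}"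
    unfolding four_cycles_def using conv_four_cycle by auto
  show "{h. conv (tv ` V0) (perp_pairs V0 V0) h = 2} \<subseteq> four_cycles"
  proof (rule subsetI, rule ccontr)
    fix h assume h2: "h \<in> {h. conv (tv ` V0) (perp_pairs V0 V0) h = 2}" and nh: "h \<notin> four_cycles"
    let ?c = "conv (tv ` V0) (perp_pairs V0 V0) h"
    have "h \<in> prods (tv ` V0) (perp_pairs V0 V0)" using h2 by (simp flip: conv_pos_iff)
    then obtain x y z where xyz: "x \<noteq> 0" "y \<noteq> 0" "z \<noteq> 0" "y \<noteq> z" "\<not> y \<bowtie> z"
      and h: "h = tv x \<circ> (tv y \<circ> tv z)" by (auto simp: prods_def perp_pairs_def)
    have three: False if "distinct [x1, x2, x3]"
      "\<And>i. i \<in> {0, 1, 2::nat} \<Longrightarrow> xx i \<noteq> 0 \<and> yy i \<noteq> 0 \<and> zz i \<noteq> 0 \<and> yy i \<noteq> zz i \<and> \<not> yy i \<bowtie> zz i \<and> tv (xx i) \<circ> (tv (yy i) \<circ> tv (zz i)) = h"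
      "xx 0 = x1" "xx 1 = x2" "xx 2 = x3" for xx yy zz x1 x2 x3
    proof -
      have "inj_on xx {0, 1, 2}" using that(1,3-5) by (auto simp: inj_on_def)
      then have "card {0, 1, 2::nat} \<le> ?c" using card_le_conv_perp_pairs[of "{0, 1, 2}" xx yy zz h] that(2) by blast
      then show False using h2 by simp
    qed
    have three': False if "distinct [x1, x2, x3]"
      "x1 \<noteq> 0 \<and> y1 \<noteq> 0 \<and> z1 \<noteq> 0 \<and> y1 \<noteq> z1 \<and> \<not> y1 \<bowtie> z1 \<and> tv x1 \<circ> (tv y1 \<circ> tv z1) = h"
      "x2 \<noteq> 0 \<and> y2 \<noteq> 0 \<and> z2 \<noteq> 0 \<and> y2 \<noteq> z2 \<and> \<not> y2 \<bowtie> z2 \<and> tv x2 \<circ> (tv y2 \<circ> tv z2) = h"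
      "x3 \<noteq> 0 \<and> y3 \<noteq> 0 \<and> z3 \<noteq> 0 \<and> y3 \<noteq> z3 \<and> \<not> y3 \<bowtie> z3 \<and> tv x3 \<circ> (tv y3 \<circ> tv z3) = h"
      for x1 x2 x3 y1 y2 y3 z1 z2 z3
      by (rule three[of x1 x2 x3 "\<lambda>i. [x1, x2, x3] ! i" "\<lambda>i. [y1, y2, y3] ! i" "\<lambda>i. [z1, z2, z3] ! i"])
        (use that in \<open>auto simp: numeral_2_eq_2\<close>)
    have pw: "(16::nat) \<le> 2 ^ CARD('n)" using power_increasing[OF n, of "2::nat"] by simp
    have deg: False if w: "w \<noteq> 0" and hw: "h = tv w" for w
    proof -
      \<comment> \<open>At least eight vectors are orthogonal to \<open>w\<close>, and at most four
        are forbidden at each choice.\<close>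
      obtain q1 where q1: "q1 \<notin> {0, w}" "\<not> w \<bowtie> q1"
        using sols_avoiding[of "[w]" "[False]" "set [0, w]"] card_length[of "[0, w]"] w pw by auto
      obtain q2 where q2: "q2 \<notin> {0, w, q1}" "\<not> w \<bowtie> q2"
        using sols_avoiding[of "[w]" "[False]" "set [0, w, q1]"] card_length[of "[0, w, q1]"] w pw by auto
      obtain q3 where q3: "q3 \<notin> {0, w, q1, q2}" "\<not> w \<bowtie> q3"
        using sols_avoiding[of "[w]" "[False]" "set [0, w, q1, q2]"] card_length[of "[0, w, q1, q2]"] w pw by auto
      show False
        by (rule three'[of q1 q2 q3 q1 w q2 w q3 w]) (use q1 q2 q3 w hw adj_sym in auto)
    qed
    have half: False if "x \<noteq> 0" "y \<noteq> 0" "z \<noteq> 0" "x \<bowtie> y" "\<not> x \<bowtie> z" "\<not> y \<bowtie> z" and h: "h = tv x \<circ> (tv y \<circ> tv z)" for x y z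
    proof -
      have e: "tv y \<circ> (tv (x + y) \<circ> tv z) = h" "tv (x + y) \<circ> (tv x \<circ> tv z) = h"
        using tv_pair_adj_eqs[OF that(4)] unfolding h comp_assoc[symmetric] by simp_all
      have "x + y \<noteq> z" "x \<noteq> y" "x \<noteq> z" "y \<noteq> z" using that adj_sym by (auto simp: bit_vec_add_eq_iff)
      then show False
        by (intro three'[of x y "x + y" y z "x + y" z x z]) (use that e in \<open>auto simp: bit_vec_add_eq_iff\<close>)
    qed
    show False
    proof (cases "x \<bowtie> y"; cases "x \<bowtie> z")
      assume "x \<bowtie> y" "x \<bowtie> z"
      then show False using nh h xyz unfolding four_cycles_def by blast
    next
      assume "x \<bowtie> y" "\<not> x \<bowtie> z"
      then show False using half[of x y z] xyz h by blast
    next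
      assume "\<not> x \<bowtie> y" "x \<bowtie> z"
      then show False using half[of x z y] xyz h tv_commute[OF xyz(5)] adj_sym[of z y] by simp
    next
      assume p: "\<not> x \<bowtie> y" "\<not> x \<bowtie> z"
      note c = tv_commute[OF p(1)] tv_commute[OF p(2)] tv_commute[OF xyz(5)]
      have e: "tv y \<circ> (tv x \<circ> tv z) = h" "tv z \<circ> (tv x \<circ> tv y) = h"
      proof -
        have "tv y \<circ> (tv x \<circ> tv z) = (tv x \<circ> tv y) \<circ> tv z" unfolding c(1) by (simp add: comp_assoc)
        then show "tv y \<circ> (tv x \<circ> tv z) = h" by (simp add: h comp_assoc)
        have "tv z \<circ> (tv x \<circ> tv y) = (tv x \<circ> tv z) \<circ> tv y" unfolding c(2) by (simp add: comp_assoc)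
        also have "\<dots> = tv x \<circ> (tv y \<circ> tv z)" unfolding c(3) by (simp add: comp_assoc)
        finally show "tv z \<circ> (tv x \<circ> tv y) = h" by (simp add: h)
      qed
      consider "x = y" | "x = z" | "x \<noteq> y" "x \<noteq> z" by blast
      then show False
      proof cases
        case 1
        then show False using deg[of z] h xyz by simp
      next
        case 2
        then show False using deg[of y] h xyz c by simp
      next
        case 3
        then show False
          by (intro three'[of x y z y z x z x y]) (use xyz p e h in auto)
      qed
    qed
  qed
qed

end

section \<open>The algebra of S-sets\<close>

text \<open>What is kept of the Schur ring is its S-sets, as sets of maps. The condition
  \<open>k > 0\<close> is essential for the levels: level 0 contains all maps outside the group.
  Complements are therefore formed as differences of S-sets.\<close>

locale schur_sets = symplectic B for B :: "bit ^ 'n \<Rightarrow> bit ^ 'n \<Rightarrow> bit" +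
  fixes SS :: "(bit ^ 'n \<Rightarrow> bit ^ 'n) set set"
  assumes dim: "CARD('n) \<ge> 14" and even_dim: "even CARD('n)"
    and SS_diff: "E \<in> SS \<Longrightarrow> F \<in> SS \<Longrightarrow> E - F \<in> SS"
    and SS_un: "E \<in> SS \<Longrightarrow> F \<in> SS \<Longrightarrow> E \<union> F \<in> SS"
    and SS_level: "E \<in> SS \<Longrightarrow> F \<in> SS \<Longrightarrow> k > 0 \<Longrightarrow> {g. conv E F g = k} \<in> SS"
    and SS_comm: "E \<in> SS \<Longrightarrow> F \<in> SS \<Longrightarrow> conv E F g = conv F E g"
    and SS_transvections: "tv ` V0 \<in> SS"
begin

text \<open>The S-sets of transvections, read as sets of vectors; \<open>0\<close> is kept out
  because \<open>tv 0\<close> is the identity.\<close>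

definition VV :: "(bit ^ 'n) set set" where "VV = {X. 0 \<notin> X \<and> tv ` X \<in> SS}"

lemma SS_int: "E \<in> SS \<Longrightarrow> F \<in> SS \<Longrightarrow> E \<inter> F \<in> SS"
  using SS_diff[of E "E - F"] SS_diff[of E F] by (simp add: Diff_Diff_Int)

lemma SS_prods:
  assumes "E \<in> SS" "F \<in> SS" shows "prods E F \<in> SS"
proof -
  have fin: "(\<Union>k\<in>K. {g. conv E F g = k}) \<in> SS" if "finite K" "0 \<notin> K" for K
    using that
  proof (induction K)
    case empty
    then show ?case using SS_diff[OF assms(1) assms(1)] by simp
  next
    case (insert k K)
    then show ?case using SS_un[OF SS_level[OF assms, of k]] by auto
  qed
  have "prods E F = (\<Union>k\<in>range (conv E F) - {0}. {g. conv E F g = k})"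
    by (auto simp flip: conv_pos_iff)
  then show ?thesis using fin[of "range (conv E F) - {0}"] finite_bit_vec_maps[of UNIV] by simp
qed

lemma VV_0: "X \<in> VV \<Longrightarrow> 0 \<notin> X"
  by (simp add: VV_def)

lemma VV_SS: "X \<in> VV \<Longrightarrow> tv ` X \<in> SS"
  by (simp add: VV_def)

lemma inj_tv: "inj tv"
  by (rule injI) simp

lemma VV_diff: "X \<in> VV \<Longrightarrow> Y \<in> VV \<Longrightarrow> X - Y \<in> VV"
  by (simp add: VV_def image_set_diff[OF inj_tv] SS_diff)

lemma VV_un: "X \<in> VV \<Longrightarrow> Y \<in> VV \<Longrightarrow> X \<union> Y \<in> VV"
  by (simp add: VV_def image_Un SS_un)

lemma VV_int: "X \<in> VV \<Longrightarrow> Y \<in> VV \<Longrightarrow> X \<inter> Y \<in> VV"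
  by (simp add: VV_def image_Int[OF inj_tv] SS_int)

lemma VV_V0: "V0 \<in> VV"
  using SS_transvections by (simp add: VV_def)

lemma VV_compl: "X \<in> VV \<Longrightarrow> V0 - X \<in> VV"
  by (rule VV_diff[OF VV_V0])

lemma SS_products:
  shows adj_pairs_SS: "adj_pairs \<in> SS" and perp_pairs_V0_SS: "perp_pairs V0 V0 \<in> SS"
proof -
  \<comment> \<open>The identity has so many factorizations that it falls neither into level 2 nor
    into level 3.\<close>
  have "(2::nat) ^ 14 \<le> 2 ^ CARD('n)" using dim by (rule power_increasing) simp
  then have id: "conv (tv ` V0) (tv ` V0) id > 3" using conv_tv_id by simp
  have cases: "g = id \<or> g \<in> adj_pairs \<or> g \<in> perp_pairs V0 V0" if "conv (tv ` V0) (tv ` V0) g > 0" for g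
  proof -
    have "g \<in> prods (tv ` V0) (tv ` V0)" using that by (simp only: conv_pos_iff)
    then obtain x y where "x \<in> tv ` V0" "y \<in> tv ` V0" "g = x \<circ> y" unfolding prods_def by blast
    then obtain a b where "a \<in> V0" "b \<in> V0" and g: "g = tv a \<circ> tv b" by blast
    then show ?thesis by (cases "a = b"; cases "a \<bowtie> b") (auto simp: adj_pairs_def perp_pairs_def)
  qed
  have 3: "conv (tv ` V0) (tv ` V0) g = 3" if "g \<in> adj_pairs" for g
    using that conv_tv_adj by (auto simp: adj_pairs_def)
  have 2: "conv (tv ` V0) (tv ` V0) g = 2" if "g \<in> perp_pairs V0 V0" for g
    using that conv_tv_perp by (auto simp: perp_pairs_def)
  have "g \<in> adj_pairs \<longleftrightarrow> conv (tv ` V0) (tv ` V0) g = 3" for g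
    using cases[of g] 2[of g] 3[of g] id by (cases "g = id") auto
  then have "adj_pairs = {g. conv (tv ` V0) (tv ` V0) g = 3}" by blast
  then show "adj_pairs \<in> SS" using SS_level[OF SS_transvections SS_transvections] by simp
  have "g \<in> perp_pairs V0 V0 \<longleftrightarrow> conv (tv ` V0) (tv ` V0) g = 2" for g
    using cases[of g] 2[of g] 3[of g] id by (cases "g = id") auto
  then have "perp_pairs V0 V0 = {g. conv (tv ` V0) (tv ` V0) g = 2}" by blast
  then show "perp_pairs V0 V0 \<in> SS" using SS_level[OF SS_transvections SS_transvections] by simp
qed

lemma four_cycles_SS: "four_cycles \<in> SS"
  using four_cycles_eq_level SS_level[OF SS_transvections perp_pairs_V0_SS, of 2] dim by simp

lemma perp_pairs_SS:
  assumes "X \<in> VV" "Y \<in> VV" shows "perp_pairs X Y \<in> SS"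
proof -
  note z = VV_0[OF assms(1)] VV_0[OF assms(2)]
  have "perp_pairs X Y = perp_pairs V0 V0 \<inter> prods (tv ` X) (tv ` Y)"
  proof (intro equalityI subsetI)
    fix g assume "g \<in> perp_pairs X Y"
    then show "g \<in> perp_pairs V0 V0 \<inter> prods (tv ` X) (tv ` Y)"
      using z by (fastforce simp: perp_pairs_def prods_def)
  next
    fix g assume g: "g \<in> perp_pairs V0 V0 \<inter> prods (tv ` X) (tv ` Y)"
    then obtain a b where ab: "a \<noteq> 0" "b \<noteq> 0" "a \<noteq> b" "\<not> a \<bowtie> b" "g = tv a \<circ> tv b"
      by (auto simp: perp_pairs_def)
    obtain x y where xy: "x \<in> X" "y \<in> Y" "tv x \<circ> tv y = tv a \<circ> tv b" using g ab(5) by (auto simp: prods_def)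
    have "a \<in> X \<and> b \<in> Y \<or> b \<in> X \<and> a \<in> Y" using tv_pair_perp[OF xy(3) ab(1-4)] xy by auto
    then show "g \<in> perp_pairs X Y" using perp_pairs_iff[OF ab(1-4) z] ab(5) by simp
  qed
  then show ?thesis using SS_int[OF perp_pairs_V0_SS SS_prods[OF VV_SS[OF assms(1)] VV_SS[OF assms(2)]]] by simp
qed

lemma tv_pair_adj_pairs_iff:
  assumes "a \<noteq> 0" "b \<noteq> 0" shows "tv a \<circ> tv b \<in> adj_pairs \<longleftrightarrow> a \<bowtie> b"
proof
  assume "tv a \<circ> tv b \<in> adj_pairs"
  then obtain x y where xy: "x \<bowtie> y" "tv a \<circ> tv b = tv x \<circ> tv y" by (auto simp: adj_pairs_def)
  show "a \<bowtie> b" using tv_pair_adj[OF xy(2,1)] xy(1) adj_sym by auto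
qed (auto simp: adj_pairs_def)

text \<open>Since \<open>tv b = tv a \<circ> (tv a \<circ> tv b)\<close>, where the second factor
  belongs to \<open>adj_pairs\<close> iff \<open>a\<close> is adjacent to \<open>b\<close>, the
  number of neighbours of \<open>b\<close> in \<open>X\<close> is a coefficient of a product of two
  S-sets.\<close>

lemma degree_level_VV:
  assumes "X \<in> VV" shows "{b \<in> V0. card {a \<in> X. a \<bowtie> b} = k} \<in> VV"
proof -
  note s = VV_SS[OF assms] adj_pairs_SS
  have c: "conv (tv ` X) adj_pairs (tv b) = card {a \<in> X. a \<bowtie> b}" if b: "b \<noteq> 0" for b
  proof -
    let ?f = "\<lambda>a. (tv a, tv a \<circ> tv b)"
    have "{(x, y). x \<in> tv ` X \<and> y \<in> adj_pairs \<and> x \<circ> y = tv b} = ?f ` {a \<in> X. a \<bowtie> b}"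
    proof (intro equalityI subsetI)
      fix p assume "p \<in> {(x, y). x \<in> tv ` X \<and> y \<in> adj_pairs \<and> x \<circ> y = tv b}"
      then obtain a y where a: "a \<in> X" "y \<in> adj_pairs" "tv a \<circ> y = tv b" "p = (tv a, y)" by auto
      have y: "y = tv a \<circ> tv b" using a(3) by (metis tv_comp_self_left)
      have "a \<noteq> 0" using a(1) VV_0[OF assms] by auto
      then have "a \<bowtie> b" using tv_pair_adj_pairs_iff a(2) y b by simp
      then show "p \<in> ?f ` {a \<in> X. a \<bowtie> b}" using a y by auto
    qed (auto simp: adj_pairs_def)
    moreover have "inj_on ?f {a \<in> X. a \<bowtie> b}" by (auto simp: inj_on_def)
    ultimately show ?thesis by (simp add: conv_def card_image)
  qed
  show ?thesis
  proof (cases "k = 0")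
    case False
    have "tv ` {b \<in> V0. card {a \<in> X. a \<bowtie> b} = k} = tv ` V0 \<inter> {g. conv (tv ` X) adj_pairs g = k}"
      using c by auto
    then show ?thesis
      using SS_int[OF SS_transvections SS_level[OF s]] False by (auto simp: VV_def)
  next
    case True
    \<comment> \<open>Level 0 is obtained as the complement of the support within the set of
      transvections.\<close>
    have "tv ` {b \<in> V0. card {a \<in> X. a \<bowtie> b} = k} = tv ` V0 - prods (tv ` X) adj_pairs"
      using c True by (auto simp: card_gt_0_iff simp flip: conv_pos_iff)
    then show ?thesis
      using SS_diff[OF SS_transvections SS_prods[OF s]] by (auto simp: VV_def)
  qed
qed

text \<open>The reversed product must have a factorization of \<open>tv x \<circ> tv y\<close> with
  the first factor from \<open>Y\<close> and the second from \<open>X\<close>. Of the three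
  factorizations, \<open>(x, y)\<close> itself does not qualify, and the other two contain the third
  point \<open>x + y\<close>.\<close>

lemma no_rainbow_line:
  assumes "X \<in> VV" "Y \<in> VV" "X \<inter> Y = {}" "x \<in> X" "y \<in> Y" "x \<bowtie> y"
  shows "x + y \<in> X \<union> Y"
proof -
  let ?g = "tv x \<circ> tv y"
  have "?g \<in> prods (tv ` X) (tv ` Y)" using assms by (auto simp: prods_def)
  then have "?g \<in> prods (tv ` Y) (tv ` X)"
    using SS_comm[OF VV_SS[OF assms(1)] VV_SS[OF assms(2)]] by (simp flip: conv_pos_iff)
  then obtain u v where uv: "u \<in> Y" "v \<in> X" "tv u \<circ> tv v = ?g" by (auto simp: prods_def)
  show ?thesis using tv_pair_adj[OF uv(3) assms(6)] uv assms(3-5) by auto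
qed

text \<open>
  The six transvections of a subgroup \<open>S\<^sub>4\<close> form the edges of a tetrahedron; \<open>{b, b + c + d}\<close>,
  \<open>{c, d}\<close> and \<open>{b + c, b + d}\<close> are its pairs of opposite edges.
\<close>

lemma opposite_edges:
  assumes X: "X \<in> VV" and Z: "Z \<in> VV" "W \<in> VV"
    and h: "b \<bowtie> c" "b \<bowtie> d" "\<not> c \<bowtie> d" "c \<noteq> d"
    and b: "b \<in> X" "b + c + d \<notin> X" and cd: "c \<in> Z" "d \<in> W"
  shows "b + c \<in> Z \<and> b + d \<in> W \<or> b + d \<in> Z \<and> b + c \<in> W"
proof -
  let ?h = "tv b \<circ> (tv c \<circ> tv d)"
  note z = VV_0[OF Z(1)] VV_0[OF Z(2)]
  note s = VV_SS[OF X] perp_pairs_SS[OF Z]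
  have "tv c \<circ> tv d \<in> perp_pairs Z W" using h cd by (auto simp: perp_pairs_def)
  then have "?h \<in> prods (tv ` X) (perp_pairs Z W)" unfolding prods_def using b by blast
  then have "?h \<in> prods (perp_pairs Z W) (tv ` X)" using SS_comm[OF s] by (simp flip: conv_pos_iff)
  then obtain y w x where ywx: "y \<in> Z" "w \<in> W" "\<not> y \<bowtie> w" "y \<noteq> w" "x \<in> X" "(tv y \<circ> tv w) \<circ> tv x = ?h"
    by (auto simp: prods_def perp_pairs_def)
  let ?e = "tv y \<circ> tv w"
  \<comment> \<open>Moving \<open>tv x\<close> to the front turns the reversed product into a
    factorization of the original shape, with \<open>?e x\<close> in place of
    \<open>x\<close>.\<close>
  have "tv (?e x) \<circ> ?e = ?h" using isom_conj[of ?e x] ywx(6) by simp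
  from four_cycle_factors[OF h this ywx(3)]
  have "?e x = b \<and> ?e = tv c \<circ> tv d \<or> ?e = tv (b + c) \<circ> tv (b + d)" by blast
  then show ?thesis
  proof
    \<comment> \<open>Here \<open>x\<close> would be the edge opposite to \<open>b\<close>, which is
      not in \<open>X\<close>.\<close>
    assume e: "?e x = b \<and> ?e = tv c \<circ> tv d"
    have "tv w (tv y b) = x" using e by (metis comp_apply tv_tv)
    moreover have "tv w (tv y b) = tv d (tv c b)"
      using e tv_commute[OF ywx(3)] tv_commute[OF h(3)] by (metis comp_apply)
    ultimately have "x = tv d (tv c b)" by simp
    also have "\<dots> = b + c + d" using h adj_sym by (auto simp: tv_apply)
    finally show ?thesis using b ywx(5) by simp
  next
    assume e: "?e = tv (b + c) \<circ> tv (b + d)"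
    have "tv (b + c) \<circ> tv (b + d) \<in> perp_pairs Z W" using perp_pairsI[OF ywx(1,2,4,3)] e by simp
    moreover have "b + c \<noteq> 0" "b + d \<noteq> 0" "b + c \<noteq> b + d" "\<not> b + c \<bowtie> b + d"
      using h adj_sym[of c b] by auto
    ultimately show ?thesis using perp_pairs_iff z by blast
  qed
qed

end

section \<open>Factorizations of a 7-cycle\<close>

context symplectic
begin

definition tvs :: "(bit ^ 'n) list \<Rightarrow> bit ^ 'n \<Rightarrow> bit ^ 'n"
  where "tvs cs = foldr (\<lambda>c f. tv c \<circ> f) cs id"

lemma tvs_simps [simp]: "tvs [] = id" "tvs (c # cs) = tv c \<circ> tvs cs"
  by (simp_all add: tvs_def)

lemma tvs_moves: "tvs cs w + w \<in> list_span cs"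
proof (induction cs)
  case (Cons c cs)
  have "tv c (tvs cs w) + w = (if c \<bowtie> tvs cs w then c + (tvs cs w + w) else tvs cs w + w)"
    by (simp add: tv_apply ac_simps)
  then show ?case using Cons by (auto simp del: bit_vec_add_self_mid)
qed simp

text \<open>The factors in front of \<open>b\<close> are conjugated while the length is kept, so
  what holds for a first factor holds for every factor.\<close>

lemma tvs_to_front: "tvs (xs @ b # ys) = tvs (b # map (tv b) xs @ ys)"
proof (induction xs)
  case (Cons x xs)
  have "tv b \<circ> tv (tv b x) = tv x \<circ> tv b" using tv_conj[of b "tv b x"] by simp
  then have "tv b (tv (tv b x) v) = tv x (tv b v)" for v by (metis comp_apply)
  then show ?case using Cons by (simp add: comp_def)
qed simp

text \<open>
  If \<open>g\<close> is a product of \<open>k\<close> transvections and \<open>g - 1\<close> has rank \<open>k\<close>, then a first factor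
  \<open>t\<^sub>b\<close> satisfies \<open>b = (g - 1) w\<close> with \<open>b \<cdot> w = 1\<close>.
\<close>

lemma front_factor:
  assumes g: "g = tvs (b # cs)" and k: "card U = 2 ^ Suc (length cs)"
    and U: "U = (\<lambda>w. g w + w) ` U"
  shows "\<exists>w\<in>U. b = g w + w \<and> b \<bowtie> w"
proof -
  have sub: "U \<subseteq> list_span (b # cs)"
  proof
    fix u assume "u \<in> U"
    then obtain w where "u = g w + w" using U by blast
    then show "u \<in> list_span (b # cs)" using tvs_moves[of "b # cs" w] g by simp
  qed
  have "card (list_span (b # cs)) \<le> card U" using card_list_span_le[of "b # cs"] k by simp
  then have eq: "U = list_span (b # cs)" using sub by (metis card_seteq finite_bit_vec_set)
  have b: "b \<notin> list_span cs"
  proof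
    assume "b \<in> list_span cs"
    then have "list_span (b # cs) \<subseteq> list_span cs" using list_span_add by auto
    then have "card U \<le> 2 ^ length cs" using card_list_span_le[of cs] card_mono[of "list_span cs" U] eq by (metis finite_bit_vec_set order_trans)
    then show False using k by simp
  qed
  have "b \<in> U" using eq set_subset_list_span[of "b # cs"] by simp
  then obtain w where w: "w \<in> U" "b = g w + w" using U by blast
  let ?y = "tvs cs w"
  have gw: "g w = (if b \<bowtie> ?y then ?y + b else ?y)" by (simp add: g tv_apply)
  \<comment> \<open>Otherwise \<open>b\<close> would be a displacement of the remaining factors
    alone and lie in \<open>list_span cs\<close>.\<close>
  have "b \<bowtie> ?y"
  proof (rule ccontr)
    assume "\<not> b \<bowtie> ?y"
    then have "g w = ?y" using gw by simp
    then have "b = ?y + w" using w(2) by (simp only:)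
    then show False using b tvs_moves[of cs w] by simp
  qed
  then have gy: "g w = ?y + b" using gw by simp
  have "?y + w = b + ((?y + b) + w)" by (simp add: ac_simps)
  then have "?y + w = b + (g w + w)" by (simp only: gy)
  also have "g w + w = b" using w(2) by (rule sym)
  finally have "?y + w = 0" by simp
  then have "?y = w" by simp
  then have "b \<bowtie> w" using \<open>b \<bowtie> ?y\<close> by simp
  then show ?thesis using w by blast
qed

lemma any_factor:
  assumes g: "g = tvs (xs @ b # ys)" and k: "card U = 2 ^ Suc (length (xs @ ys))"
    and U: "U = (\<lambda>w. g w + w) ` U"
  shows "\<exists>w\<in>U. b = g w + w \<and> b \<bowtie> w"
proof (rule front_factor[OF _ _ U])
  show "g = tvs (b # map (tv b) xs @ ys)" unfolding g by (rule tvs_to_front)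
qed (use k in simp)

text \<open>The transvections along the \<open>p i + p j\<close> act as the transpositions of a subgroup \<open>S\<^sub>8\<close>.\<close>

definition frame :: "(nat \<Rightarrow> bit ^ 'n) \<Rightarrow> bool"
  where "frame p \<longleftrightarrow> p 0 = 0 \<and> p 7 = p 1 + p 2 + p 3 + p 4 + p 5 + p 6 \<and>
    (\<forall>i<8. \<forall>j<8. p i \<bowtie> p j \<longleftrightarrow> i \<noteq> j \<and> i \<noteq> 0 \<and> j \<noteq> 0)"

text \<open>The 4-cycle \<open>i -> j -> k -> l -> i\<close> on the points, written with the
  diagonal from \<open>i\<close> to \<open>k\<close> in front to match \<open>four_cycles\<close>;
  \<open>cyc\<close> is its action on indices.\<close>

definition point_cycle :: "(nat \<Rightarrow> bit ^ 'n) \<Rightarrow> nat \<Rightarrow> nat \<Rightarrow> nat \<Rightarrow> nat \<Rightarrow> bit ^ 'n \<Rightarrow> bit ^ 'n"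
  where "point_cycle p i j k l = tv (p i + p k) \<circ> (tv (p i + p j) \<circ> tv (p k + p l))"

definition cyc :: "nat \<Rightarrow> nat \<Rightarrow> nat \<Rightarrow> nat \<Rightarrow> nat \<Rightarrow> nat"
  where "cyc i j k l x = (if x = i then j else if x = j then k else if x = k then l else if x = l then i else x)"

lemma frame_adj:
  assumes "frame p" "i < 8" "j < 8" "k < 8" "l < 8" "i \<noteq> j" "k \<noteq> l"
  shows "p i + p j \<bowtie> p k + p l \<longleftrightarrow> ((i = k) \<noteq> (i = l)) \<noteq> ((j = k) \<noteq> (j = l))"
  using assms unfolding frame_def by auto

lemma fresh_index: "\<exists>m<8. m \<noteq> i \<and> m \<noteq> j \<and> m \<noteq> k \<and> m \<noteq> (l::nat)"
proof -
  have "card (set [i, j, k, l]) < card {..<8::nat}" using card_length[of "[i, j, k, l]"] by simp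
  then have "\<not> {..<8} \<subseteq> set [i, j, k, l]" by (meson List.finite_set card_mono leD)
  then show ?thesis by auto
qed

text \<open>Eight points leave a fresh point \<open>m\<close> besides \<open>i, j, k, l\<close>. The
  edge from \<open>i\<close> to \<open>m\<close> is adjacent to the edge \<open>i j\<close>, but not
  to \<open>k l\<close> unless \<open>i\<close> is an end of it.\<close>

lemma frame_inj:
  assumes p: "frame p" and "i < 8" "j < 8" "k < 8" "l < 8" "i \<noteq> j" "k \<noteq> l" "p i + p j = p k + p l"
  shows "{i, j} = {k, l}"
proof -
  have sub: "i = k \<or> i = l" if "i < 8" "j < 8" "k < 8" "l < 8" "i \<noteq> j" "k \<noteq> l" "p i + p j = p k + p l" for i j k l
  proof (rule ccontr)
    assume n: "\<not> (i = k \<or> i = l)"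
    obtain m where m: "m < 8" "m \<noteq> i" "m \<noteq> j" "m \<noteq> k" "m \<noteq> l" using fresh_index by blast
    have "p i + p j \<bowtie> p i + p m" using frame_adj[OF p, of i j i m] that m by auto
    moreover have "\<not> p k + p l \<bowtie> p i + p m" using frame_adj[OF p, of k l i m] that m n by auto
    ultimately show False using that(7) by simp
  qed
  show ?thesis using sub[of i j k l] sub[of j i k l] sub[of k l i j] sub[of l k i j] assms
    by (auto simp: add.commute)
qed

lemma tv_frame:
  assumes p: "frame p" and "i < 8" "j < 8" "k < 8" "l < 8" "i \<noteq> j" "k \<noteq> l"
  shows "tv (p i + p j) (p k + p l) = p (Transposition.transpose i j k) + p (Transposition.transpose i j l)"
  using frame_adj[OF assms] assms(6,7) by (auto simp: tv_apply Transposition.transpose_def ac_simps)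

lemma point_cycle_frame:
  assumes p: "frame p" and "i < 8" "j < 8" "k < 8" "l < 8" "distinct [i, j, k, l]" "m < 8" "n < 8" "m \<noteq> n"
  shows "point_cycle p i j k l (p m + p n) = p (cyc i j k l m) + p (cyc i j k l n)"
proof -
  have lt: "Transposition.transpose x y z < 8" if "x < 8" "y < 8" "z < 8" for x y z :: nat using that by (simp add: Transposition.transpose_def)
  have ne: "Transposition.transpose x y m \<noteq> Transposition.transpose x y n" if "m \<noteq> n" for x y m n :: nat using that by (auto simp: Transposition.transpose_def)
  have "cyc i j k l x = Transposition.transpose i k (Transposition.transpose i j (Transposition.transpose k l x))" for x
    using assms(6) by (auto simp: cyc_def Transposition.transpose_def)
  moreover have "point_cycle p i j k l (p m + p n) = tv (p i + p k) (tv (p i + p j) (tv (p k + p l) (p m + p n)))"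
    by (simp add: point_cycle_def)
  moreover have "tv (p k + p l) (p m + p n) = p (Transposition.transpose k l m) + p (Transposition.transpose k l n)" (is "_ = p ?m + p ?n")
    using assms by (intro tv_frame[OF p]) auto
  moreover have "tv (p i + p j) (p ?m + p ?n) = p (Transposition.transpose i j ?m) + p (Transposition.transpose i j ?n)" (is "_ = p ?m' + p ?n'")
    using assms by (intro tv_frame[OF p] lt ne) auto
  moreover have "tv (p i + p k) (p ?m' + p ?n') = p (Transposition.transpose i k ?m') + p (Transposition.transpose i k ?n')"
    using assms by (intro tv_frame[OF p] lt ne) auto
  ultimately show ?thesis by simp
qed

lemma cyc_lt: "i < 8 \<Longrightarrow> j < 8 \<Longrightarrow> k < 8 \<Longrightarrow> l < 8 \<Longrightarrow> x < 8 \<Longrightarrow> cyc i j k l x < 8"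
  by (simp add: cyc_def)

lemma cyc_inverse: "distinct [i, j, k, l] \<Longrightarrow> cyc l k j i (cyc i j k l x) = x"
  by (simp add: cyc_def)

lemma cyc_eq_iff: "distinct [i, j, k, l] \<Longrightarrow> cyc i j k l x = cyc i j k l y \<longleftrightarrow> x = y"
  using cyc_inverse by metis

lemma frame_path:
  assumes p: "frame p" and "i < 8" "j < 8" "k < 8" "l < 8" "distinct [i, j, k, l]"
  shows "p i + p k \<bowtie> p i + p j" "p i + p k \<bowtie> p k + p l" "\<not> p i + p j \<bowtie> p k + p l" "p i + p j \<noteq> p k + p l"
proof -
  have n: "i \<noteq> j" "i \<noteq> k" "i \<noteq> l" "j \<noteq> k" "j \<noteq> l" "k \<noteq> l" using assms(6) by auto
  show "p i + p k \<bowtie> p i + p j" using frame_adj[OF p, of i k i j] assms n by simp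
  show "p i + p k \<bowtie> p k + p l" using frame_adj[OF p, of i k k l] assms n by simp
  show "\<not> p i + p j \<bowtie> p k + p l" using frame_adj[OF p, of i j k l] assms n by simp
  show "p i + p j \<noteq> p k + p l" using frame_inj[OF p, of i j k l] assms n by auto
qed

lemma point_cycle_rotate:
  assumes p: "frame p" and "i < 8" "j < 8" "k < 8" "l < 8" "distinct [i, j, k, l]"
  shows "point_cycle p i j k l = point_cycle p j k l i"
proof -
  have "tv (p i + p k + (p i + p j) + (p k + p l)) \<circ> (tv (p i + p k + (p i + p j)) \<circ> tv (p i + p k + (p k + p l))) = point_cycle p i j k l"
    unfolding point_cycle_def using four_cycle_eq[OF frame_path(1-3)[OF assms]] .
  moreover have "p i + p k + (p i + p j) + (p k + p l) = p j + p l"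
    "p i + p k + (p i + p j) = p j + p k" "p i + p k + (p k + p l) = p l + p i" by (simp_all add: ac_simps)
  ultimately show ?thesis unfolding point_cycle_def by simp
qed

lemma point_cycle_four_cycles:
  assumes p: "frame p" and "i < 8" "j < 8" "k < 8" "l < 8" "distinct [i, j, k, l]"
  shows "point_cycle p i j k l \<in> four_cycles"
  using frame_path[OF assms] unfolding point_cycle_def four_cycles_def by blast

end

lemma card_UNIV_bool6: "card (UNIV :: (bool \<times> bool \<times> bool \<times> bool \<times> bool \<times> bool) set) = 64"
  by (simp add: card_UNIV_bool flip: UNIV_Times_UNIV)

section \<open>Coordinates for six pairwise adjacent vectors and the possible factors of a
  7-cycle\<close>

context symplectic
begin

definition sel :: "bool \<Rightarrow> bit ^ 'n \<Rightarrow> bit ^ 'n" where "sel x v = (if x then v else 0)"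

text \<open>Boolean coordinates on the span of six vectors, in which the linear algebra becomes
  propositional reasoning.\<close>

definition vec6 :: "bit ^ 'n \<Rightarrow> bit ^ 'n \<Rightarrow> bit ^ 'n \<Rightarrow> bit ^ 'n \<Rightarrow> bit ^ 'n \<Rightarrow> bit ^ 'n \<Rightarrow>
    bool \<times> bool \<times> bool \<times> bool \<times> bool \<times> bool \<Rightarrow> bit ^ 'n"
  where "vec6 a b c d e f = (\<lambda>(x1, x2, x3, x4, x5, x6).
    sel x1 a + (sel x2 b + (sel x3 c + (sel x4 d + (sel x5 e + sel x6 f)))))"

definition pairwise_adj :: "(bit ^ 'n) list \<Rightarrow> bool"
  where "pairwise_adj us \<longleftrightarrow> (\<forall>i<length us. \<forall>j<length us. us ! i \<bowtie> us ! j \<longleftrightarrow> i \<noteq> j)"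

lemma sel_adj [simp]: "sel x u \<bowtie> v \<longleftrightarrow> x \<and> u \<bowtie> v" "v \<bowtie> sel x u \<longleftrightarrow> x \<and> v \<bowtie> u"
  by (simp_all add: sel_def)

lemma sel_add: "sel x u + sel y u = sel (x \<noteq> y) u" "sel x u + (sel y u + w) = sel (x \<noteq> y) u + w"
  by (cases x; cases y; simp add: sel_def)+

lemma vec6_add:
  "vec6 a b c d e f (x1, x2, x3, x4, x5, x6) + vec6 a b c d e f (y1, y2, y3, y4, y5, y6) =
   vec6 a b c d e f (x1 \<noteq> y1, x2 \<noteq> y2, x3 \<noteq> y3, x4 \<noteq> y4, x5 \<noteq> y5, x6 \<noteq> y6)"
  unfolding vec6_def case_prod_conv sel_add(1)[symmetric] by (simp only: ac_simps)

context
  fixes a b c d e f :: "bit ^ 'n"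
  assumes adj: "pairwise_adj [a, b, c, d, e, f]"
begin

lemma six_adj:
  "a \<bowtie> b" "a \<bowtie> c" "a \<bowtie> d" "a \<bowtie> e" "a \<bowtie> f"
  "b \<bowtie> a" "b \<bowtie> c" "b \<bowtie> d" "b \<bowtie> e" "b \<bowtie> f"
  "c \<bowtie> a" "c \<bowtie> b" "c \<bowtie> d" "c \<bowtie> e" "c \<bowtie> f"
  "d \<bowtie> a" "d \<bowtie> b" "d \<bowtie> c" "d \<bowtie> e" "d \<bowtie> f"
  "e \<bowtie> a" "e \<bowtie> b" "e \<bowtie> c" "e \<bowtie> d" "e \<bowtie> f"
  "f \<bowtie> a" "f \<bowtie> b" "f \<bowtie> c" "f \<bowtie> d" "f \<bowtie> e"
  using adj by (simp_all add: pairwise_adj_def All_less_Suc nth_Cons numeral_nat)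

lemma vec6_eq_0:
  assumes "vec6 a b c d e f (x1, x2, x3, x4, x5, x6) = 0"
  shows "\<not> x1 \<and> \<not> x2 \<and> \<not> x3 \<and> \<not> x4 \<and> \<not> x5 \<and> \<not> x6"
proof -
  have *: "\<not> vec6 a b c d e f (x1, x2, x3, x4, x5, x6) \<bowtie> u" for u using assms by simp
  show ?thesis using *[of a] *[of b] *[of c] *[of d] *[of e] *[of f]
    by (simp add: vec6_def six_adj) argo
qed

lemma vec6_inj: "inj (vec6 a b c d e f)"
proof (rule injI)
  fix x y assume eq: "vec6 a b c d e f x = vec6 a b c d e f y"
  obtain x1 x2 x3 x4 x5 x6 where x: "x = (x1, x2, x3, x4, x5, x6)" by (metis prod.exhaust)
  obtain y1 y2 y3 y4 y5 y6 where y: "y = (y1, y2, y3, y4, y5, y6)" by (metis prod.exhaust)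
  have "vec6 a b c d e f x + vec6 a b c d e f y = 0" using eq by simp
  then show "x = y" using vec6_eq_0 unfolding x y vec6_add by blast
qed

lemma card_range_vec6: "card (range (vec6 a b c d e f)) = 64"
  using card_image[OF vec6_inj] card_UNIV_bool6 by simp

context
  fixes g :: "bit ^ 'n \<Rightarrow> bit ^ 'n"
  assumes g: "isom g" "g a = a + b" "g b = a + c" "g c = a + d" "g d = a + e" "g e = a + f" "g f = a"
begin

lemma g_sel: "g (sel x u) = sel x (g u)"
  using isom_add[OF g(1), of 0 0] by (simp add: sel_def)

lemma g_vec6:
  "g (vec6 a b c d e f (x1, x2, x3, x4, x5, x6)) + vec6 a b c d e f (x1, x2, x3, x4, x5, x6) =
   vec6 a b c d e f ((x2 \<noteq> (x3 \<noteq> (x4 \<noteq> (x5 \<noteq> x6)))), x1 \<noteq> x2, x2 \<noteq> x3, x3 \<noteq> x4, x4 \<noteq> x5, x5 \<noteq> x6)"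
proof -
  have s: "sel x (u + v) = sel x u + sel x v" for x u v by (simp add: sel_def)
  have "g (vec6 a b c d e f (x1, x2, x3, x4, x5, x6)) =
    vec6 a b c d e f ((x1 \<noteq> (x2 \<noteq> (x3 \<noteq> (x4 \<noteq> (x5 \<noteq> x6))))), x1, x2, x3, x4, x5)"
    unfolding vec6_def case_prod_conv isom_add[OF g(1)] g_sel g(2-7) s sel_add(1)[symmetric]
    by (simp only: ac_simps)
  moreover have "((x \<noteq> y) \<noteq> x) = y" for x y by auto
  ultimately show ?thesis by (simp only: vec6_add)
qed

text \<open>Here \<open>g - 1\<close> has full rank 6 on the span, which equals the number of
  factors, as \<open>any_factor\<close> demands.\<close>

lemma g_vec6_inj: "inj_on (\<lambda>w. g w + w) (range (vec6 a b c d e f))"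
proof (rule inj_onI)
  fix u v assume "u \<in> range (vec6 a b c d e f)" "v \<in> range (vec6 a b c d e f)" and eq: "g u + u = g v + v"
  then obtain x y where u: "u = vec6 a b c d e f x" and v: "v = vec6 a b c d e f y" by blast
  obtain x1 x2 x3 x4 x5 x6 where x: "x = (x1, x2, x3, x4, x5, x6)" by (metis prod.exhaust)
  obtain y1 y2 y3 y4 y5 y6 where y: "y = (y1, y2, y3, y4, y5, y6)" by (metis prod.exhaust)
  have "(g u + u) + (g v + v) = 0" using eq by simp
  then have "x1 = y1 \<and> x2 = y2 \<and> x3 = y3 \<and> x4 = y4 \<and> x5 = y5 \<and> x6 = y6"
    unfolding u v x y g_vec6 vec6_add by (drule_tac vec6_eq_0) argo
  then show "u = v" unfolding u v x y by simp
qed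

lemma g_vec6_image: "(\<lambda>w. g w + w) ` range (vec6 a b c d e f) = range (vec6 a b c d e f)"
proof (rule card_seteq)
  show "(\<lambda>w. g w + w) ` range (vec6 a b c d e f) \<subseteq> range (vec6 a b c d e f)"
  proof
    fix v assume "v \<in> (\<lambda>w. g w + w) ` range (vec6 a b c d e f)"
    then obtain x where v: "v = g (vec6 a b c d e f x) + vec6 a b c d e f x" by blast
    obtain x1 x2 x3 x4 x5 x6 where x: "x = (x1, x2, x3, x4, x5, x6)" by (metis prod.exhaust)
    show "v \<in> range (vec6 a b c d e f)" unfolding v x g_vec6 by blast
  qed
qed (simp_all add: card_image[OF g_vec6_inj])

text \<open>The 63 non-zero vectors of the span are the 28 edges of the eight points and 35 others;
  that \<open>h = g w + w\<close> is adjacent to \<open>w\<close> leaves only the edges. The three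
  sets are the edges from 0 to the six vectors, the edges among these, and the edges at the eighth
  point.\<close>

lemma six_factor:
  assumes "g = tvs (xs @ h # ys)" "length (xs @ ys) = 5"
  shows "h \<in> {a, b, c, d, e, f} \<or> 
    h \<in> {a+b, a+c, a+d, a+e, a+f, b+c, b+d, b+e, b+f, c+d, c+e, c+f, d+e, d+f, e+f} \<or>
    h \<in> {a+b+c+d+e+f, b+c+d+e+f, a+c+d+e+f, a+b+d+e+f, a+b+c+e+f, a+b+c+d+f, a+b+c+d+e}"
proof -
  have "\<exists>w\<in>range (vec6 a b c d e f). h = g w + w \<and> h \<bowtie> w"
    by (rule any_factor[OF assms(1)]) (simp_all only: card_range_vec6 assms(2) g_vec6_image, simp)
  then obtain x where h: "h = g (vec6 a b c d e f x) + vec6 a b c d e f x" "h \<bowtie> vec6 a b c d e f x" by blast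
  obtain x1 x2 x3 x4 x5 x6 where x: "x = (x1, x2, x3, x4, x5, x6)" by (metis prod.exhaust)
  show ?thesis using h(2) unfolding h(1) unfolding x g_vec6
    by (cases x1; cases x2; cases x3; cases x4; cases x5; cases x6)
      (simp_all add: vec6_def sel_def six_adj add.assoc)
qed

end

end

end

section \<open>The 7-cycle and its factorizations into two 4-cycles\<close>

context symplectic
begin

text \<open>Two 4-cycles with only the point 0 in common compose to
  \<open>0 -> 1 -> 2 -> 3 -> 4 -> 5 -> 6 -> 0\<close>, with 7 fixed.\<close>

definition seven_cycle :: "(nat \<Rightarrow> bit ^ 'n) \<Rightarrow> bit ^ 'n \<Rightarrow> bit ^ 'n"
  where "seven_cycle p = point_cycle p 0 4 5 6 \<circ> point_cycle p 0 1 2 3"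

abbreviation "gamma x \<equiv> cyc 0 4 5 6 (cyc 0 1 2 3 x)"

lemma seven_cycle_frame:
  assumes p: "frame p" and "m < 8" "n < 8" "m \<noteq> n"
  shows "seven_cycle p (p m + p n) = p (gamma m) + p (gamma n)"
proof -
  have "point_cycle p 0 1 2 3 (p m + p n) = p (cyc 0 1 2 3 m) + p (cyc 0 1 2 3 n)"
    by (rule point_cycle_frame[OF p]) (use assms in simp_all)
  moreover have "point_cycle p 0 4 5 6 (p (cyc 0 1 2 3 m) + p (cyc 0 1 2 3 n)) = p (gamma m) + p (gamma n)"
    by (rule point_cycle_frame[OF p]) (use assms in \<open>simp_all add: cyc_lt cyc_eq_iff\<close>)
  ultimately show ?thesis by (simp add: seven_cycle_def)
qed

lemma isom_point_cycle [simp]: "isom (point_cycle p i j k l)"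
  unfolding point_cycle_def by (intro isom_comp isom_tv)

lemma frame_factor:
  assumes p: "frame p" and h: "seven_cycle p = tvs (xs @ h # ys)" "length (xs @ ys) = 5"
  shows "\<exists>i j. i < 8 \<and> j < 8 \<and> i \<noteq> j \<and> h = p i + p j"
proof -
  have adj: "pairwise_adj [p 1, p 2, p 3, p 4, p 5, p 6]"
    using p unfolding frame_def pairwise_adj_def by (simp add: All_less_Suc nth_Cons numeral_nat)
  have 0: "p 0 = 0" and 7: "p 7 = p 1 + p 2 + p 3 + p 4 + p 5 + p 6" using p by (simp_all add: frame_def)
  have i: "isom (seven_cycle p)" unfolding seven_cycle_def by (intro isom_comp isom_point_cycle)
  have "seven_cycle p (p m) = p (gamma m) + p 1" if "m < 8" "m \<noteq> 0" for m
    using seven_cycle_frame[OF p, of m 0] that 0 by (simp add: cyc_def)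
  from this[of 1] this[of 2] this[of 3] this[of 4] this[of 5] this[of 6]
  have s: "seven_cycle p (p 1) = p 1 + p 2" "seven_cycle p (p 2) = p 1 + p 3" "seven_cycle p (p 3) = p 1 + p 4"
    "seven_cycle p (p 4) = p 1 + p 5" "seven_cycle p (p 5) = p 1 + p 6" "seven_cycle p (p 6) = p 1"
    by (simp_all add: cyc_def 0 add.commute)
  have I: "\<exists>i j. i < 8 \<and> j < 8 \<and> i \<noteq> j \<and> h = p i + p j" if "h = p i + p j" "i < 8" "j < 8" "i \<noteq> j" for i j
    using that by blast
  have 7: "p 1 + p 2 + p 3 + p 4 + p 5 + p 6 = p 7 + p 0" 
    "p 2 + p 3 + p 4 + p 5 + p 6 = p 7 + p 1" "p 1 + p 3 + p 4 + p 5 + p 6 = p 7 + p 2"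
    "p 1 + p 2 + p 4 + p 5 + p 6 = p 7 + p 3" "p 1 + p 2 + p 3 + p 5 + p 6 = p 7 + p 4"
    "p 1 + p 2 + p 3 + p 4 + p 6 = p 7 + p 5" "p 1 + p 2 + p 3 + p 4 + p 5 = p 7 + p 6"
    unfolding 7 0 by (simp_all add: ac_simps)
  show ?thesis
    using six_factor[OF adj i s h] unfolding 7
    apply (elim disjE insertE emptyE)
    subgoal by (rule I[of 1 0]) (simp_all add: 0)
    subgoal by (rule I[of 2 0]) (simp_all add: 0)
    subgoal by (rule I[of 3 0]) (simp_all add: 0)
    subgoal by (rule I[of 4 0]) (simp_all add: 0)
    subgoal by (rule I[of 5 0]) (simp_all add: 0)
    subgoal by (rule I[of 6 0]) (simp_all add: 0)
    apply ((erule I; simp; fail)+)[15]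
    subgoal by (rule I[of 7 0]) (simp_all add: 0 add.assoc)
    by (erule I; simp)+
qed

text \<open>Orthogonal edges \<open>c \<noteq> d\<close> are disjoint, and \<open>b\<close> shares
  exactly one end with each of them, so the three edges form a path through
  \<open>j, i, k, l\<close>.\<close>

lemma frame_path_points:
  assumes p: "frame p" and b: "b = p x + p y" "x < 8" "y < 8" "x \<noteq> y"
    and c: "c = p i + p j" "i < 8" "j < 8" "i \<noteq> j"
    and d: "d = p k + p l" "k < 8" "l < 8" "k \<noteq> l"
    and h: "b \<bowtie> c" "b \<bowtie> d" "\<not> c \<bowtie> d" "c \<noteq> d"
  shows "\<exists>i j k l. i < 8 \<and> j < 8 \<and> k < 8 \<and> l < 8 \<and> distinct [i, j, k, l] \<and>
    b = p i + p k \<and> c = p i + p j \<and> d = p k + p l"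
proof -
  have "\<not> ({i, j} = {k, l})" using h(4) c(1) d(1) by (auto simp: doubleton_eq_iff add.commute)
  then have dis: "i \<noteq> k" "i \<noteq> l" "j \<noteq> k" "j \<noteq> l"
    using h(3) frame_adj[OF p c(2,3) d(2,3) c(4) d(4)] c(1,4) d(1,4) by auto
  have 1: "(x = i \<or> x = j) \<noteq> (y = i \<or> y = j)"
    using h(1) frame_adj[OF p b(2,3) c(2,3) b(4) c(4)] b(1,4) c(1,4) by auto
  have 2: "(x = k \<or> x = l) \<noteq> (y = k \<or> y = l)"
    using h(2) frame_adj[OF p b(2,3) d(2,3) b(4) d(4)] b(1,4) d(1,4) by auto
  define i' j' where "i' = (if x = i \<or> y = i then i else j)" and "j' = (if x = i \<or> y = i then j else i)"
  define k' l' where "k' = (if x = k \<or> y = k then k else l)" and "l' = (if x = k \<or> y = k then l else k)"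
  have "c = p i' + p j'" "d = p k' + p l'" using c(1) d(1) by (auto simp: i'_def j'_def k'_def l'_def add.commute)
  moreover have "b = p i' + p k'"
    using 1 2 dis b(1) by (auto simp: i'_def k'_def add.commute)
  moreover have "i' < 8" "j' < 8" "k' < 8" "l' < 8" using c d by (auto simp: i'_def j'_def k'_def l'_def)
  moreover have "distinct [i', j', k', l']" using dis c(4) d(4) by (auto simp: i'_def j'_def k'_def l'_def)
  ultimately show ?thesis by blast
qed

lemma pair_eq_cancel:
  assumes "{x, y} = {X, Y}" "{x, z} = {X, Z}" "X \<noteq> Y" "X \<noteq> Z" "Y \<noteq> Z"
  shows "x = X"
  using assms by (auto simp: doubleton_eq_iff)

lemma gamma_values:
  "gamma 0 = Suc 0" "gamma (Suc 0) = 2" "gamma 2 = 3" "gamma 3 = 4" "gamma 4 = 5" "gamma 5 = 6" "gamma 6 = 0" "gamma 7 = 7"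
  by (simp_all add: cyc_def)

lemma less8: "x < (8::nat) \<Longrightarrow> x = 0 \<or> x = Suc 0 \<or> x = 2 \<or> x = 3 \<or> x = 4 \<or> x = 5 \<or> x = 6 \<or> x = 7"
  by arith

lemma gamma_fixed: "x < 8 \<Longrightarrow> gamma x = x \<Longrightarrow> x = 7"
  using less8[of x] gamma_values by auto

text \<open>Starting at the common point \<open>i\<close>, the orbit of the product runs through the
  cycle applied first, the primed one, and continues through the other.\<close>

lemma cyc_factorization_rooted:
  assumes "distinct [i, j, k, l]" "distinct [i, j', k', l']" "i < 8"
    and sep: "{j, k, l} \<inter> {j', k', l'} = {}"
    and c: "\<And>x. x < 8 \<Longrightarrow> cyc i j k l (cyc i j' k' l' x) = gamma x"
    and lt: "j < 8" "k < 8" "l < 8" "j' < 8" "k' < 8" "l' < 8"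
  shows "i < 7 \<and> j' = gamma i \<and> k' = gamma j' \<and> l' = gamma k' \<and> j = gamma l' \<and> k = gamma j \<and> l = gamma k"
proof -
  have d: "i \<noteq> j" "i \<noteq> k" "i \<noteq> l" "j \<noteq> k" "j \<noteq> l" "k \<noteq> l" "i \<noteq> j'" "i \<noteq> k'" "i \<noteq> l'" "j' \<noteq> k'" "j' \<noteq> l'" "k' \<noteq> l'"
    "j \<noteq> j'" "j \<noteq> k'" "j \<noteq> l'" "k \<noteq> j'" "k \<noteq> k'" "k \<noteq> l'" "l \<noteq> j'" "l \<noteq> k'" "l \<noteq> l'"
    using assms(1,2) sep by auto
  have "j' = gamma i" using c[of i] assms(3) d unfolding cyc_def[of i] by simp
  moreover have "k' = gamma j'" using c[of j'] lt d unfolding cyc_def[of i] by simp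
  moreover have "l' = gamma k'" using c[of k'] lt d unfolding cyc_def[of i] by simp
  moreover have "j = gamma l'" using c[of l'] lt d unfolding cyc_def[of i] by simp
  moreover have "k = gamma j" using c[of j] lt d unfolding cyc_def[of i] by simp
  moreover have "l = gamma k" using c[of k] lt d unfolding cyc_def[of i] by simp
  moreover have "i \<noteq> 7" using \<open>j' = gamma i\<close> d(7) gamma_values(8) by auto
  ultimately show ?thesis using assms(3) by simp
qed

lemma cyc_rotate: "distinct [i, j, k, l] \<Longrightarrow> cyc i j k l = cyc j k l i"
  by (simp add: fun_eq_iff cyc_def)

lemma point_cycle_rotate_to:
  assumes p: "frame p" and ijkl: "i < 8" "j < 8" "k < 8" "l < 8" "distinct [i, j, k, l]" and r: "r \<in> {i, j, k, l}"
  shows "\<exists>a b c. a < 8 \<and> b < 8 \<and> c < 8 \<and> distinct [r, a, b, c] \<and> {r, a, b, c} = {i, j, k, l} \<and>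
    point_cycle p i j k l = point_cycle p r a b c \<and> cyc i j k l = cyc r a b c"
proof -
  have d: "distinct [j, k, l, i]" "distinct [k, l, i, j]" "distinct [l, i, j, k]" using ijkl(5) by auto
  have f: "point_cycle p i j k l = point_cycle p j k l i" "point_cycle p j k l i = point_cycle p k l i j" "point_cycle p k l i j = point_cycle p l i j k"
    using point_cycle_rotate[OF p ijkl] point_cycle_rotate[OF p ijkl(2,3,4,1) d(1)] point_cycle_rotate[OF p ijkl(3,4,1,2) d(2)] by blast+
  have c: "cyc i j k l = cyc j k l i" "cyc j k l i = cyc k l i j" "cyc k l i j = cyc l i j k"
    using cyc_rotate[OF ijkl(5)] cyc_rotate[OF d(1)] cyc_rotate[OF d(2)] by blast+
  consider "r = i" | "r = j" | "r = k" | "r = l" using r by blast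
  then show ?thesis
  proof cases
    case 1
    then show ?thesis using ijkl by (intro exI[of _ j] exI[of _ k] exI[of _ l]) auto
  next
    case 2
    then show ?thesis using ijkl d f c by (intro exI[of _ k] exI[of _ l] exI[of _ i]) (simp, blast)
  next
    case 3
    then show ?thesis using ijkl d f c by (intro exI[of _ l] exI[of _ i] exI[of _ j]) (simp, blast)
  next
    case 4
    then show ?thesis using ijkl d f c by (intro exI[of _ i] exI[of _ j] exI[of _ k]) (simp, blast)
  qed
qed

text \<open>Two supports of size 4 must cover the seven moved points, so they share at most one
  point. Disjoint supports would fill all eight points, and the product would move the point 7,
  which \<open>gamma\<close> fixes.\<close>

lemma common_point:
  assumes d: "distinct [i, j, k, l]" "distinct [i', j', k', l']"
    and lt: "i < 8" "j < 8" "k < 8" "l < 8" "i' < 8" "j' < 8" "k' < 8" "l' < 8"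
    and c: "\<And>x. x < 8 \<Longrightarrow> cyc i j k l (cyc i' j' k' l' x) = gamma x"
  shows "\<exists>r. {i, j, k, l} \<inter> {i', j', k', l'} = {r}"
proof -
  let ?s = "{i, j, k, l}" and ?t = "{i', j', k', l'}"
  have cs: "card ?s = 4" "card ?t = 4" using d by auto
  have out: "cyc i j k l x = x" if "x \<notin> ?s" for x using that by (simp add: cyc_def)
  have out': "cyc i' j' k' l' x = x" if "x \<notin> ?t" for x using that by (simp add: cyc_def)
  have mv: "cyc i j k l x \<in> ?s" "cyc i j k l x \<noteq> x" if "x \<in> ?s" for x using that d(1) by (auto simp: cyc_def)
  have mv': "cyc i' j' k' l' x \<in> ?t" "cyc i' j' k' l' x \<noteq> x" if "x \<in> ?t" for x using that d(2) by (auto simp: cyc_def)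
  have "x \<in> ?s \<union> ?t" if "x < 7" for x
  proof (rule ccontr)
    assume "x \<notin> ?s \<union> ?t"
    then have "cyc i j k l (cyc i' j' k' l' x) = x" using out out' by simp
    then show False using c[of x] gamma_fixed[of x] that by simp
  qed
  then have sub: "{..<7} \<subseteq> ?s \<union> ?t" by blast
  have "card {..<7::nat} \<le> card (?s \<union> ?t)" by (rule card_mono[OF _ sub]) simp
  moreover have un: "card (?s \<union> ?t) + card (?s \<inter> ?t) = 8" using card_Un_Int[of ?s ?t] cs by simp
  ultimately have le: "card (?s \<inter> ?t) \<le> 1" by simp
  have "?s \<inter> ?t \<noteq> {}"
  proof
    assume e: "?s \<inter> ?t = {}"
    then have "card (?s \<union> ?t) = 8" using un by simp
    moreover have "?s \<union> ?t \<subseteq> {..<8}" using lt by auto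
    ultimately have "?s \<union> ?t = {..<8}" using card_seteq[of "{..<8::nat}" "?s \<union> ?t"] by simp
    then have s7: "7 \<in> ?s \<or> 7 \<in> ?t" by (metis UnE lessThan_iff numeral_less_iff semiring_norm(76,79,81))
    have c7: "cyc i j k l (cyc i' j' k' l' 7) = 7" using c[of 7] gamma_values(8) by simp
    from s7 show False
    proof
      assume "7 \<in> ?s"
      then show False using e mv(2)[of 7] out'[of 7] c7 by auto
    next
      assume t: "7 \<in> ?t"
      then have "cyc i' j' k' l' 7 \<notin> ?s" using e mv'(1)[of 7] by blast
      then show False using out c7 mv'(2)[OF t] by simp
    qed
  qed
  then have "card (?s \<inter> ?t) = 1" using le by (metis One_nat_def card_0_eq finite.emptyI finite.insertI finite_Int le_Suc_eq le_zero_eq)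
  then show ?thesis by (simp only: card_1_singleton_iff One_nat_def)
qed

text \<open>By \<open>frame_factor\<close> all six transvections involved are edges, which turns the
  question into one about permutations of eight points. The two 4-cycles share one point
  \<open>m\<close>, and this point determines both.\<close>

lemma seven_cycle_factorizations:
  assumes p: "frame p" and h: "h \<in> four_cycles" "h' \<in> four_cycles" and eq: "h \<circ> h' = seven_cycle p"
  shows "\<exists>m<7. h = point_cycle p m ((m + 4) mod 7) ((m + 5) mod 7) ((m + 6) mod 7) \<and>
    h' = point_cycle p m ((m + 1) mod 7) ((m + 2) mod 7) ((m + 3) mod 7)"
proof -
  obtain b c d where bcd: "b \<bowtie> c" "b \<bowtie> d" "\<not> c \<bowtie> d" "c \<noteq> d" "h = tv b \<circ> (tv c \<circ> tv d)"
    using h(1) by (auto simp: four_cycles_def)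
  obtain b' c' d' where bcd': "b' \<bowtie> c'" "b' \<bowtie> d'" "\<not> c' \<bowtie> d'" "c' \<noteq> d'" "h' = tv b' \<circ> (tv c' \<circ> tv d')"
    using h(2) by (auto simp: four_cycles_def)
  have sc: "seven_cycle p = tvs [b, c, d, b', c', d']" using eq bcd(5) bcd'(5) by (auto simp: comp_def)
  have f: "\<exists>i j. i < 8 \<and> j < 8 \<and> i \<noteq> j \<and> u = p i + p j" if "[b, c, d, b', c', d'] = xs @ u # ys" for u xs ys
  proof -
    have "length (xs @ ys) = 5" using arg_cong[OF that, of length] by simp
    then show ?thesis using frame_factor[OF p _ \<open>length (xs @ ys) = 5\<close>, of u] sc that by simp
  qed
  have "\<exists>i j. i < 8 \<and> j < 8 \<and> i \<noteq> j \<and> u = p i + p j" if u: "u \<in> {b, c, d, b', c', d'}" for u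
    using f[of "[]" b "[c, d, b', c', d']"] f[of "[b]" c "[d, b', c', d']"] f[of "[b, c]" d "[b', c', d']"]
      f[of "[b, c, d]" b' "[c', d']"] f[of "[b, c, d, b']" c' "[d']"] f[of "[b, c, d, b', c']" d' "[]"] u by auto
  then have g: "\<exists>i j. u = p i + p j \<and> i < 8 \<and> j < 8 \<and> i \<noteq> j" if "u \<in> {b, c, d, b', c', d'}" for u
    using that by blast
  obtain x1 y1 where e1: "b = p x1 + p y1" "x1 < 8" "y1 < 8" "x1 \<noteq> y1" using g[of b] by blast
  obtain x2 y2 where e2: "c = p x2 + p y2" "x2 < 8" "y2 < 8" "x2 \<noteq> y2" using g[of c] by blast
  obtain x3 y3 where e3: "d = p x3 + p y3" "x3 < 8" "y3 < 8" "x3 \<noteq> y3" using g[of d] by blast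
  obtain x4 y4 where e4: "b' = p x4 + p y4" "x4 < 8" "y4 < 8" "x4 \<noteq> y4" using g[of b'] by blast
  obtain x5 y5 where e5: "c' = p x5 + p y5" "x5 < 8" "y5 < 8" "x5 \<noteq> y5" using g[of c'] by blast
  obtain x6 y6 where e6: "d' = p x6 + p y6" "x6 < 8" "y6 < 8" "x6 \<noteq> y6" using g[of d'] by blast
  have "\<exists>i j k l. i < 8 \<and> j < 8 \<and> k < 8 \<and> l < 8 \<and> distinct [i, j, k, l] \<and>
      b = p i + p k \<and> c = p i + p j \<and> d = p k + p l"
    by (rule frame_path_points[OF p e1 e2 e3 bcd(1-4)])
  then obtain i j k l where ijkl: "i < 8" "j < 8" "k < 8" "l < 8" "distinct [i, j, k, l]" and hf: "h = point_cycle p i j k l"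
    using bcd(5) unfolding point_cycle_def by blast
  have "\<exists>i j k l. i < 8 \<and> j < 8 \<and> k < 8 \<and> l < 8 \<and> distinct [i, j, k, l] \<and>
      b' = p i + p k \<and> c' = p i + p j \<and> d' = p k + p l"
    by (rule frame_path_points[OF p e4 e5 e6 bcd'(1-4)])
  then obtain i' j' k' l' where ijkl': "i' < 8" "j' < 8" "k' < 8" "l' < 8" "distinct [i', j', k', l']" and hf': "h' = point_cycle p i' j' k' l'"
    using bcd'(5) unfolding point_cycle_def by blast
  have pair: "p (cyc i j k l (cyc i' j' k' l' m)) + p (cyc i j k l (cyc i' j' k' l' n)) = p (gamma m) + p (gamma n)"
    if mn: "m < 8" "n < 8" "m \<noteq> n" for m n
  proof -
    have "h' (p m + p n) = p (cyc i' j' k' l' m) + p (cyc i' j' k' l' n)"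
      unfolding hf' by (rule point_cycle_frame[OF p ijkl' mn])
    moreover have "h (p (cyc i' j' k' l' m) + p (cyc i' j' k' l' n)) =
        p (cyc i j k l (cyc i' j' k' l' m)) + p (cyc i j k l (cyc i' j' k' l' n))"
      unfolding hf by (rule point_cycle_frame[OF p ijkl]) (use ijkl' mn in \<open>simp_all add: cyc_lt cyc_eq_iff\<close>)
    moreover have "h (h' (p m + p n)) = seven_cycle p (p m + p n)" using eq by (simp add: fun_eq_iff)
    ultimately show ?thesis using seven_cycle_frame[OF p mn] by simp
  qed
  have set: "{cyc i j k l (cyc i' j' k' l' m), cyc i j k l (cyc i' j' k' l' n)} = {gamma m, gamma n}"
    if mn: "m < 8" "n < 8" "m \<noteq> n" for m n
    by (rule frame_inj[OF p _ _ _ _ _ _ pair[OF mn]]) (use ijkl ijkl' mn in \<open>simp_all add: cyc_lt cyc_eq_iff\<close>)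
  \<comment> \<open>The image of a point is recovered from the images of two edges at it.\<close>
  have c: "cyc i j k l (cyc i' j' k' l' x) = gamma x" if x: "x < 8" for x
  proof -
    obtain y where y: "y < 8" "y \<noteq> x" using fresh_index[of x x x x] by blast
    obtain z where z: "z < 8" "z \<noteq> x" "z \<noteq> y" using fresh_index[of x y y y] by blast
    show ?thesis
      by (rule pair_eq_cancel[OF set[of x y] set[of x z]]) (use x y z in \<open>auto simp: cyc_eq_iff\<close>)
  qed
  obtain r where r: "{i, j, k, l} \<inter> {i', j', k', l'} = {r}"
    using common_point[OF ijkl(5) ijkl'(5) ijkl(1-4) ijkl'(1-4) c] by blast
  have ri: "r \<in> {i, j, k, l}" "r \<in> {i', j', k', l'}" using r by blast+
  obtain x1 x2 x3 where x: "x1 < 8" "x2 < 8" "x3 < 8" "distinct [r, x1, x2, x3]" "{r, x1, x2, x3} = {i, j, k, l}"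
    "h = point_cycle p r x1 x2 x3" "cyc i j k l = cyc r x1 x2 x3"
    using point_cycle_rotate_to[OF p ijkl ri(1)] unfolding hf by blast
  obtain y1 y2 y3 where y: "y1 < 8" "y2 < 8" "y3 < 8" "distinct [r, y1, y2, y3]" "{r, y1, y2, y3} = {i', j', k', l'}"
    "h' = point_cycle p r y1 y2 y3" "cyc i' j' k' l' = cyc r y1 y2 y3"
    using point_cycle_rotate_to[OF p ijkl' ri(2)] unfolding hf' by blast
  have r8: "r < 8" using r ijkl by auto
  have sep: "{x1, x2, x3} \<inter> {y1, y2, y3} = {}"
  proof -
    have "{x1, x2, x3} \<inter> {y1, y2, y3} \<subseteq> {r}" using r x(5) y(5) by auto
    then show ?thesis using x(4) by auto
  qed
  have c': "cyc r x1 x2 x3 (cyc r y1 y2 y3 x) = gamma x" if "x < 8" for x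
    using c[OF that] unfolding x(7) y(7) .
  have v: "r < 7" "y1 = gamma r" "y2 = gamma y1" "y3 = gamma y2" "x1 = gamma y3" "x2 = gamma x1" "x3 = gamma x2"
    using cyc_factorization_rooted[OF x(4) y(4) r8 sep c' x(1-3) y(1-3)] by blast+
  have gm: "gamma m = (m + 1) mod 7" if "m < 7" for m
  proof -
    have "m = 0 \<or> m = Suc 0 \<or> m = 2 \<or> m = 3 \<or> m = 4 \<or> m = 5 \<or> m = 6" using that by arith
    then show ?thesis by (elim disjE; simp only: gamma_values; simp)
  qed
  have vals: "y1 = (r + 1) mod 7" "y2 = (r + 2) mod 7" "y3 = (r + 3) mod 7"
      "x1 = (r + 4) mod 7" "x2 = (r + 5) mod 7" "x3 = (r + 6) mod 7"
  proof -
    show 1: "y1 = (r + 1) mod 7" using v(2) gm[OF v(1)] by simp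
    have s: "gamma ((r + k) mod 7) = (r + (k + 1)) mod 7" for k
      using gm[of "(r + k) mod 7"] by (simp add: mod_simps add.assoc)
    show 2: "y2 = (r + 2) mod 7" using v(3) s[of 1] unfolding 1 by simp
    show 3: "y3 = (r + 3) mod 7" using v(4) s[of 2] unfolding 2 by simp
    show 4: "x1 = (r + 4) mod 7" using v(5) s[of 3] unfolding 3 by simp
    show 5: "x2 = (r + 5) mod 7" using v(6) s[of 4] unfolding 4 by simp
    show "x3 = (r + 6) mod 7" using v(7) s[of 5] unfolding 5 by simp
  qed
  show ?thesis using v(1) x(6) y(6) unfolding vals by blast
qed

end

section \<open>Colourings of seven points excluded by the 7-cycle\<close>

context symplectic
begin

lemma four_cycle_in_prods_iff:
  assumes h: "b \<bowtie> c" "b \<bowtie> d" "\<not> c \<bowtie> d" "c \<noteq> d" and z: "0 \<notin> Z" "0 \<notin> W"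
  shows "tv b \<circ> (tv c \<circ> tv d) \<in> prods (tv ` X) (perp_pairs Z W) \<longleftrightarrow>
    b \<in> X \<and> (c \<in> Z \<and> d \<in> W \<or> d \<in> Z \<and> c \<in> W) \<or>
    b + c + d \<in> X \<and> (b + c \<in> Z \<and> b + d \<in> W \<or> b + d \<in> Z \<and> b + c \<in> W)" (is "?L = ?R")
proof -
  have n: "c \<noteq> 0" "d \<noteq> 0" "b + c \<noteq> 0" "b + d \<noteq> 0" "b + c \<noteq> b + d" "\<not> b + c \<bowtie> b + d"
    using h adj_sym[of c b] by auto
  note pp = perp_pairs_iff[OF n(1,2) h(4,3) z] perp_pairs_iff[OF n(3-6) z]
  show ?thesis
  proof
    assume ?L
    then obtain x y w where xyw: "x \<in> X" "y \<in> Z" "w \<in> W" "y \<noteq> w" "\<not> y \<bowtie> w"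
      "tv x \<circ> (tv y \<circ> tv w) = tv b \<circ> (tv c \<circ> tv d)"
      unfolding prods_def perp_pairs_def by (smt (verit) imageE mem_Collect_eq)
    have "tv y \<circ> tv w \<in> perp_pairs Z W" using xyw unfolding perp_pairs_def by blast
    then show ?R using four_cycle_factors[OF h xyw(6,5)] pp xyw(1) by metis
  next
    assume ?R
    then show ?L
    proof
      assume "b \<in> X \<and> (c \<in> Z \<and> d \<in> W \<or> d \<in> Z \<and> c \<in> W)"
      then show ?L using pp(1) unfolding prods_def by blast
    next
      assume "b + c + d \<in> X \<and> (b + c \<in> Z \<and> b + d \<in> W \<or> b + d \<in> Z \<and> b + c \<in> W)"
      then have "tv (b + c + d) \<circ> (tv (b + c) \<circ> tv (b + d)) \<in> prods (tv ` X) (perp_pairs Z W)"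
        using pp(2) unfolding prods_def by blast
      then show ?L unfolding four_cycle_eq[OF h(1-3)] .
    qed
  qed
qed

lemma point_cycle_in_prods_iff:
  assumes p: "frame p" and ijkl: "i < 8" "j < 8" "k < 8" "l < 8" "distinct [i, j, k, l]" and z: "0 \<notin> Z" "0 \<notin> W"
  shows "point_cycle p i j k l \<in> prods (tv ` X) (perp_pairs Z W) \<longleftrightarrow>
    p i + p k \<in> X \<and> (p i + p j \<in> Z \<and> p k + p l \<in> W \<or> p k + p l \<in> Z \<and> p i + p j \<in> W) \<or>
    p j + p l \<in> X \<and> (p j + p k \<in> Z \<and> p l + p i \<in> W \<or> p l + p i \<in> Z \<and> p j + p k \<in> W)"
proof -
  have e: "p j + p k + (p k + p l) = p j + p l"
    "p i + p k + (p i + p j) = p j + p k" "p i + p k + (p k + p l) = p l + p i" by (simp_all add: ac_simps)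
  show ?thesis unfolding point_cycle_def four_cycle_in_prods_iff[OF frame_path[OF p ijkl] z] e by blast
qed

end

text \<open>
  \<open>mono_diag\<close> and \<open>balanced\<close> describe the colours of the edges and diagonals of a 4-cycle \<open>(i j k l)\<close>
  when two points span an edge of the first colour iff they carry the same label.
\<close>

definition mono_diag :: "(nat \<Rightarrow> nat) \<Rightarrow> nat \<Rightarrow> nat \<Rightarrow> nat \<Rightarrow> nat \<Rightarrow> bool"
  where "mono_diag w i j k l \<longleftrightarrow>
    w i = w k \<and> w i \<noteq> w j \<and> w k \<noteq> w l \<or> w j = w l \<and> w j \<noteq> w k \<and> w l \<noteq> w i"

definition balanced :: "(nat \<Rightarrow> nat) \<Rightarrow> nat \<Rightarrow> nat \<Rightarrow> nat \<Rightarrow> nat \<Rightarrow> bool"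
  where "balanced w i j k l \<longleftrightarrow>
    (w i = w k \<or> (w i = w j \<longleftrightarrow> w k = w l)) \<and> (w j = w l \<or> (w j = w k \<longleftrightarrow> w l = w i))"

text \<open>The obstruction to \<open>prods E F = prods F E\<close> at the 7-cycle, where
  \<open>mono_diag\<close> tests membership in \<open>E\<close> and \<open>balanced\<close>
  membership in \<open>F\<close>; \<open>m\<close> is the common point of the two 4-cycles.\<close>

definition bad_word :: "(nat \<Rightarrow> nat) \<Rightarrow> bool"
  where "bad_word w \<longleftrightarrow> mono_diag w 0 4 5 6 \<and> balanced w 0 1 2 3 \<and>
    (\<forall>m<7. \<not> (balanced w m ((m + 4) mod 7) ((m + 5) mod 7) ((m + 6) mod 7) \<and>
      mono_diag w m ((m + 1) mod 7) ((m + 2) mod 7) ((m + 3) mod 7)))"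

text \<open>The first word serves hyperplanes and quadrics, the second sparse closed sets, the third
  totally isotropic sets.\<close>

lemma bad_words:
  "bad_word ((!) [0, 0, 1, 1, 1, 0, 1])"
  "bad_word ((!) [0, 1, 2, 3, 3, 4, 3])"
  "bad_word ((!) [0, 1, 2, 3, 3, 0, 4])"
proof -
  have all7: "(\<forall>m<7. P m) \<longleftrightarrow> P 0 \<and> P 1 \<and> P 2 \<and> P 3 \<and> P 4 \<and> P 5 \<and> P 6" for P :: "nat \<Rightarrow> bool"
  proof -
    have "{..<7::nat} = {0, 1, 2, 3, 4, 5, 6}" by (simp add: lessThan_Suc numeral_eq_Suc) auto
    then have "(\<forall>m\<in>{..<7}. P m) \<longleftrightarrow> P 0 \<and> P 1 \<and> P 2 \<and> P 3 \<and> P 4 \<and> P 5 \<and> P 6" by simp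
    then show ?thesis unfolding Ball_def lessThan_iff .
  qed
  show "bad_word ((!) [0, 0, 1, 1, 1, 0, 1])" "bad_word ((!) [0, 1, 2, 3, 3, 4, 3])" "bad_word ((!) [0, 1, 2, 3, 3, 0, 4])"
    unfolding bad_word_def all7 mono_diag_def balanced_def by simp_all
qed

context schur_sets
begin

lemma no_bad_word:
  assumes X: "X \<in> VV" and p: "frame p" and w: "bad_word w"
    and col: "\<And>i j. i < 7 \<Longrightarrow> j < 7 \<Longrightarrow> i \<noteq> j \<Longrightarrow> p i + p j \<in> X \<longleftrightarrow> w i = w j"
  shows False
proof -
  let ?Y = "V0 - X"
  have Y: "?Y \<in> VV" by (rule VV_compl[OF X])
  note z = VV_0[OF X] VV_0[OF Y]
  define E where "E = four_cycles \<inter> prods (tv ` X) (perp_pairs ?Y ?Y)"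
  \<comment> \<open>Membership in \<open>F\<close> says that neither diagonal lying outside
    \<open>X\<close> comes with two edges of different colours.\<close>
  define F where "F = four_cycles - prods (tv ` ?Y) (perp_pairs X ?Y)"
  have ES: "E \<in> SS" unfolding E_def
    using SS_int[OF four_cycles_SS SS_prods[OF VV_SS[OF X] perp_pairs_SS[OF Y Y]]] .
  have FS: "F \<in> SS" unfolding F_def
    using SS_diff[OF four_cycles_SS SS_prods[OF VV_SS[OF Y] perp_pairs_SS[OF X Y]]] .
  have colY: "p i + p j \<in> ?Y \<longleftrightarrow> w i \<noteq> w j" if "i < 7" "j < 7" "i \<noteq> j" for i j
    using col[OF that] frame_inj[OF p, of i j 7 i] frame_adj[OF p, of i j i 7] that by auto
  have EF: "point_cycle p i j k l \<in> E \<longleftrightarrow> mono_diag w i j k l" "point_cycle p i j k l \<in> F \<longleftrightarrow> balanced w i j k l"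
    if "i < 7" "j < 7" "k < 7" "l < 7" "distinct [i, j, k, l]" for i j k l
  proof -
    have lt: "i < 8" "j < 8" "k < 8" "l < 8" using that by simp_all
    have n: "i \<noteq> j" "i \<noteq> k" "i \<noteq> l" "j \<noteq> k" "j \<noteq> l" "k \<noteq> l" "l \<noteq> i" using that(5) by auto
    note c = point_cycle_four_cycles[OF p lt that(5)] point_cycle_in_prods_iff[OF p lt that(5)]
    note cc = col[OF that(1,2) n(1)] col[OF that(1,3) n(2)] col[OF that(4,1) n(7)] col[OF that(2,3) n(4)] col[OF that(2,4) n(5)] col[OF that(3,4) n(6)]
      colY[OF that(1,2) n(1)] colY[OF that(1,3) n(2)] colY[OF that(4,1) n(7)] colY[OF that(2,3) n(4)] colY[OF that(2,4) n(5)] colY[OF that(3,4) n(6)]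
    show "point_cycle p i j k l \<in> E \<longleftrightarrow> mono_diag w i j k l"
      unfolding E_def mono_diag_def Int_iff c(2)[OF z(2) z(2)] cc using c(1) by blast
    show "point_cycle p i j k l \<in> F \<longleftrightarrow> balanced w i j k l"
    proof -
      have "point_cycle p i j k l \<in> F \<longleftrightarrow> point_cycle p i j k l \<notin> prods (tv ` ?Y) (perp_pairs X ?Y)" using c(1) unfolding F_def by blast
      then show ?thesis unfolding balanced_def c(2)[OF z(1) z(2)] cc by blast
    qed
  qed
  have "point_cycle p 0 4 5 6 \<in> E" "point_cycle p 0 1 2 3 \<in> F" using EF w by (auto simp: bad_word_def)
  then have "seven_cycle p \<in> prods E F" unfolding prods_def seven_cycle_def by blast
  then have "seven_cycle p \<in> prods F E" using SS_comm[OF ES FS] by (simp flip: conv_pos_iff)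
  then obtain h h' where h: "h \<in> F" "h' \<in> E" "h \<circ> h' = seven_cycle p" by (auto simp: prods_def)
  then obtain m where m: "m < 7" "h = point_cycle p m ((m + 4) mod 7) ((m + 5) mod 7) ((m + 6) mod 7)"
      "h' = point_cycle p m ((m + 1) mod 7) ((m + 2) mod 7) ((m + 3) mod 7)"
    using seven_cycle_factorizations[OF p, of h h'] unfolding E_def F_def by blast
  have "m = 0 \<or> m = 1 \<or> m = 2 \<or> m = 3 \<or> m = 4 \<or> m = 5 \<or> m = 6" using m(1) by arith
  then have d: "distinct [m, (m + 4) mod 7, (m + 5) mod 7, (m + 6) mod 7]"
    "distinct [m, (m + 1) mod 7, (m + 2) mod 7, (m + 3) mod 7]"
    by (elim disjE; simp)+
  have "balanced w m ((m + 4) mod 7) ((m + 5) mod 7) ((m + 6) mod 7)"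
    "mono_diag w m ((m + 1) mod 7) ((m + 2) mod 7) ((m + 3) mod 7)"
    using h(1,2) unfolding m(2,3) using EF(2)[OF _ _ _ _ d(1)] EF(1)[OF _ _ _ _ d(2)] m(1) by simp_all
  then show False using w m(1) unfolding bad_word_def by blast
qed

end

section \<open>Closed sets of vectors\<close>

context symplectic
begin

definition closed_set :: "(bit ^ 'n) set \<Rightarrow> bool"
  where "closed_set X \<longleftrightarrow> (\<forall>a\<in>X. \<forall>b\<in>X. a \<bowtie> b \<longrightarrow> a + b \<in> X)"

definition perp :: "(bit ^ 'n) set \<Rightarrow> (bit ^ 'n) set"
  where "perp X = {b. \<forall>a\<in>X. \<not> a \<bowtie> b}"

lemma perp_0: "0 \<in> perp X"
  by (simp add: perp_def)

lemma perp_add: "x \<in> perp X \<Longrightarrow> y \<in> perp X \<Longrightarrow> x + y \<in> perp X"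
  by (simp add: perp_def)

lemma perp_Diff_0: "perp (X - {0}) = perp X"
  by (auto simp: perp_def)

lemma obtain_frame:
  assumes "pairwise_adj [a, b, c, d, e, f]"
  obtains p where "frame p" "\<And>i. i < 7 \<Longrightarrow> p i = [0, a, b, c, d, e, f] ! i"
proof -
  let ?p = "\<lambda>i. [0, a, b, c, d, e, f, a + b + c + d + e + f] ! i"
  have "frame ?p" unfolding frame_def
    using six_adj[OF assms] by (simp add: All_less_Suc numeral_nat)
  moreover have "?p i = [0, a, b, c, d, e, f] ! i" if "i < 7" for i
  proof -
    have "?p i = ([0, a, b, c, d, e, f] @ [a + b + c + d + e + f]) ! i" by simp
    then show ?thesis using that by (simp only: nth_append) simp
  qed
  ultimately show ?thesis using that by blast
qed

lemma pairwise_adjI: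
  assumes "a \<bowtie> b" "a \<bowtie> c" "a \<bowtie> d" "a \<bowtie> e" "a \<bowtie> f" "b \<bowtie> c" "b \<bowtie> d" "b \<bowtie> e" "b \<bowtie> f"
    "c \<bowtie> d" "c \<bowtie> e" "c \<bowtie> f" "d \<bowtie> e" "d \<bowtie> f" "e \<bowtie> f"
  shows "pairwise_adj [a, b, c, d, e, f]"
  using assms adj_sym by (simp add: pairwise_adj_def All_less_Suc numeral_nat)

text \<open>The hypothesis says that the indicator of \<open>X\<close> is a quadratic form with
  polarization \<open>B\<close>. On a coset of a hyperbolic plane its four values sum to
  \<open>B a b = 1\<close>, so both values occur.\<close>

lemma four_of_coset:
  assumes q: "\<And>u v. u + v \<in> X \<longleftrightarrow> ((u \<in> X) \<noteq> (v \<in> X)) \<noteq> (u \<bowtie> v)" and "a \<bowtie> b"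
  shows "\<exists>t\<in>{0, a, b, a + b}. (v + t \<in> X) = \<tau>"
proof -
  have "((v \<in> X) \<noteq> (v + a \<in> X)) \<noteq> ((v + b \<in> X) \<noteq> (v + (a + b) \<in> X))"
    using assms(2) unfolding q by auto
  then show ?thesis by auto
qed

end

context schur_sets
begin

lemma perp_VV:
  assumes "X \<in> VV" shows "perp X - {0} \<in> VV"
proof -
  have "perp X - {0} = {b \<in> V0. card {a \<in> X. a \<bowtie> b} = 0}" by (auto simp: perp_def)
  then show ?thesis using degree_level_VV[OF assms, of 0] by simp
qed

lemma no_bad_six:
  assumes X: "X \<in> VV" and adj: "pairwise_adj [a, b, c, d, e, f]" and w: "bad_word w"
    and col: "\<And>i j. j < i \<Longrightarrow> i < 7 \<Longrightarrow> [0, a, b, c, d, e, f] ! i + [0, a, b, c, d, e, f] ! j \<in> X \<longleftrightarrow> w i = w j"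
  shows False
proof -
  obtain p where p: "frame p" "\<And>i. i < 7 \<Longrightarrow> p i = [0, a, b, c, d, e, f] ! i"
    using obtain_frame[OF adj] by blast
  have "p i + p j \<in> X \<longleftrightarrow> w i = w j" if "i < 7" "j < 7" "i \<noteq> j" for i j
  proof (cases "j < i")
    case True
    then show ?thesis using col[of j i] p(2) that by simp
  next
    case False
    then have "p j + p i \<in> X \<longleftrightarrow> w j = w i" using col[of i j] p(2) that by simp
    then show ?thesis by (simp only: add.commute eq_commute)
  qed
  then show False using no_bad_word[OF X p(1) w] by blast
qed

section \<open>One of the two colour classes is closed\<close>

lemma opposite_edges_types:
  assumes X: "X \<in> VV" and h: "b \<bowtie> c" "b \<bowtie> d" "\<not> c \<bowtie> d" "c \<noteq> d" and b: "(b \<in> X) \<noteq> (b + c + d \<in> X)"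
  shows "(b + c \<in> X \<longleftrightarrow> c \<in> X) \<and> (b + d \<in> X \<longleftrightarrow> d \<in> X) \<or> (b + d \<in> X \<longleftrightarrow> c \<in> X) \<and> (b + c \<in> X \<longleftrightarrow> d \<in> X)"
proof -
  define side where "side v = (if v \<in> X then X else V0 - X)" for v
  have s: "side v \<in> VV" for v using X VV_compl[OF X] by (simp add: side_def)
  have m: "u \<in> side v \<longleftrightarrow> (u \<in> X \<longleftrightarrow> v \<in> X)" if "u \<noteq> 0" for u v using that by (auto simp: side_def)
  have n: "b \<noteq> 0" "c \<noteq> 0" "d \<noteq> 0" "b + c \<noteq> 0" "b + d \<noteq> 0" "b + c + d \<noteq> 0"
    using h adj_sym[of b c] adj_sym[of b d] by (auto simp: bit_vec_add_eq_iff)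
  show ?thesis
    using opposite_edges[OF s[of b] s[of c] s[of d] h] b m n by auto
qed

definition two_on_line :: "(bit ^ 'n) set \<Rightarrow> bit ^ 'n \<Rightarrow> bit ^ 'n \<Rightarrow> bool"
  where "two_on_line X u v \<longleftrightarrow> u \<in> X \<and> v \<in> X \<and> u + v \<notin> X \<or> u \<in> X \<and> v \<notin> X \<and> u + v \<in> X \<or> u \<notin> X \<and> v \<in> X \<and> u + v \<in> X"

definition one_on_line :: "(bit ^ 'n) set \<Rightarrow> bit ^ 'n \<Rightarrow> bit ^ 'n \<Rightarrow> bool"
  where "one_on_line X u v \<longleftrightarrow> u \<notin> X \<and> v \<notin> X \<and> u + v \<in> X \<or> u \<notin> X \<and> v \<in> X \<and> u + v \<notin> X \<or> u \<in> X \<and> v \<notin> X \<and> u + v \<notin> X"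

text \<open>As the lines share \<open>p\<close>, the numbers of points of \<open>X\<close> in
  \<open>{q, p + q}\<close> and \<open>{r, p + r}\<close> would differ by one, so exactly one of the
  opposite pairs \<open>{q, r}\<close> and \<open>{p + q, p + r}\<close> would be two-coloured. The
  condition on opposite edges then gives \<open>p\<close> the common colour of the other pair, which
  contradicts the count on one of the lines.\<close>

lemma tetrahedron_lines:
  assumes X: "X \<in> VV" and h: "p \<bowtie> q" "p \<bowtie> r" "\<not> q \<bowtie> r" "q \<noteq> r"
  shows "\<not> (two_on_line X p q \<and> one_on_line X p r)"
proof -
  have s: "q \<bowtie> p" "r \<bowtie> p" "\<not> r \<bowtie> q" using h adj_sym by blast+
  have e: "q + p + (p + q + r) = r" "q + (p + q + r) = p + r" "q + p = p + q"
    "p + q + p + (p + q + r) = p + r" "p + q + p = q" "p + q + (p + q + r) = r"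
    by (simp_all add: ac_simps)
  have n: "p \<noteq> p + q + r" using h(4) by (simp add: add.assoc)
  note 1 = opposite_edges_types[OF X h]
  have 2: "(q \<in> X) \<noteq> (r \<in> X) \<Longrightarrow> (p + q \<in> X \<longleftrightarrow> p \<in> X) \<and> (p + r \<in> X \<longleftrightarrow> p + q + r \<in> X) \<or> (p + r \<in> X \<longleftrightarrow> p \<in> X) \<and> (p + q \<in> X \<longleftrightarrow> p + q + r \<in> X)"
    using opposite_edges_types[OF X, of q p "p + q + r"] s h n unfolding e by simp
  have 3: "(p + q \<in> X) \<noteq> (p + r \<in> X) \<Longrightarrow> (q \<in> X \<longleftrightarrow> p \<in> X) \<and> (r \<in> X \<longleftrightarrow> p + q + r \<in> X) \<or> (r \<in> X \<longleftrightarrow> p \<in> X) \<and> (q \<in> X \<longleftrightarrow> p + q + r \<in> X)"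
    using opposite_edges_types[OF X, of "p + q" p "p + q + r"] s h n unfolding e by simp
  show ?thesis using 1 2 3 unfolding two_on_line_def one_on_line_def by argo
qed

text \<open>If \<open>q\<close> and \<open>r\<close> are adjacent, \<open>r\<close> is replaced by
  \<open>p + r\<close>, which lies on the same line and is orthogonal to \<open>q\<close>.\<close>

lemma meeting_lines:
  assumes X: "X \<in> VV" and h: "p \<bowtie> q" "p \<bowtie> r"
  shows "\<not> (two_on_line X p q \<and> one_on_line X p r)"
proof -
  have t: "\<not> (two_on_line X p q \<and> one_on_line X p q)" by (auto simp: two_on_line_def one_on_line_def)
  have o: "one_on_line X p (p + r) \<longleftrightarrow> one_on_line X p r" by (auto simp: one_on_line_def)
  show ?thesis
  proof (cases "q = r \<or> q = p + r")
    case True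
    then show ?thesis using t o by auto
  next
    case False
    show ?thesis
    proof (cases "q \<bowtie> r")
      case False
      then show ?thesis using tetrahedron_lines[OF X h] \<open>\<not> (q = r \<or> q = p + r)\<close> by blast
    next
      case True
      then have "\<not> q \<bowtie> p + r" using h(1) adj_sym[of p q] by simp
      then show ?thesis using tetrahedron_lines[OF X h(1), of "p + r"] h(2) False o by simp
    qed
  qed
qed

text \<open>Otherwise the line through \<open>x\<close> and \<open>y\<close> would contain both
  colours and clash with the given line at \<open>y\<close> or with the one at
  \<open>x\<close>.\<close>

lemma mixed_lines_orthogonal:
  assumes X: "X \<in> VV" and x: "x \<in> X" "x' \<in> X" "x \<bowtie> x'" "x + x' \<notin> X"
    and y: "y \<notin> X" "y' \<notin> X" "y \<bowtie> y'" "y + y' \<in> X"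
  shows "\<not> x \<bowtie> y"
proof
  assume xy: "x \<bowtie> y"
  have yx: "y \<bowtie> x" using xy adj_sym by blast
  show False
  proof (cases "x + y \<in> X")
    case True
    then show False using meeting_lines[OF X yx y(3)] x y by (auto simp: two_on_line_def one_on_line_def add.commute)
  next
    case False
    then show False using meeting_lines[OF X x(3) xy] x y by (auto simp: two_on_line_def one_on_line_def)
  qed
qed

text \<open>Given bad lines of both kinds, a vector \<open>v\<close> adjacent to \<open>x\<close>
  and to \<open>y\<close> replaces, according to its colour, \<open>y\<close> by
  \<open>y + v\<close> or \<open>x\<close> by \<open>x + v\<close>. The new vector lies on a bad
  line of the same kind but is adjacent to the other vector.\<close>

lemma closed_or_complement_closed:
  assumes X: "X \<in> VV" shows "closed_set X \<or> closed_set (V0 - X)"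
proof (rule ccontr)
  assume "\<not> ?thesis"
  then obtain x x' y y' where x: "x \<in> X" "x' \<in> X" "x \<bowtie> x'" "x + x' \<notin> X"
    and y: "y \<notin> X" "y' \<notin> X" "y \<bowtie> y'" "y + y' \<notin> V0 - X"
    unfolding closed_set_def by blast
  have "y + y' \<noteq> 0" using y(3) by auto
  then have y4: "y + y' \<in> X" using y(4) by simp
  note y = y(1-3) y4
  obtain v where v: "x \<bowtie> v" "y \<bowtie> v"
    using obtain_adj2[of x y True True] x y by (metis adj_0(1))
  note orth = mixed_lines_orthogonal[OF X]
  show False
  proof (cases "v \<in> X")
    case True
    have "\<not> two_on_line X y v" using meeting_lines[OF X v(2) y(3)] y by (auto simp: one_on_line_def)
    then have "y + v \<notin> X" using True y(1) by (auto simp: two_on_line_def)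
    moreover have "y + v \<bowtie> y" using v(2) adj_sym[of v y] by simp
    ultimately have "\<not> x \<bowtie> y + v" using orth[OF x, of "y + v" y] y(1) True by (simp add: ac_simps)
    then show False using orth[OF x y] v(1) by simp
  next
    case False
    have "\<not> one_on_line X x v" using meeting_lines[OF X x(3) v(1)] x by (auto simp: two_on_line_def)
    then have "x + v \<in> X" using False x(1) by (auto simp: one_on_line_def)
    moreover have "x + v \<bowtie> x" using v(1) adj_sym[of v x] by simp
    ultimately have "\<not> x + v \<bowtie> y" using orth[OF _ x(1) _ _ y, of "x + v"] False by (simp add: ac_simps)
    then show False using orth[OF x y] v(2) adj_sym[of v y] by simp
  qed
qed

section \<open>Hyperplanes and quadrics\<close>

lemma extend_indep:
  assumes us: "indep us" "length us \<le> 6" "length us = length \<beta>"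
  obtains v where "v \<notin> list_span us" "list_all2 (\<lambda>u b. (u \<bowtie> v) = b) us \<beta>"
proof -
  have "card (list_span us) * 2 ^ length us \<le> 2 ^ length us * 2 ^ length us" using card_list_span_le by simp
  also have "\<dots> = 2 ^ (length us + length us)" by (simp add: power_add)
  \<comment> \<open>Twice the length is at most 12, which is below the dimension.\<close>
  also have "\<dots> < 2 ^ CARD('n)" using us(2) dim by (intro power_strict_increasing) auto
  finally show ?thesis using sols_avoiding[OF us(1,3), of "list_span us"] that by blast
qed

text \<open>An edge lies in the hyperplane iff its ends have the same value under the form with
  \<open>x\<close>, so the points are chosen with the first bad word as their list of
  values.\<close>

lemma hyperplane_not_VV:
  assumes X: "{b. b \<noteq> 0 \<and> \<not> x \<bowtie> b} \<in> VV" and x: "x \<noteq> 0"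
  shows False
proof -
  obtain p1 where p1: "p1 \<notin> list_span [x]" "\<not> x \<bowtie> p1"
    using extend_indep[of "[x]" "[False]"] x by auto
  obtain p2 where p2: "p2 \<notin> list_span [p1, x]" "p1 \<bowtie> p2" "x \<bowtie> p2"
    using extend_indep[of "[p1, x]" "[True, True]"] x p1 by (auto simp del: list_span.simps(2))
  obtain p3 where p3: "p3 \<notin> list_span [p2, p1, x]" "p2 \<bowtie> p3" "p1 \<bowtie> p3" "x \<bowtie> p3"
    using extend_indep[of "[p2, p1, x]" "[True, True, True]"] x p1 p2 by (auto simp del: list_span.simps(2))
  obtain p4 where p4: "p4 \<notin> list_span [p3, p2, p1, x]" "p3 \<bowtie> p4" "p2 \<bowtie> p4" "p1 \<bowtie> p4" "x \<bowtie> p4"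
    using extend_indep[of "[p3, p2, p1, x]" "[True, True, True, True]"] x p1 p2 p3 by (auto simp del: list_span.simps(2))
  obtain p5 where p5: "p5 \<notin> list_span [p4, p3, p2, p1, x]" "p4 \<bowtie> p5" "p3 \<bowtie> p5" "p2 \<bowtie> p5" "p1 \<bowtie> p5" "\<not> x \<bowtie> p5"
    using extend_indep[of "[p4, p3, p2, p1, x]" "[True, True, True, True, False]"] x p1 p2 p3 p4 by (auto simp del: list_span.simps(2))
  obtain p6 where p6: "p5 \<bowtie> p6" "p4 \<bowtie> p6" "p3 \<bowtie> p6" "p2 \<bowtie> p6" "p1 \<bowtie> p6" "x \<bowtie> p6"
    using extend_indep[of "[p5, p4, p3, p2, p1, x]" "[True, True, True, True, True, True]"] x p1 p2 p3 p4 p5 by (auto simp del: list_span.simps(2))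
  have adj: "pairwise_adj [p1, p2, p3, p4, p5, p6]" by (rule pairwise_adjI) (use p1 p2 p3 p4 p5 p6 in blast)+
  note s = six_adj[OF adj]
  have n: "u \<noteq> v" if "u \<bowtie> v" for u v using that by auto
  note ne = s[THEN n]
  have nz: "p1 \<noteq> 0" "p2 \<noteq> 0" "p3 \<noteq> 0" "p4 \<noteq> 0" "p5 \<noteq> 0" "p6 \<noteq> 0" using s by auto
  show False
  proof (rule no_bad_six[OF X adj bad_words(1)])
    fix i j :: nat assume "j < i" "i < 7"
    then show "[0, p1, p2, p3, p4, p5, p6] ! i + [0, p1, p2, p3, p4, p5, p6] ! j \<in> {b. b \<noteq> 0 \<and> \<not> x \<bowtie> b} \<longleftrightarrow>
        [0, 0, 1, 1, 1, 0, 1] ! i = [0, 0, 1, 1, 1, 0, 1 :: nat] ! j"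
      using p1(2) p2(3) p3(4) p4(5) p5(6) p6(6) ne nz
      by (auto simp: numeral_nat less_Suc_eq)
  qed
qed

text \<open>For pairwise adjacent points the bilinear term is always 1, so again an edge lies in
  \<open>X\<close> iff its ends have the same label, where a non-zero point has label 0 iff it
  belongs to \<open>X\<close>. The same word as for hyperplanes therefore applies.\<close>

lemma quadric_not_VV:
  assumes X: "X \<in> VV" and q: "\<And>u v. u + v \<in> X \<longleftrightarrow> ((u \<in> X) \<noteq> (v \<in> X)) \<noteq> (u \<bowtie> v)"
  shows False
proof -
  have step: "\<exists>v. v \<notin> list_span us \<and> (\<forall>u\<in>set us. u \<bowtie> v) \<and> (v \<in> X) = \<tau>" if us: "indep us" "length us \<le> 5" for us \<tau>
  proof -
    \<comment> \<open>The worst case is 13: the span of seven vectors avoided under six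
      equations.\<close>
    have bound: "card (list_span vs) * 2 ^ k < 2 ^ CARD('n)" if "length vs + k \<le> 13" for vs :: "(bit ^ 'n) list" and k
    proof -
      have "card (list_span vs) * 2 ^ k \<le> 2 ^ length vs * 2 ^ k" using card_list_span_le by simp
      also have "\<dots> = 2 ^ (length vs + k)" by (simp add: power_add)
      also have "\<dots> < 2 ^ CARD('n)" using that dim by (intro power_strict_increasing) auto
      finally show ?thesis .
    qed
    have la: "list_all2 (\<lambda>u b. (u \<bowtie> v) = b) us (replicate (length us) \<beta>) \<longleftrightarrow> (\<forall>u\<in>set us. (u \<bowtie> v) = \<beta>)" for v \<beta>
      by (simp add: list_all2_conv_all_nth all_set_conv_all_nth)
    obtain v0 where v0: "v0 \<notin> list_span us" "\<forall>u\<in>set us. u \<bowtie> v0"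
      using sols_avoiding[of us "replicate (length us) True" "list_span us"] bound[of us "length us"] us la[of _ True] by auto
    \<comment> \<open>A hyperbolic plane spanned by \<open>a\<close> and \<open>b\<close>,
      orthogonal to \<open>us\<close>, allows the colour of \<open>v0\<close> to be adjusted without
      disturbing its equations.\<close>
    obtain a where a: "a \<notin> list_span (v0 # us)" "\<forall>u\<in>set us. \<not> u \<bowtie> a"
      using sols_avoiding[of us "replicate (length us) False" "list_span (v0 # us)"] bound[of "v0 # us" "length us"] us la[of _ False]
      by (auto simp del: list_span.simps(2))
    have ia: "indep (a # us)" using a us by simp
    have "card (list_span (a # v0 # us)) * 2 ^ length (a # us) < 2 ^ CARD('n)" by (rule bound) (use us in simp)
    then obtain b where b: "b \<notin> list_span (a # v0 # us)"
        and "list_all2 (\<lambda>u c. (u \<bowtie> b) = c) (a # us) (True # replicate (length us) False)"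
      using sols_avoiding[OF ia, of "True # replicate (length us) False"] by (metis length_Cons length_replicate)
    then have b2: "a \<bowtie> b" "\<forall>u\<in>set us. \<not> u \<bowtie> b" using la[of b False] by simp_all
    obtain t where t: "t \<in> {0, a, b, a + b}" "(v0 + t \<in> X) = \<tau>"
      using four_of_coset[OF q b2(1)] by blast
    have "v0 + t \<notin> list_span us"
    proof
      assume c: "v0 + t \<in> list_span us"
      have c1: "list_span us \<subseteq> list_span (v0 # us)" by simp
      have v0': "v0 \<in> list_span (v0 # us)" using set_subset_list_span[of "v0 # us"] by simp
      have a': "a \<in> list_span (a # v0 # us)" using set_subset_list_span[of "a # v0 # us"] by simp
      have "v0 + (v0 + t) \<in> list_span (v0 # us)" using list_span_add[OF v0'] c c1 by blast
      then have tt: "t \<in> list_span (v0 # us)" by simp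
      then have tt': "t \<in> list_span (a # v0 # us)" by simp
      have "a + t \<in> list_span (a # v0 # us)" using list_span_add[OF a' tt'] .
      moreover have "t = 0 \<or> t = a \<or> t = b \<or> t = a + b" using t(1) by blast
      ultimately show False using tt tt' a(1) b c v0(1)
        by (elim disjE) (simp_all del: list_span.simps)
    qed
    moreover have "\<forall>u\<in>set us. u \<bowtie> v0 + t" using t(1) v0(2) a(2) b2(2) by auto
    ultimately show ?thesis using t(2) by blast
  qed
  obtain p1 where p1: "p1 \<notin> list_span []" "p1 \<in> X" using step[of "[]" True] by auto
  obtain p2 where p2: "p2 \<notin> list_span [p1]" "p1 \<bowtie> p2" "p2 \<notin> X" using step[of "[p1]" False] p1 by auto
  obtain p3 where p3: "p3 \<notin> list_span [p2, p1]" "p2 \<bowtie> p3" "p1 \<bowtie> p3" "p3 \<notin> X"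
    using step[of "[p2, p1]" False] p1 p2 by (auto simp del: list_span.simps(2))
  obtain p4 where p4: "p4 \<notin> list_span [p3, p2, p1]" "p3 \<bowtie> p4" "p2 \<bowtie> p4" "p1 \<bowtie> p4" "p4 \<notin> X"
    using step[of "[p3, p2, p1]" False] p1 p2 p3 by (auto simp del: list_span.simps(2))
  obtain p5 where p5: "p5 \<notin> list_span [p4, p3, p2, p1]" "p4 \<bowtie> p5" "p3 \<bowtie> p5" "p2 \<bowtie> p5" "p1 \<bowtie> p5" "p5 \<in> X"
    using step[of "[p4, p3, p2, p1]" True] p1 p2 p3 p4 by (auto simp del: list_span.simps(2))
  obtain p6 where p6: "p5 \<bowtie> p6" "p4 \<bowtie> p6" "p3 \<bowtie> p6" "p2 \<bowtie> p6" "p1 \<bowtie> p6" "p6 \<notin> X"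
    using step[of "[p5, p4, p3, p2, p1]" False] p1 p2 p3 p4 p5 by (auto simp del: list_span.simps(2))
  have adj: "pairwise_adj [p1, p2, p3, p4, p5, p6]" by (rule pairwise_adjI) (use p1 p2 p3 p4 p5 p6 in blast)+
  note s = six_adj[OF adj]
  have z: "0 \<notin> X" by (rule VV_0[OF X])
  show False
  proof (rule no_bad_six[OF X adj bad_words(1)])
    fix i j :: nat assume "j < i" "i < 7"
    then show "[0, p1, p2, p3, p4, p5, p6] ! i + [0, p1, p2, p3, p4, p5, p6] ! j \<in> X \<longleftrightarrow>
        [0, 0, 1, 1, 1, 0, 1] ! i = [0, 0, 1, 1, 1, 0, 1 :: nat] ! j"
      unfolding q using p1(2) p2(3) p3(4) p4(5) p5(6) p6(6) s z
      by (auto simp: numeral_nat less_Suc_eq)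
  qed
qed

end

section \<open>Fourier analysis of closed sets with constant degrees\<close>

context symplectic
begin

text \<open>The additive characters of the space, indexed by its own vectors through the
  form.\<close>

definition chi :: "bit ^ 'n \<Rightarrow> bit ^ 'n \<Rightarrow> int" where "chi a b = (if a \<bowtie> b then - 1 else 1)"

lemma chi_add_left: "chi (a + b) c = chi a c * chi b c"
  by (simp add: chi_def)

lemma chi_sym: "chi a b = chi b a"
  using adj_sym by (simp add: chi_def)

lemma sum_chi: "(\<Sum>b\<in>UNIV. chi b c) = (if c = 0 then 2 ^ CARD('n) else 0)"
proof (cases "c = 0")
  case True
  then show ?thesis by (simp add: chi_def)
next
  case False
  then obtain z where z: "z \<bowtie> c" using adj_nondegenerate adj_sym by blast
  have "(\<Sum>b\<in>UNIV. chi b c) = (\<Sum>b\<in>UNIV. chi (b + z) c)"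
    by (rule sum.reindex_bij_witness[of _ "\<lambda>b. b + z" "\<lambda>b. b + z"]) (simp_all add: add.assoc)
  also have "\<dots> = (\<Sum>b\<in>UNIV. - chi b c)" using z by (intro sum.cong) (auto simp: chi_def)
  also have "\<dots> = - (\<Sum>b\<in>UNIV. chi b c)" by (rule sum_negf)
  finally show ?thesis using False by simp
qed

definition fourier :: "(bit ^ 'n) set \<Rightarrow> bit ^ 'n \<Rightarrow> int" where "fourier X b = (\<Sum>a\<in>X. chi a b)"

lemma fourier_eq: "fourier X b = int (card X) - 2 * int (card {a \<in> X. a \<bowtie> b})"
proof -
  have "fourier X b = (\<Sum>a\<in>X. 1 - 2 * (if a \<bowtie> b then 1 else 0))"
    unfolding fourier_def by (rule sum.cong) (auto simp: chi_def)
  also have "\<dots> = int (card X) - 2 * (\<Sum>a\<in>X. if a \<bowtie> b then 1 else 0)"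
    by (simp add: sum_subtractf sum_distrib_left)
  also have "(\<Sum>a\<in>X. if a \<bowtie> b then 1 else 0) = int (card {a \<in> X. a \<bowtie> b})"
    by (simp add: sum.If_cases Int_def conj_commute)
  finally show ?thesis .
qed

lemma fourier_inversion: "(\<Sum>b\<in>UNIV. fourier X b * chi b c) = (if c \<in> X then 2 ^ CARD('n) else 0)"
proof -
  have "(\<Sum>b\<in>UNIV. fourier X b * chi b c) = (\<Sum>b\<in>UNIV. \<Sum>a\<in>X. chi b (a + c))"
    unfolding fourier_def sum_distrib_right
    by (intro sum.cong refl) (metis chi_add_left chi_sym)
  also have "\<dots> = (\<Sum>a\<in>X. if a = c then 2 ^ CARD('n) else 0)"
    by (subst sum.swap) (simp add: sum_chi)
  also have "\<dots> = (if c \<in> X then 2 ^ CARD('n) else 0)" by simp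
  finally show ?thesis .
qed

lemma fourier_square_inversion:
  "(\<Sum>b\<in>UNIV. (fourier X b)\<^sup>2 * chi b c) = 2 ^ CARD('n) * int (card {a \<in> X. a + c \<in> X})"
proof -
  have "(\<Sum>b\<in>UNIV. (fourier X b)\<^sup>2 * chi b c) = (\<Sum>b\<in>UNIV. \<Sum>a\<in>X. fourier X b * chi b (a + c))"
  proof (intro sum.cong refl)
    fix b
    have "(fourier X b)\<^sup>2 * chi b c = (\<Sum>a\<in>X. chi a b) * (fourier X b * chi b c)"
      by (simp add: power2_eq_square fourier_def)
    also have "\<dots> = (\<Sum>a\<in>X. fourier X b * chi b (a + c))"
      unfolding sum_distrib_right
    proof (intro sum.cong refl)
      fix a show "chi a b * (fourier X b * chi b c) = fourier X b * chi b (a + c)"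
        using chi_add_left[of a c b] chi_sym[of b "a + c"] chi_sym[of c b] by simp
    qed
    finally show "(fourier X b)\<^sup>2 * chi b c = (\<Sum>a\<in>X. fourier X b * chi b (a + c))" .
  qed
  also have "\<dots> = (\<Sum>a\<in>X. if a + c \<in> X then 2 ^ CARD('n) else 0)"
    by (subst sum.swap) (simp add: fourier_inversion)
  also have "\<dots> = 2 ^ CARD('n) * int (card {a \<in> X. a + c \<in> X})"
    by (simp add: sum.If_cases Int_def conj_commute)
  finally show ?thesis .
qed

text \<open>Away from 0, the transform of a function constant on \<open>{0}\<close>, on
  \<open>X\<close> and on the rest is an affine function of the transform of
  \<open>X\<close>.\<close>

lemma sum_three_values:
  assumes c: "c \<noteq> 0" and X: "0 \<notin> X"
    and H: "H 0 = h0" "\<And>b. b \<in> X \<Longrightarrow> H b = h1" "\<And>b. b \<noteq> 0 \<Longrightarrow> b \<notin> X \<Longrightarrow> H b = h2"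
  shows "(\<Sum>b\<in>UNIV. H b * chi b c) = (h1 - h2) * fourier X c + (h0 - h2)"
proof -
  have "(\<Sum>b\<in>UNIV. H b * chi b c) = (\<Sum>b\<in>UNIV. h2 * chi b c + ((h1 - h2) * (if b \<in> X then chi b c else 0) + (if b = 0 then h0 - h2 else 0)))"
    using H X by (intro sum.cong refl) (auto simp: chi_def)
  also have "\<dots> = h2 * (\<Sum>b\<in>UNIV. chi b c) + ((h1 - h2) * (\<Sum>b\<in>UNIV. if b \<in> X then chi b c else 0) + (h0 - h2))"
    by (simp add: sum.distrib sum_distrib_left)
  also have "(\<Sum>b\<in>UNIV. if b \<in> X then chi b c else 0) = fourier X c"
    by (simp add: fourier_def sum.If_cases)
  finally show ?thesis using c by (simp add: sum_chi)
qed

text \<open>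
  If every vector of \<open>X\<close> has \<open>dX\<close> and every other non-zero vector \<open>dY\<close> neighbours in \<open>X\<close>, then the Fourier
  transform of \<open>X\<close> takes the two values \<open>p\<close>, \<open>q\<close> outside \<open>0\<close>; Fourier inversion forces \<open>p - q = \<plusminus>2\<^sup>m\<close>.
  Closedness turns the count of the sums within \<open>X\<close> into a quadratic inequality for \<open>s = \<plusminus>q\<close>.
\<close>

lemma intriguing_closed:
  assumes n: "CARD('n) = 2 * m" and X: "0 \<notin> X" "closed_set X" and x: "x0 \<in> X" and y: "y0 \<noteq> 0" "y0 \<notin> X"
    and dX: "\<And>b. b \<in> X \<Longrightarrow> card {a \<in> X. a \<bowtie> b} = dX"
    and dY: "\<And>b. b \<noteq> 0 \<Longrightarrow> b \<notin> X \<Longrightarrow> card {a \<in> X. a \<bowtie> b} = dY"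
  shows "(\<forall>u v. u + v \<in> X \<longleftrightarrow> ((u \<in> X) \<noteq> (v \<in> X)) \<noteq> (u \<bowtie> v)) \<or>
    (\<exists>s\<le>3. int (card X) = s * (2 ^ m - 1) \<and> 2 * int dX = (s - 1) * 2 ^ m)"
proof -
  define M N p q :: int where "M = 2 ^ m" and "N = int (card X)" and "p = N - 2 * int dX" and "q = N - 2 * int dY"
  have MM: "2 ^ CARD('n) = M * M" by (simp add: n M_def power_mult_distrib mult_2 power_add)
  have M: "M > 0" by (simp add: M_def)
  have x0: "x \<noteq> 0" if "x \<in> X" for x using that X by auto
  have F: "fourier X 0 = N" "\<And>b. b \<in> X \<Longrightarrow> fourier X b = p" "\<And>b. b \<noteq> 0 \<Longrightarrow> b \<notin> X \<Longrightarrow> fourier X b = q"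
    using dX dY by (auto simp: fourier_eq N_def p_def q_def)
  have F2: "(fourier X 0)\<^sup>2 = N\<^sup>2" "\<And>b. b \<in> X \<Longrightarrow> (fourier X b)\<^sup>2 = p\<^sup>2" "\<And>b. b \<noteq> 0 \<Longrightarrow> b \<notin> X \<Longrightarrow> (fourier X b)\<^sup>2 = q\<^sup>2"
    using F by auto
  have lin: "(p - q) * fourier X c + (N - q) = (if c \<in> X then M * M else 0)" if "c \<noteq> 0" for c
    using sum_three_values[where H = "fourier X", OF that X(1) F] fourier_inversion[of X c] MM by (cases "c \<in> X") simp_all
  have quad: "(p\<^sup>2 - q\<^sup>2) * fourier X c + (N\<^sup>2 - q\<^sup>2) = M * M * int (card {a \<in> X. a + c \<in> X})" if "c \<noteq> 0" for c
    using sum_three_values[where H = "\<lambda>b. (fourier X b)\<^sup>2", OF that X(1) F2] fourier_square_inversion[of X c] MM by simp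
  have eX: "(p - q) * p + (N - q) = M * M" using lin[of x0] F(2)[OF x] x x0 by simp
  have eY: "(p - q) * q + (N - q) = 0" using lin[of y0] F(3)[OF y] y by simp
  \<comment> \<open>The difference of the two preceding equations is
    \<open>(p - q)\<^sup>2 = M\<^sup>2\<close>.\<close>
  have "(p - q - M) * (p - q + M) = 0" using eX eY by (simp add: algebra_simps)
  then have pq: "p - q = M \<or> p - q = - M" by auto
  have Npos: "N > 0" using x by (auto simp: N_def card_gt_0_iff)
  define mX mY where "mX x = int (card {a \<in> X. a + x \<in> X})" and "mY y = int (card {a \<in> X. a + y \<in> X})" for x y
  have qX: "(p\<^sup>2 - q\<^sup>2) * p + (N\<^sup>2 - q\<^sup>2) = M * M * mX x" if "x \<in> X" for x
    using quad[of x] F(2)[OF that] x0[OF that] by (simp add: mX_def)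
  have qY: "(p\<^sup>2 - q\<^sup>2) * q + (N\<^sup>2 - q\<^sup>2) = M * M * mY y" if "y \<noteq> 0" "y \<notin> X" for y
    using quad[of y] F(3)[OF that] that by (simp add: mY_def)
  have subX: "{a \<in> X. a \<bowtie> x} \<subseteq> {a \<in> X. a + x \<in> X}" if "x \<in> X" for x
    using X(2) that by (auto simp: closed_set_def)
  have geX: "int dX \<le> mX x" if "x \<in> X" for x
    using card_mono[OF _ subX[OF that]] dX[OF that] by (simp add: mX_def)
  have nb: "y \<notin> X \<Longrightarrow> a \<in> X \<Longrightarrow> a + y \<in> X \<Longrightarrow> \<not> a \<bowtie> y" for a y
    using X(2) unfolding closed_set_def by (metis adj_add_right adj_irrefl bit_vec_add_self_left)
  \<comment> \<open>A line through a point \<open>y\<close> outside \<open>X\<close> and a neighbour of \<open>y\<close> has at most one point in \<open>X\<close>.\<close>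
  have half: "card ({a \<in> X. a \<bowtie> y} \<union> (+) y ` {a \<in> X. a \<bowtie> y}) = 2 * dY" if y: "y \<noteq> 0" "y \<notin> X" for y
  proof -
    have "{a \<in> X. a \<bowtie> y} \<inter> (+) y ` {a \<in> X. a \<bowtie> y} = {}" using nb[OF y(2)] by (auto simp: add.commute[of y])
    moreover have "card ((+) y ` {a \<in> X. a \<bowtie> y}) = dY" using dY[OF y] by (simp add: card_image)
    ultimately show ?thesis using dY[OF y] by (simp add: card_Un_disjoint)
  qed
  have nbr: "2 * int (card {a. a \<bowtie> y}) = M * M" if "y \<noteq> 0" for y
  proof -
    have "fourier UNIV y = 0" using sum_chi[of y] that by (simp add: fourier_def)
    moreover have "int (card (UNIV :: (bit ^ 'n) set)) = M * M" by (simp flip: MM)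
    ultimately show ?thesis using fourier_eq[of UNIV y] by simp
  qed
  have sub: "{a \<in> X. a \<bowtie> y} \<union> (+) y ` {a \<in> X. a \<bowtie> y} \<subseteq> {a. a \<bowtie> y}" for y by auto
  have "2 * dY \<le> card {a. a \<bowtie> y0}" using card_mono[OF _ sub[of y0]] half[OF y] by simp
  then have dYle: "4 * int dY \<le> M * M" using nbr[OF y(1)] by linarith
  \<comment> \<open>Equality in the three estimates makes the sets compared coincide, which decides
    membership of every sum \<open>u + v\<close>.\<close>
  have quadric: ?thesis if e1: "int dX = mX x0" and e2: "mY y0 = N - int dY" and e3: "4 * int dY = M * M"
  proof -
    have mXc: "mX x = mX x0" if "x \<in> X" for x using qX[OF that] qX[OF x] M by simp
    have mYc: "mY y' = mY y0" if "y' \<noteq> 0" "y' \<notin> X" for y' using qY[OF that] qY[OF y] M by simp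
    have A: "a + x \<in> X \<longleftrightarrow> a \<bowtie> x" if "a \<in> X" "x \<in> X" for a x
    proof -
      have "{a \<in> X. a \<bowtie> x} = {a \<in> X. a + x \<in> X}"
        by (rule card_subset_eq[OF _ subX[OF that(2)]]) (use e1 mXc[OF that(2)] dX[OF that(2)] in \<open>simp_all add: mX_def\<close>)
      then show ?thesis using that by blast
    qed
    have Bv: "a + v \<in> X \<longleftrightarrow> \<not> a \<bowtie> v" if "a \<in> X" "v \<noteq> 0" "v \<notin> X" for a v
    proof -
      have "card X = card ({a \<in> X. a \<bowtie> v} \<union> {a \<in> X. \<not> a \<bowtie> v})" by (rule arg_cong[of _ _ card]) auto
      also have "\<dots> = dY + card {a \<in> X. \<not> a \<bowtie> v}" using dY[OF that(2,3)] by (subst card_Un_disjoint) auto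
      finally have "int (card {a \<in> X. \<not> a \<bowtie> v}) = mY y0" using e2 by (simp add: N_def)
      then have "{a \<in> X. a + v \<in> X} = {a \<in> X. \<not> a \<bowtie> v}"
        by (intro card_subset_eq) (use nb[OF that(3)] mYc[OF that(2,3)] in \<open>auto simp: mY_def\<close>)
      then show ?thesis using that by blast
    qed
    have Cv: "u \<in> X \<or> u + v \<in> X" if "u \<bowtie> v" "v \<noteq> 0" "v \<notin> X" for u v
    proof -
      have "{a \<in> X. a \<bowtie> v} \<union> (+) v ` {a \<in> X. a \<bowtie> v} = {a. a \<bowtie> v}"
        by (rule card_subset_eq[OF _ sub]) (use half[OF that(2,3)] nbr[OF that(2)] e3 in simp_all)
      then have "u \<in> {a \<in> X. a \<bowtie> v} \<union> (+) v ` {a \<in> X. a \<bowtie> v}" using that(1) by blast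
      then show ?thesis by (auto simp: add.commute[of v] add.assoc)
    qed
    have "u + v \<in> X \<longleftrightarrow> ((u \<in> X) \<noteq> (v \<in> X)) \<noteq> (u \<bowtie> v)" for u v
    proof (cases "u = 0 \<or> v = 0 \<or> u = v")
      case True
      then show ?thesis using X(1) by auto
    next
      case False
      then have nz: "u \<noteq> 0" "v \<noteq> 0" "u + v \<noteq> 0" by auto
      consider "u \<in> X" "v \<in> X" | "u \<in> X" "v \<notin> X" | "u \<notin> X" "v \<in> X" | "u \<notin> X" "v \<notin> X" by blast
      then show ?thesis
      proof cases
        case 1
        then show ?thesis using A by blast
      next
        case 2
        then show ?thesis using Bv[of u v] nz by blast
      next
        case 3
        then show ?thesis using Bv[of v u] nz adj_sym[of u v] by (simp add: add.commute)
      next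
        case 4
        show ?thesis
        proof (cases "u \<bowtie> v")
          case True
          then show ?thesis using Cv[of u v] nz 4 by blast
        next
          case False
          then have "u + v \<notin> X" using Bv[of "u + v" v] nz 4 by (auto simp: add.assoc)
          then show ?thesis using 4 False by blast
        qed
      qed
    qed
    then show ?thesis by blast
  qed
  from pq show ?thesis
  proof
    \<comment> \<open>For this sign the estimates leave only \<open>M = 2 * s\<close>, the
      quadric.\<close>
    assume a: "p - q = - M"
    define s where "s = q"
    have p: "p = s - M" "q = s" using a by (simp_all add: s_def)
    have N: "N = s * (M + 1)" using eY unfolding p by (simp add: algebra_simps)
    have "M * M * mX x0 = M * M * (s * s + 3 * s - M)"
      using qX[OF x] unfolding p N by (simp add: power2_eq_square algebra_simps)
    then have mx: "mX x0 = s * s + 3 * s - M" using M by simp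
    have "M * M * mY y0 = M * M * (s * s + s)"
      using qY[OF y] unfolding p N by (simp add: power2_eq_square algebra_simps)
    then have my: "mY y0 = s * s + s" using M by simp
    have dx: "2 * int dX = s * M + M" using p(1) N unfolding p_def by (simp add: algebra_simps)
    have dy: "2 * int dY = s * M" using p(2) N unfolding q_def by (simp add: algebra_simps)
    have s: "s > 0" using Npos M unfolding N by (simp add: zero_less_mult_iff)
    have "(s + 3) * (2 * s - M) \<ge> 0" using geX[OF x] dx mx by (simp add: algebra_simps)
    then have 1: "2 * s \<ge> M" using s by (simp add: zero_le_mult_iff)
    have "2 * s * M \<le> M * M" using dYle dy by simp
    then have 2: "2 * s \<le> M" using M by simp
    have M2: "M = 2 * s" using 1 2 by simp
    show ?thesis
      by (rule quadric) (use dx mx my dy N M2 in \<open>simp_all add: algebra_simps\<close>)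
  next
    \<comment> \<open>For this sign the factor \<open>s - 3\<close> in the inequality leaves a
      second possibility, the sparse case \<open>s \<le> 3\<close>.\<close>
    assume a: "p - q = M"
    define s where "s = - q"
    have p: "p = M - s" "q = - s" using a by (simp_all add: s_def)
    have N: "N = s * (M - 1)" using eY unfolding p by (simp add: algebra_simps)
    have "M * M * mX x0 = M * M * (s * s - 3 * s + M)"
      using qX[OF x] unfolding p N by (simp add: power2_eq_square algebra_simps)
    then have mx: "mX x0 = s * s - 3 * s + M" using M by simp
    have "M * M * mY y0 = M * M * (s * s - s)"
      using qY[OF y] unfolding p N by (simp add: power2_eq_square algebra_simps)
    then have my: "mY y0 = s * s - s" using M by simp
    have dx: "2 * int dX = s * M - M" using p(1) N unfolding p_def by (simp add: algebra_simps)
    have dy: "2 * int dY = s * M" using p(2) N unfolding q_def by (simp add: algebra_simps)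
    have i: "(s - 3) * (2 * s - M) \<ge> 0" using geX[OF x] dx mx by (simp add: algebra_simps)
    have "2 * s * M \<le> M * M" using dYle dy by simp
    then have 2: "2 * s \<le> M" using M by simp
    show ?thesis
    proof (cases "s \<le> 3")
      case True
      have "int (card X) = s * (2 ^ m - 1) \<and> 2 * int dX = (s - 1) * 2 ^ m"
        using N dx by (simp add: N_def M_def algebra_simps)
      then show ?thesis using True by blast
    next
      case False
      then have "2 * s \<ge> M" using i by (simp add: zero_le_mult_iff)
      then have M2: "M = 2 * s" using 2 by simp
      show ?thesis
        by (rule quadric) (use dx mx my dy N M2 in \<open>simp_all add: algebra_simps\<close>)
    qed
  qed
qed

end

lemma bit_vec_mult_2: "2 * x = (0 :: bit ^ 'n)"
  by (simp only: mult_2 bit_vec_add_self)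

section \<open>Sparse closed sets and totally isotropic sets\<close>

context schur_sets
begin

text \<open>If \<open>c' + c\<close> were in \<open>X\<close>, it would be adjacent to
  \<open>c'\<close> and to no other member of \<open>C\<close>. The forbidden sums thus come from
  disjoint subsets \<open>Z c'\<close> of \<open>X\<close>, and altogether they cost only
  \<open>card X\<close> vectors, however large \<open>C\<close> is. As \<open>c\<close> is adjacent
  to \<open>a\<close>, avoiding \<open>X\<close> itself costs only the degree of
  \<open>a\<close>.\<close>

lemma sparse_step:
  assumes us: "indep us" and a: "a \<in> set us" and C: "C \<subseteq> set us" "\<And>u v. u \<in> C \<Longrightarrow> v \<in> C \<Longrightarrow> u \<noteq> v \<Longrightarrow> u \<bowtie> v"
    and bound: "(card (X :: (bit ^ 'n) set) + card {x \<in> X. x \<bowtie> a} + card Q) * 2 ^ length us < 2 ^ CARD('n)"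
  shows "\<exists>c. (\<forall>u\<in>set us. u \<bowtie> c) \<and> c \<notin> X \<and> (\<forall>c'\<in>C. c' + c \<notin> X) \<and> c \<notin> Q"
proof -
  define Z where "Z c' = {z \<in> X. z \<bowtie> c' \<and> (\<forall>c''\<in>C - {c'}. \<not> z \<bowtie> c'')}" for c'
  let ?Bad = "{x \<in> X. x \<bowtie> a} \<union> (\<Union>c'\<in>C. (+) c' ` Z c') \<union> Q"
  have "card (\<Union>c'\<in>C. (+) c' ` Z c') \<le> (\<Sum>c'\<in>C. card ((+) c' ` Z c'))" by (rule card_UN_le) simp
  also have "\<dots> \<le> (\<Sum>c'\<in>C. card (Z c'))" by (intro sum_mono card_image_le) simp
  also have "\<dots> = card (\<Union>c'\<in>C. Z c')"
    by (rule card_UN_disjoint[symmetric]) (auto simp: Z_def)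
  also have "\<dots> \<le> card X" by (rule card_mono) (auto simp: Z_def)
  finally have "card (\<Union>c'\<in>C. (+) c' ` Z c') \<le> card X" .
  then have "card ?Bad \<le> card X + card {x \<in> X. x \<bowtie> a} + card Q"
    using card_Un_le[of "{x \<in> X. x \<bowtie> a} \<union> (\<Union>c'\<in>C. (+) c' ` Z c')" Q]
      card_Un_le[of "{x \<in> X. x \<bowtie> a}" "\<Union>c'\<in>C. (+) c' ` Z c'"] by linarith
  then have "card ?Bad * 2 ^ length us \<le> (card X + card {x \<in> X. x \<bowtie> a} + card Q) * 2 ^ length us" by (rule mult_right_mono) simp
  then have b: "card ?Bad * 2 ^ length us < 2 ^ CARD('n)" using bound by linarith
  obtain c where c: "c \<notin> ?Bad" "list_all2 (\<lambda>u b. (u \<bowtie> c) = b) us (replicate (length us) True)"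
    by (rule sols_avoiding[OF us _ b, of "replicate (length us) True"]) simp
  have adj: "\<forall>u\<in>set us. u \<bowtie> c" using c(2) by (simp add: list_all2_conv_all_nth all_set_conv_all_nth)
  have "c \<notin> X" using c(1) adj a adj_sym by blast
  moreover have "c' + c \<notin> X" if c': "c' \<in> C" for c'
  proof
    assume "c' + c \<in> X"
    moreover have "c' + c \<bowtie> c'" using adj C(1) c' adj_sym by auto
    moreover have "\<not> c' + c \<bowtie> c''" if "c'' \<in> C - {c'}" for c''
      using adj C that c' adj_sym[of c c''] by auto
    ultimately have "c' + c \<in> Z c'" by (simp add: Z_def)
    then have "c' + (c' + c) \<in> (+) c' ` Z c'" by (rule imageI)
    then show False using c(1) c' by auto
  qed
  ultimately show ?thesis using adj c(1) by blast
qed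

text \<open>The points \<open>0\<close>, \<open>a\<close>, \<open>b\<close> carry the repeated
  label, since \<open>a\<close>, \<open>b\<close> and \<open>a + b\<close> are in \<open>X\<close>.
  All other edges lie outside: those from a \<open>c_i\<close> to \<open>a\<close> or
  \<open>b\<close> by closedness, the remaining ones by the choice of the \<open>c_i\<close>. The
  exponent \<open>CARD('n) - 5\<close> is what the five equations for \<open>c4\<close>
  require.\<close>

lemma sparse_not_VV:
  assumes X: "X \<in> VV" "closed_set X" and ab: "a \<in> X" "b \<in> X" "a \<bowtie> b"
    and bound: "card X + card {x \<in> X. x \<bowtie> a} < 2 ^ (CARD('n) - 5)"
  shows False
proof -
  let ?D = "card X + card {x \<in> X. x \<bowtie> a}"
  have n: "(2::nat) ^ CARD('n) = 2 ^ (CARD('n) - 5) * 2 ^ 5" using dim power_add[of "2::nat" "CARD('n) - 5" 5] by simp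
  have bnd: "(?D + e) * 2 ^ k < 2 ^ CARD('n)" if "k < 5 \<and> e \<le> 1 \<or> k = 5 \<and> e = 0" for k e :: nat
  proof (cases "k = 5")
    case True
    then show ?thesis using bound that unfolding n by simp
  next
    case False
    then have "?D + e \<le> 2 ^ (CARD('n) - 5)" "k < 5" using bound that by auto
    then have "(?D + e) * 2 ^ k \<le> 2 ^ (CARD('n) - 5) * 2 ^ k" by (intro mult_right_mono) simp_all
    also have "\<dots> < 2 ^ (CARD('n) - 5) * 2 ^ 5" using power_strict_increasing[OF \<open>k < 5\<close>, of "2::nat"] by simp
    finally show ?thesis unfolding n .
  qed
  have s: "b \<bowtie> a" "a + b \<in> X" "a \<noteq> b" "a \<noteq> 0" "b \<noteq> 0" 
    using X(2) ab adj_sym by (auto simp: closed_set_def)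
  obtain c1 where c1: "b \<bowtie> c1" "a \<bowtie> c1" "c1 \<notin> X"
    using sparse_step[of "[b, a]" a "{}" X "{}"] bnd[of 2 0] s by auto
  have i3: "indep [c1, b, a]" using c1 s ab VV_0[OF X(1)] by (auto simp: add.commute[of b])
  obtain c2 where c2: "c1 \<bowtie> c2" "b \<bowtie> c2" "a \<bowtie> c2" "c2 \<notin> X" "c1 + c2 \<notin> X"
    using sparse_step[OF i3, of a "{c1}" X "{}"] bnd[of 3 0] by auto
  have i4: "indep [c2, c1, b, a]"
  proof -
    have "c2 \<notin> list_span [c1, b, a]"
    proof
      assume "c2 \<in> list_span [c1, b, a]"
      then have "c2 = 0 \<or> c2 = a \<or> c2 = b \<or> c2 = b + a \<or> c2 = c1 \<or> c2 = c1 + a \<or> c2 = c1 + b \<or> c2 = c1 + (b + a)" by auto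
      then show False using c1 c2 ab s adj_sym[of c1 a] adj_sym[of c1 b] by (elim disjE) auto
    qed
    then show ?thesis using i3 by simp
  qed
  have c12: "c2 \<bowtie> c1" using c2 adj_sym by blast
  \<comment> \<open>In the span of four pairwise adjacent vectors only their sum is adjacent to all
    four; excluding this one vector makes \<open>c3\<close> independent.\<close>
  obtain c3 where c3: "c2 \<bowtie> c3" "c1 \<bowtie> c3" "b \<bowtie> c3" "a \<bowtie> c3" "c3 \<notin> X" "c1 + c3 \<notin> X" "c2 + c3 \<notin> X" "c3 \<noteq> a + (b + (c1 + c2))"
    using sparse_step[OF i4, of a "{c1, c2}" X "{a + (b + (c1 + c2))}"] bnd[of 4 1] c2(1) c12 by auto
  have i5: "indep [c3, c2, c1, b, a]"
  proof -
    have "c3 \<notin> list_span [c2, c1, b, a]"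
    proof
      assume "c3 \<in> list_span [c2, c1, b, a]"
      then have "c3 = 0 \<or> c3 = a \<or> c3 = b \<or> c3 = b + a \<or> c3 = c1 \<or> c3 = c1 + a \<or> c3 = c1 + b \<or> c3 = c1 + (b + a) \<or>
        c3 = c2 \<or> c3 = c2 + a \<or> c3 = c2 + b \<or> c3 = c2 + (b + a) \<or> c3 = c2 + c1 \<or> c3 = c2 + (c1 + a) \<or> c3 = c2 + (c1 + b) \<or> c3 = a + (b + (c1 + c2))"
        by (auto simp: ac_simps)
      then show False using c1 c2 c3 c12 ab s adj_sym[of c1 a] adj_sym[of c1 b] adj_sym[of c2 a] adj_sym[of c2 b]
        by (elim disjE) auto
    qed
    then show ?thesis using i4 by simp
  qed
  have c123: "c3 \<bowtie> c1" "c3 \<bowtie> c2" using c3 adj_sym by blast+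
  obtain c4 where c4: "c3 \<bowtie> c4" "c2 \<bowtie> c4" "c1 \<bowtie> c4" "b \<bowtie> c4" "a \<bowtie> c4" "c4 \<notin> X" "c1 + c4 \<notin> X" "c2 + c4 \<notin> X" "c3 + c4 \<notin> X"
    using sparse_step[OF i5, of a "{c1, c2, c3}" X "{}"] bnd[of 5 0] c2(1) c12 c123 c3(1,2) by auto
  have shift: "x + c \<notin> X" if "x \<in> X" "x \<bowtie> c" "c \<notin> X" for x c
  proof
    assume "x + c \<in> X"
    moreover have "x \<bowtie> x + c" using that(2) by simp
    ultimately have "x + (x + c) \<in> X" using X(2) that(1) by (simp only: closed_set_def)
    then show False using that(3) by simp
  qed
  have out: "a + c1 \<notin> X" "b + c1 \<notin> X" "a + c2 \<notin> X" "b + c2 \<notin> X" "a + c3 \<notin> X" "b + c3 \<notin> X" "a + c4 \<notin> X" "b + c4 \<notin> X"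
    using shift ab c1 c2 c3 c4 by blast+
  \<comment> \<open>The points \<open>c1, c2, c3, 0, a, c4, b\<close>, translated by \<open>c1\<close>.\<close>
  have adj: "pairwise_adj [c1 + c2, c1 + c3, c1, c1 + a, c1 + c4, c1 + b]"
    by (rule pairwise_adjI) (use c1 c2 c3 c4 ab s adj_sym in simp_all)
  show False
  proof (rule no_bad_six[OF X(1) adj bad_words(2)])
    fix i j :: nat assume ij: "j < i" "i < 7"
    have t: "c1 + u + (c1 + v) = u + v" "c1 + u + c1 = u" "c1 + (c1 + u) = u" for u v by (simp_all add: ac_simps)
    show "[0, c1 + c2, c1 + c3, c1, c1 + a, c1 + c4, c1 + b] ! i + [0, c1 + c2, c1 + c3, c1, c1 + a, c1 + c4, c1 + b] ! j \<in> X \<longleftrightarrow>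
        [0, 1, 2, 3, 3, 4, 3] ! i = [0, 1, 2, 3, 3, 4, 3 :: nat] ! j"
      using ij c1(3) c2(4,5) c3(5-7) c4(6-9) out ab(1,2) s(2)
      by (auto simp: numeral_nat less_Suc_eq t add.commute bit_vec_mult_2)
  qed
qed

text \<open>Among the points \<open>0, v4, v5, v2, v2 + w2, w1, v6\<close> only the edges
  \<open>w1\<close> and \<open>w2\<close> lie in \<open>X\<close>. A vector adjacent to
  \<open>w1\<close> or \<open>w2\<close> is outside \<open>X\<close> by isotropy; this settles all
  other edges except the three among \<open>v4, v5, v6\<close>, which are kept outside by a count
  against the size of \<open>X\<close>.\<close>

lemma isotropic_not_VV:
  assumes X: "X \<in> VV" and iso: "\<And>u v. u \<in> X \<Longrightarrow> v \<in> X \<Longrightarrow> \<not> u \<bowtie> v"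
    and w: "w1 \<in> X" "w2 \<in> X" "w1 \<noteq> w2" and small: "card X * card X \<le> 2 ^ CARD('n)"
  shows False
proof -
  obtain m where m: "CARD('n) = 2 * m" using even_dim by blast
  have m7: "m \<ge> 7" using m dim by simp
  have nz: "w1 \<noteq> 0" "w2 \<noteq> 0" using w VV_0[OF X] by auto
  have sq: "(card X)\<^sup>2 \<le> (2 ^ m)\<^sup>2" using small by (simp add: m power2_eq_square mult_2 power_add)
  have cX: "card X \<le> 2 ^ m" using power2_le_imp_le[OF sq] by simp
  have n: "(2::nat) ^ CARD('n) = 2 ^ m * 2 ^ m" by (simp add: m mult_2 power_add)
  have m7': "(2::nat) ^ 7 \<le> 2 ^ m" using m7 by (rule power_increasing) simp
  have i2: "indep [w1, w2]" using nz w(3) by simp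
  obtain v2 where v2: "v2 \<notin> list_span [w1, w2]" "w1 \<bowtie> v2" "w2 \<bowtie> v2"
    using extend_indep[OF i2, of "[True, True]"] by (auto simp del: list_span.simps)
  have i3: "indep [v2, w1, w2]" using v2 i2 by simp
  obtain v4 where v4: "v4 \<notin> list_span [v2, w1, w2]" "v2 \<bowtie> v4" "w1 \<bowtie> v4" "\<not> w2 \<bowtie> v4"
    using extend_indep[OF i3, of "[True, True, False]"] by (auto simp del: list_span.simps)
  have i4: "indep [v4, v2, w1, w2]" using v4 i3 by simp
  have "card (list_span [v4, v2, w1, w2] \<union> (+) v4 ` X) \<le> 2 ^ 4 + 2 ^ m"
    using card_list_span_le[of "[v4, v2, w1, w2]"] card_image_le[of X "(+) v4"] cX
      card_Un_le[of "list_span [v4, v2, w1, w2]" "(+) v4 ` X"] by (simp del: list_span.simps)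
  then have "card (list_span [v4, v2, w1, w2] \<union> (+) v4 ` X) * 2 ^ length [v4, v2, w1, w2] \<le> (2 ^ 4 + 2 ^ m) * 2 ^ 4"
    by (simp del: list_span.simps)
  also have "\<dots> < 2 ^ m * 2 ^ m"
  proof -
    have "(2 ^ 4 + 2 ^ m) * 2 ^ 4 < 2 ^ 7 * (2 ^ m :: nat)" using m7' by simp
    also have "\<dots> \<le> 2 ^ m * 2 ^ m" using m7' by (rule mult_right_mono) simp
    finally show ?thesis .
  qed
  finally have b5: "card (list_span [v4, v2, w1, w2] \<union> (+) v4 ` X) * 2 ^ length [v4, v2, w1, w2] < 2 ^ CARD('n)" unfolding n .
  obtain v5 where v5: "v5 \<notin> list_span [v4, v2, w1, w2] \<union> (+) v4 ` X" "v4 \<bowtie> v5" "v2 \<bowtie> v5" "w1 \<bowtie> v5" "\<not> w2 \<bowtie> v5"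
    using sols_avoiding[OF i4 _ b5, of "[True, True, True, False]"] by (auto simp del: list_span.simps)
  have i5: "indep [v5, v4, v2, w1, w2]" using v5(1) i4 by simp
  have "card ((+) v4 ` X \<union> (+) v5 ` X) \<le> 2 ^ m + 2 ^ m"
    using card_image_le[of X "(+) v4"] card_image_le[of X "(+) v5"] cX card_Un_le[of "(+) v4 ` X" "(+) v5 ` X"] by simp
  then have "card ((+) v4 ` X \<union> (+) v5 ` X) * 2 ^ length [v5, v4, v2, w1, w2] \<le> (2 ^ m + 2 ^ m) * 2 ^ 5" by simp
  also have "\<dots> < 2 ^ 7 * (2 ^ m :: nat)" by simp
  also have "\<dots> \<le> 2 ^ m * 2 ^ m" using m7' by (rule mult_right_mono) simp
  finally have b6: "card ((+) v4 ` X \<union> (+) v5 ` X) * 2 ^ length [v5, v4, v2, w1, w2] < 2 ^ CARD('n)" unfolding n .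
  obtain v6 where v6': "v6 \<notin> (+) v4 ` X \<union> (+) v5 ` X"
      "list_all2 (\<lambda>u b. (u \<bowtie> v6) = b) [v5, v4, v2, w1, w2] [True, True, True, True, False]"
    by (rule sols_avoiding[OF i5 _ b6, of "[True, True, True, True, False]"]) simp
  then have v6: "v6 \<notin> (+) v4 ` X \<union> (+) v5 ` X" "v5 \<bowtie> v6" "v4 \<bowtie> v6" "v2 \<bowtie> v6" "w1 \<bowtie> v6" "\<not> w2 \<bowtie> v6"
    by simp_all
  have sh: "u + v \<notin> X" if "v \<notin> (+) u ` X" for u v
    using that by (metis bit_vec_add_self_left image_eqI)
  have o: "v4 + v5 \<notin> X" "v4 + v6 \<notin> X" "v5 + v6 \<notin> X" using v5(1) v6(1) sh by auto
  have hit: "u \<notin> X" if "w1 \<bowtie> u \<or> w2 \<bowtie> u" for u using that iso w by blast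
  have ww: "\<not> w1 \<bowtie> w2" "\<not> w2 \<bowtie> w1" using iso w by blast+
  have adj: "pairwise_adj [v4, v5, v2, v2 + w2, w1, v6]"
    by (rule pairwise_adjI) (use v2 v4 v5 v6 ww adj_sym in auto)
  show False
  proof (rule no_bad_six[OF X adj bad_words(3)])
    fix i j :: nat assume ij: "j < i" "i < 7"
    have h: "v4 \<notin> X" "v5 \<notin> X" "v2 \<notin> X" "v2 + w2 \<notin> X" "v6 \<notin> X"
      "v2 + v4 \<notin> X" "v2 + v5 \<notin> X" "v2 + w2 + v4 \<notin> X" "v2 + w2 + v5 \<notin> X"
      "w1 + v4 \<notin> X" "w1 + v5 \<notin> X" "w1 + v2 \<notin> X" "w1 + (v2 + w2) \<notin> X" 
      "v6 + v2 \<notin> X" "v6 + (v2 + w2) \<notin> X" "v6 + w1 \<notin> X"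
      by (rule hit; use v2 v4 v5 v6 ww in simp)+
    have o': "v5 + v4 \<notin> X" "v6 + v4 \<notin> X" "v6 + v5 \<notin> X" using o by (simp_all add: add.commute)
    show "[0, v4, v5, v2, v2 + w2, w1, v6] ! i + [0, v4, v5, v2, v2 + w2, w1, v6] ! j \<in> X \<longleftrightarrow>
        [0, 1, 2, 3, 3, 0, 4] ! i = [0, 1, 2, 3, 3, 0, 4 :: nat] ! j"
      using ij h o' w(1,2) by (auto simp: numeral_nat less_Suc_eq)
  qed
qed

end

section \<open>Exclusion of subspaces and of all proper S-sets of transvections\<close>

context schur_sets
begin

lemma obtain_half_dim: 
  obtains m where "CARD('n) = 2 * m" "m \<ge> 7"
proof -
  obtain m where "CARD('n) = 2 * m" using even_dim by blast
  then show ?thesis using that dim by simp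
qed

text \<open>The radical of \<open>R\<close> is again an S-set and totally isotropic. If it has only
  one non-zero vector, its perp is a hyperplane; otherwise \<open>isotropic_not_VV\<close>
  applies.\<close>

lemma not_isotropic_radical:
  assumes R: "R - {0} \<in> VV" "0 \<in> R" "\<And>u v. u \<in> R \<Longrightarrow> v \<in> R \<Longrightarrow> u + v \<in> R"
  shows "R \<inter> perp R = {0}"
proof (rule ccontr)
  assume ne: "R \<inter> perp R \<noteq> {0}"
  define W where "W = R \<inter> perp R"
  have W0: "0 \<in> W" using R(2) perp_0 by (simp add: W_def)
  have "W - {0} = (R - {0}) \<inter> (perp (R - {0}) - {0})" by (auto simp: W_def perp_Diff_0)
  then have WV: "W - {0} \<in> VV" using VV_int[OF R(1) perp_VV[OF R(1)]] by simp
  have iso: "\<not> u \<bowtie> v" if "u \<in> W" "v \<in> W" for u v using that by (auto simp: W_def perp_def)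
  have add: "u + v \<in> W" if "u \<in> W" "v \<in> W" for u v using that R(3) perp_add by (simp add: W_def)
  obtain x where x: "x \<in> W" "x \<noteq> 0" using ne W0 by (auto simp: W_def)
  show False
  proof (cases "W = {0, x}")
    case True
    have "perp (W - {0}) - {0} = {b. b \<noteq> 0 \<and> \<not> x \<bowtie> b}" using True x(2) by (auto simp: perp_def)
    then show False using hyperplane_not_VV[OF _ x(2)] perp_VV[OF WV] by simp
  next
    case False
    then obtain y where y: "y \<in> W" "y \<noteq> 0" "y \<noteq> x" using x W0 by blast
    \<comment> \<open>Parseval: the Fourier transform of \<open>W\<close> is constantly \<open>card W\<close> on \<open>W\<close>.\<close>
    have "fourier W b = int (card W)" if "b \<in> W" for b using iso that by (simp add: fourier_eq)
    moreover have "(fourier W b)\<^sup>2 \<ge> 0" for b by simp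
    ultimately have "(\<Sum>b\<in>W. (int (card W))\<^sup>2) \<le> (\<Sum>b\<in>UNIV. (fourier W b)\<^sup>2)"
      by (intro order_trans[OF _ sum_mono2[of UNIV W "\<lambda>b. (fourier W b)\<^sup>2"]]) simp_all
    also have "\<dots> = (\<Sum>b\<in>UNIV. (fourier W b)\<^sup>2 * chi b 0)" by (simp add: chi_def)
    also have "\<dots> = 2 ^ CARD('n) * int (card W)" unfolding fourier_square_inversion by simp
    finally have "int (card W) * (int (card W) * int (card W)) \<le> 2 ^ CARD('n) * int (card W)"
      by (simp add: power2_eq_square)
    moreover have Wp: "card W > 0" using W0 by (auto simp: card_gt_0_iff)
    ultimately have "int (card W) * int (card W) \<le> 2 ^ CARD('n)" by (simp add: mult.commute[of "2 ^ CARD('n)"])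
    then have "card W * card W \<le> 2 ^ CARD('n)" by (simp flip: of_nat_mult of_nat_power_le_of_nat_cancel_iff add: of_nat_le_numeral_power_cancel_iff)
    moreover have "card (W - {0}) * card (W - {0}) \<le> card W * card W" by (intro mult_le_mono card_mono) auto
    ultimately show False
      using isotropic_not_VV[OF WV _ _ _ y(3)[symmetric]] iso x y by auto
  qed
qed

text \<open>Both \<open>perp X\<close> and its perp have trivial radical, and they meet only in 0.
  One of them therefore has at most \<open>2 ^ m\<close> elements and is a sparse closed set
  containing adjacent vectors.\<close>

lemma perp_trivial:
  assumes X: "X \<in> VV" "X \<noteq> {}"
  shows "perp X = {0}"
proof (rule ccontr)
  assume ne: "perp X \<noteq> {0}"
  obtain m where m: "CARD('n) = 2 * m" "m \<ge> 7" by (rule obtain_half_dim)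
  define R R' where "R = perp X" and "R' = perp R"
  have RV: "R - {0} \<in> VV" unfolding R_def by (rule perp_VV[OF X(1)])
  have R'V: "R' - {0} \<in> VV" using perp_VV[OF RV] by (simp add: R'_def perp_Diff_0)
  have add: "u + v \<in> R" if "u \<in> R" "v \<in> R" for u v using that perp_add by (simp add: R_def)
  have add': "u + v \<in> R'" if "u \<in> R'" "v \<in> R'" for u v using that perp_add by (simp add: R'_def)
  have z: "0 \<in> R" "0 \<in> R'" by (simp_all add: R_def R'_def perp_0)
  have rad: "R \<inter> R' = {0}" using not_isotropic_radical[OF RV z(1) add] by (simp add: R'_def)
  have rad': "R' \<inter> perp R' = {0}" using not_isotropic_radical[OF R'V z(2) add'] by simp
  have "inj_on (\<lambda>(r, r'). r + r') (R \<times> R')"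
  proof (rule inj_onI)
    fix a b assume ab: "a \<in> R \<times> R'" "b \<in> R \<times> R'" "(\<lambda>(r, r'). r + r') a = (\<lambda>(r, r'). r + r') b"
    obtain r r' s s' where e: "a = (r, r')" "b = (s, s')" by (metis prod.exhaust)
    have "r + s = r' + s'"
    proof -
      have "r + s = r + (s + s') + s'" by (simp add: add.assoc)
      also have "s + s' = r + r'" using ab e by simp
      finally show ?thesis by (simp add: add.assoc)
    qed
    moreover have "r + s \<in> R" "r' + s' \<in> R'" using ab e add add' by auto
    ultimately have "r' + s' \<in> R \<inter> R'" "r + s \<in> R \<inter> R'" by simp_all
    then show "a = b" unfolding rad using e by simp
  qed
  then have "card (R \<times> R') \<le> card (UNIV :: (bit ^ 'n) set)" by (rule card_inj_on_le) simp_all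
  then have le: "card R * card R' \<le> 2 ^ m * 2 ^ m" by (simp add: card_cartesian_product m mult_2 power_add)
  have "card R \<le> 2 ^ m \<or> card R' \<le> 2 ^ m"
  proof (rule ccontr)
    assume "\<not> ?thesis"
    then have "2 ^ m * 2 ^ m < card R * card R'" by (intro mult_strict_mono) auto
    then show False using le by simp
  qed
  moreover have "R \<noteq> {0}" using ne by (simp add: R_def)
  moreover have "R' \<noteq> {0}"
  proof -
    have "X \<subseteq> R'" by (auto simp: R'_def R_def perp_def adj_sym)
    then show ?thesis using X VV_0[OF X(1)] by auto
  qed
  moreover have False if Z: "Z - {0} \<in> VV" "0 \<in> Z" "Z \<noteq> {0}" "Z \<inter> perp Z = {0}" "card Z \<le> 2 ^ m"
    and addZ: "\<And>u v. u \<in> Z \<Longrightarrow> v \<in> Z \<Longrightarrow> u + v \<in> Z" for Z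
  proof -
    obtain a where a: "a \<in> Z" "a \<noteq> 0" using Z(2,3) by blast
    then have "a \<notin> perp Z" using Z(4) by auto
    then obtain b where b: "b \<in> Z" "b \<bowtie> a" by (auto simp: perp_def)
    have ab: "a \<in> Z - {0}" "b \<in> Z - {0}" "a \<bowtie> b" using a b adj_sym by auto
    have cl: "closed_set (Z - {0})" using addZ by (auto simp: closed_set_def)
    have "card {x \<in> Z - {0}. x \<bowtie> a} \<le> card (Z - {0})" by (intro card_mono) auto
    moreover have "card (Z - {0}) < card Z" by (intro psubset_card_mono) (use Z(2) in auto)
    ultimately have "card (Z - {0}) + card {x \<in> Z - {0}. x \<bowtie> a} < 2 * 2 ^ m" using Z(5) by linarith
    also have "\<dots> = 2 ^ Suc m" by simp
    also have "\<dots> \<le> 2 ^ (CARD('n) - 5)" using m by (intro power_increasing) auto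
    finally show False using sparse_not_VV[OF Z(1) cl ab] by simp
  qed
  ultimately show False
    using RV R'V z rad rad' add add' R'_def by blast
qed

theorem VV_trivial:
  assumes D: "D \<in> VV" shows "D = {} \<or> D = V0"
proof (rule ccontr)
  assume nt: "\<not> ?thesis"
  obtain m where m: "CARD('n) = 2 * m" "m \<ge> 7" by (rule obtain_half_dim)
  have D0: "D \<subseteq> V0" using VV_0[OF D] by auto
  \<comment> \<open>Disjoint closed S-sets are orthogonal: the third point of a line meeting both
    would lie in one of them, and closedness would pull in the point of the other.\<close>
  have disj: False if "X \<in> VV" "X' \<in> VV" "X \<noteq> {}" "X' \<noteq> {}" "X \<inter> X' = {}" "closed_set X" "closed_set X'" for X X'
  proof -
    have "\<not> x \<bowtie> x'" if x: "x \<in> X" "x' \<in> X'" for x x'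
    proof
      assume xx: "x \<bowtie> x'"
      have x'x: "x' \<bowtie> x" using xx adj_sym by blast
      have "x + x' \<in> X \<union> X'" using no_rainbow_line[OF \<open>X \<in> VV\<close> \<open>X' \<in> VV\<close> \<open>X \<inter> X' = {}\<close> x xx] .
      then show False
      proof
        assume "x + x' \<in> X"
        then have "x + (x + x') \<in> X" using \<open>closed_set X\<close> x(1) xx unfolding closed_set_def by (metis adj_add_right adj_irrefl)
        then show False using x \<open>X \<inter> X' = {}\<close> by auto
      next
        assume "x + x' \<in> X'"
        then have "x' + (x + x') \<in> X'" using \<open>closed_set X'\<close> x(2) x'x unfolding closed_set_def by (metis adj_add_right adj_irrefl)
        then show False using x \<open>X \<inter> X' = {}\<close> by auto
      qed
    qed
    then have "X' \<subseteq> perp X" by (auto simp: perp_def)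
    then show False using perp_trivial[of X] that VV_0[of X'] by auto
  qed
  define Q where "Q X \<longleftrightarrow> X \<in> VV \<and> closed_set X \<and> X \<noteq> {}" for X
  have "\<exists>C0. Q C0 \<and> C0 \<noteq> V0"
    using closed_or_complement_closed[OF D] D VV_compl[OF D] nt D0 unfolding Q_def by blast
  then obtain C0 where C0: "Q C0" "C0 \<noteq> V0" by blast
  obtain C where C: "Q C" and min: "\<And>X. Q X \<Longrightarrow> card C \<le> card X"
    using ex_has_least_nat[of Q C0 card] C0(1) by blast
  have CV: "C \<in> VV" and Ccl: "closed_set C" and Cne: "C \<noteq> {}" using C by (simp_all add: Q_def)
  have C0': "0 \<notin> C" by (rule VV_0[OF CV])
  have CnV: "C \<noteq> V0"
  proof
    assume e: "C = V0"
    have "C0 \<subset> V0" using C0 VV_0[of C0] by (auto simp: Q_def)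
    then have "card C0 < card C" unfolding e by (intro psubset_card_mono) simp_all
    then show False using min[OF C0(1)] by simp
  qed
  have atomC: "C \<subseteq> X" if X: "X \<in> VV" "closed_set X" "X \<noteq> {}" for X
  proof -
    have "C \<inter> X \<noteq> {}" using disj[OF CV X(1) Cne X(3) _ Ccl X(2)] by blast
    moreover have "closed_set (C \<inter> X)" using Ccl X(2) by (auto simp: closed_set_def)
    ultimately have "card C \<le> card (C \<inter> X)" using VV_int[OF CV X(1)] by (intro min) (simp add: Q_def)
    then have "C \<inter> X = C" by (intro card_seteq) auto
    then show ?thesis by blast
  qed
  \<comment> \<open>Either \<open>X\<close> or its complement is closed, and it contains
    \<open>C\<close> unless it is empty.\<close>
  have alt: "C \<subseteq> X \<or> C \<inter> X = {}" if X: "X \<in> VV" for X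
  proof (cases "closed_set X")
    case True
    then show ?thesis using atomC[OF X] by blast
  next
    case False
    then have cl: "closed_set (V0 - X)" using closed_or_complement_closed[OF X] by blast
    show ?thesis
    proof (cases "V0 - X = {}")
      case True
      moreover have "C \<subseteq> V0" using C0' by auto
      ultimately show ?thesis by blast
    next
      case False
      then show ?thesis using atomC[OF VV_compl[OF X] cl] by blast
    qed
  qed
  let ?Y = "V0 - C"
  have YV: "?Y \<in> VV" by (rule VV_compl[OF CV])
  have Yne: "?Y \<noteq> {}" using CnV C0' by auto
  \<comment> \<open>If \<open>E\<close> and \<open>E'\<close> split the complement of
    \<open>C\<close>, then \<open>C \<union> E\<close> and \<open>C \<union> E'\<close> are closed,
    because a non-empty closed S-set contains \<open>C\<close> and so their complements are not
    closed. This makes \<open>E\<close> and \<open>E'\<close> orthogonal.\<close>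
  have atomY: "E = {} \<or> E = ?Y" if E: "E \<in> VV" "E \<subseteq> ?Y" for E
  proof (rule ccontr)
    assume n: "\<not> ?thesis"
    define E' where "E' = ?Y - E"
    have E'V: "E' \<in> VV" unfolding E'_def by (rule VV_diff[OF YV E(1)])
    have E'ne: "E' \<noteq> {}" using n E(2) by (auto simp: E'_def)
    have cl: "closed_set (C \<union> F)" if F: "F \<in> VV" "F \<subseteq> ?Y" "F \<noteq> ?Y" for F
    proof -
      have "\<not> closed_set (V0 - (C \<union> F))"
      proof
        assume "closed_set (V0 - (C \<union> F))"
        moreover have "V0 - (C \<union> F) \<noteq> {}" using F by auto
        ultimately have "C \<subseteq> V0 - (C \<union> F)" using atomC VV_compl[OF VV_un[OF CV F(1)]] by blast
        then show False using Cne by blast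
      qed
      then show ?thesis using closed_or_complement_closed[OF VV_un[OF CV F(1)]] by blast
    qed
    have clE: "closed_set (C \<union> E)" using cl E n by blast
    have clE': "closed_set (C \<union> E')" using cl[OF E'V] n E E'ne unfolding E'_def by blast
    have orth: "\<not> y \<bowtie> y'" if y: "y \<in> E" "y' \<in> E'" for y y'
    proof
      assume yy: "y \<bowtie> y'"
      have y'y: "y' \<bowtie> y" using yy adj_sym by blast
      have "E \<inter> E' = {}" by (auto simp: E'_def)
      from no_rainbow_line[OF E(1) E'V this y yy] show False
      proof
        assume "y + y' \<in> E"
        then have "y + (y + y') \<in> C \<union> E" using clE y yy unfolding closed_set_def by (metis UnCI adj_add_right adj_irrefl)
        then show False using y by (auto simp: E'_def)
      next
        assume "y + y' \<in> E'"
        then have "y' + (y + y') \<in> C \<union> E'" using clE' y y'y unfolding closed_set_def by (metis UnCI adj_add_right adj_irrefl)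
        then show False using y E(2) by (auto simp: E'_def)
      qed
    qed
    then have "E' \<subseteq> perp E" by (auto simp: perp_def)
    then show False using perp_trivial[OF E(1)] n E'ne VV_0[OF E'V] by auto
  qed
  obtain x0 where x0: "x0 \<in> C" using Cne by blast
  obtain y0 where y0: "y0 \<in> ?Y" using Yne by blast
  define dX dY where "dX = card {a \<in> C. a \<bowtie> x0}" and "dY = card {a \<in> C. a \<bowtie> y0}"
  let ?L = "\<lambda>k. {b \<in> V0. card {a \<in> C. a \<bowtie> b} = k}"
  \<comment> \<open>The degree levels are S-sets, so the degree is constant on each of the two
    atoms.\<close>
  have LV: "?L k \<in> VV" for k by (rule degree_level_VV[OF CV])
  have "x0 \<in> C \<inter> ?L dX" using x0 C0' by (auto simp: dX_def)
  then have LX: "C \<subseteq> ?L dX" using alt[OF LV[of dX]] by blast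
  have dX: "card {a \<in> C. a \<bowtie> b} = dX" if "b \<in> C" for b using subsetD[OF LX that] by simp
  have "y0 \<in> ?Y \<inter> ?L dY" using y0 by (auto simp: dY_def)
  then have "?Y \<inter> ?L dY \<noteq> {}" by blast
  then have LY: "?Y \<inter> ?L dY = ?Y" using atomY[OF VV_int[OF YV LV[of dY]]] by blast
  have dY: "card {a \<in> C. a \<bowtie> b} = dY" if "b \<noteq> 0" "b \<notin> C" for b
  proof -
    have "b \<in> ?Y \<inter> ?L dY" unfolding LY using that by simp
    then show ?thesis by simp
  qed
  have y0': "y0 \<noteq> 0" "y0 \<notin> C" using y0 by auto
  have deg: "dX \<noteq> 0"
  proof
    assume "dX = 0"
    then have "\<not> a \<bowtie> b" if "a \<in> C" "b \<in> C" for a b using dX[OF that(2)] that(1) by auto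
    then have "x0 \<in> perp C" using x0 by (auto simp: perp_def)
    then show False using perp_trivial[OF CV Cne] x0 C0' by auto
  qed
  from intriguing_closed[OF m(1) C0' Ccl x0 y0' dX dY]
  show False
  proof
    assume "\<forall>u v. u + v \<in> C \<longleftrightarrow> ((u \<in> C) \<noteq> (v \<in> C)) \<noteq> (u \<bowtie> v)"
    then show False using quadric_not_VV[OF CV] by blast
  next
    assume "\<exists>s\<le>3. int (card C) = s * (2 ^ m - 1) \<and> 2 * int dX = (s - 1) * 2 ^ m"
    then obtain s where s: "s \<le> 3" "int (card C) = s * (2 ^ m - 1)" "2 * int dX = (s - 1) * 2 ^ m" by blast
    obtain a where a: "a \<in> C" "a \<bowtie> x0" using deg dX[OF x0] by (metis (mono_tags, lifting) card.empty empty_Collect_eq)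
    have ax: "x0 \<bowtie> a" using a(2) adj_sym by blast
    have "(2::int) ^ m \<ge> 1" by simp
    then have "s * (2 ^ m - 1) \<le> 3 * (2 ^ m - 1)" using s(1) by (intro mult_right_mono) simp_all
    then have c: "int (card C) \<le> 3 * (2 ^ m - 1)" using s(2) by (simp only:)
    have "(s - 1) * 2 ^ m \<le> 2 * (2 ^ m :: int)" using s(1) by (intro mult_right_mono) simp_all
    then have "2 * int dX \<le> 2 * 2 ^ m" using s(3) by (simp only:)
    moreover have "k + l < 4 * t" if "k \<le> 3 * (t - 1)" "2 * l \<le> 2 * t" for k l t :: int using that by (simp add: algebra_simps)
    ultimately have "int (card C) + int dX < 4 * 2 ^ m" using c by blast
    then have "card C + dX < 4 * 2 ^ m" by (simp flip: of_nat_add of_nat_less_iff[where 'a = int])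
    also have "\<dots> = 2 ^ (m + 2)" by simp
    \<comment> \<open>The inequality \<open>m + 2 \<le> 2 * m - 5\<close> is exactly
      \<open>m \<ge> 7\<close>.\<close>
    also have "(2::nat) ^ (m + 2) \<le> 2 ^ (CARD('n) - 5)" using m by (intro power_increasing) auto
    finally show False using sparse_not_VV[OF CV Ccl x0 a(1) ax] dX[OF x0] by simp
  qed
qed

end

section \<open>From Schur rings to the algebra of S-sets\<close>

lemma carrier_Sp_isom:
  assumes "symplectic_form B" shows "f \<in> carrier (Sp B) \<longleftrightarrow> symplectic.isom B f"
proof -
  interpret symplectic B by unfold_locales (rule assms)
  have "Vector_Spaces.linear (*s) (*s) f \<longleftrightarrow> (\<forall>x y. f (x + y) = f x + f y)"
  proof
    assume a: "\<forall>x y. f (x + y) = f x + f y"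
    then have "f 0 = 0" by (metis add_cancel_right_right)
    then have "f (c *s x) = c *s f x" for c :: bit and x using bit_cases[of c] by auto
    then show "Vector_Spaces.linear (*s) (*s) f"
      using a unfolding Vector_Spaces.linear_iff by (intro conjI vec.vector_space_axioms) auto
  qed (simp add: Vector_Spaces.linear_iff)
  moreover have "B (f u) (f v) = B u v \<longleftrightarrow> (f u \<bowtie> f v \<longleftrightarrow> u \<bowtie> v)" for u v
    using bit_cases[of "B (f u) (f v)"] bit_cases[of "B u v"] unfolding adj_def by auto
  ultimately show ?thesis by (simp add: Sp_def isom_def)
qed

text \<open>A set is an S-set iff its indicator is constant on the principal sets. Products of
  indicators have \<open>conv\<close> as coefficients and stay in \<open>S\<close>, so their
  positive levels are unions of principal sets.\<close>

lemma schur_sets_of_schur_ring: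
  assumes n: "CARD('n) \<ge> 14" "even CARD('n)" and B: "symplectic_form (B :: bit ^ 'n \<Rightarrow> bit ^ 'n \<Rightarrow> bit)"
    and S: "commutative_schur_ring (Sp B) S P" and T: "schur_set P (transvections B)"
  shows "schur_sets B {E. indicator E \<in> S}"
proof -
  interpret symplectic B by unfold_locales (rule B)
  let ?G = "Sp B" and ?A = "group_algebra (Sp B)"
  have sr: "schur_ring ?G S P" and comm: "\<And>a b. a \<in> S \<Longrightarrow> b \<in> S \<Longrightarrow> a \<otimes>\<^bsub>?A\<^esub> b = b \<otimes>\<^bsub>?A\<^esub> a"
    using S by (auto simp: commutative_schur_ring_def)
  note mem = schur_ring_mem_iff[OF finite_carrier_Sp sr]
  have sub: "subring S ?A" using sr unfolding schur_ring_def subalgebra_of_group_algebra_def by (elim conjE)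
  have mult: "a \<otimes>\<^bsub>?A\<^esub> b \<in> S" if "a \<in> S" "b \<in> S" for a b using subringE(6)[OF sub that] .
  have ind: "indicator E \<in> S \<longleftrightarrow> E \<subseteq> carrier ?G \<and> (\<forall>D\<in>P. \<forall>x\<in>D. \<forall>y\<in>D. x \<in> E \<longleftrightarrow> y \<in> E)" for E
    unfolding mem by (auto simp: group_algebra_simps indicator_def split: if_splits)
  have conv: "(indicator E \<otimes>\<^bsub>?A\<^esub> indicator F) g = rat_of_nat (conv E F g)"
    if "E \<subseteq> carrier ?G" "F \<subseteq> carrier ?G" for E F g
  proof -
    have fin: "finite {(x, y). x \<in> carrier ?G \<and> y \<in> carrier ?G \<and> x \<otimes>\<^bsub>?G\<^esub> y = g}"
      by (rule finite_subset[of _ "carrier ?G \<times> carrier ?G"]) (auto simp: finite_carrier_Sp)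
    have "(indicator E \<otimes>\<^bsub>?A\<^esub> indicator F) g =
        (\<Sum>q\<in>{(x, y). x \<in> carrier ?G \<and> y \<in> carrier ?G \<and> x \<otimes>\<^bsub>?G\<^esub> y = g}. if fst q \<in> E \<and> snd q \<in> F then 1 else 0)"
      by (simp add: group_algebra_def) (rule sum.cong, auto simp: indicator_def)
    also have "\<dots> = rat_of_nat (card ({(x, y). x \<in> carrier ?G \<and> y \<in> carrier ?G \<and> x \<otimes>\<^bsub>?G\<^esub> y = g} \<inter> {q. fst q \<in> E \<and> snd q \<in> F}))"
      using fin by (simp add: sum.If_cases)
    also have "{(x, y). x \<in> carrier ?G \<and> y \<in> carrier ?G \<and> x \<otimes>\<^bsub>?G\<^esub> y = g} \<inter> {q. fst q \<in> E \<and> snd q \<in> F} =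
        {(x, y). x \<in> E \<and> y \<in> F \<and> x \<circ> y = g}"
      using that by (auto simp: Sp_def)
    finally show ?thesis by (simp add: conv_def)
  qed
  show ?thesis
  proof (intro schur_sets.intro schur_sets_axioms.intro)
    show "symplectic B" by (rule symplectic_axioms)
    show "CARD('n) \<ge> 14" "even CARD('n)" by (rule n)+
  next
    fix E F assume "E \<in> {E. indicator E \<in> S}" "F \<in> {E. indicator E \<in> S}"
    then have EF: "indicator E \<in> S" "indicator F \<in> S" by auto
    then have c: "E \<subseteq> carrier ?G" "F \<subseteq> carrier ?G" by (simp_all only: ind)
    have eqE: "\<forall>D\<in>P. \<forall>x\<in>D. \<forall>y\<in>D. x \<in> E \<longleftrightarrow> y \<in> E" using EF(1) unfolding ind by (rule conjunct2)
    have eqF: "\<forall>D\<in>P. \<forall>x\<in>D. \<forall>y\<in>D. x \<in> F \<longleftrightarrow> y \<in> F" using EF(2) unfolding ind by (rule conjunct2)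
    have eq: "x \<in> E \<longleftrightarrow> y \<in> E" "x \<in> F \<longleftrightarrow> y \<in> F" if "D \<in> P" "x \<in> D" "y \<in> D" for D x y
      using eqE[rule_format, OF that] eqF[rule_format, OF that] by blast+
    have "\<forall>D\<in>P. \<forall>x\<in>D. \<forall>y\<in>D. x \<in> E - F \<longleftrightarrow> y \<in> E - F"
      and "\<forall>D\<in>P. \<forall>x\<in>D. \<forall>y\<in>D. x \<in> E \<union> F \<longleftrightarrow> y \<in> E \<union> F"
      by (intro ballI; simp only: Diff_iff Un_iff; metis eq)+
    moreover have "E - F \<subseteq> carrier ?G" "E \<union> F \<subseteq> carrier ?G" using c by auto
    ultimately show "E - F \<in> {E. indicator E \<in> S}" "E \<union> F \<in> {E. indicator E \<in> S}"
      unfolding mem_Collect_eq ind by - (rule conjI, assumption, assumption)+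
    have "indicator E \<otimes>\<^bsub>?A\<^esub> indicator F \<in> S" by (rule mult[OF EF])
    then have mA: "(indicator E \<otimes>\<^bsub>?A\<^esub> indicator F) \<in> carrier ?A \<and> (\<forall>D\<in>P. \<forall>x\<in>D. \<forall>y\<in>D. (indicator E \<otimes>\<^bsub>?A\<^esub> indicator F) x = (indicator E \<otimes>\<^bsub>?A\<^esub> indicator F) y)"
      unfolding mem .
    have m1: "g \<in> carrier ?G" if "conv E F g > 0" for g
    proof (rule ccontr)
      assume "g \<notin> carrier ?G"
      then have "(indicator E \<otimes>\<^bsub>?A\<^esub> indicator F) g = 0" using conjunct1[OF mA] unfolding group_algebra_simps by blast
      then show False using conv[OF c, of g] that by simp
    qed
    have m2: "conv E F x = conv E F y" if "D \<in> P" "x \<in> D" "y \<in> D" for D x y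
    proof -
      have "rat_of_nat (conv E F x) = rat_of_nat (conv E F y)"
        using conjunct2[OF mA, rule_format, OF that] unfolding conv[OF c] .
      then show ?thesis by (simp only: of_nat_eq_iff)
    qed
    show "conv E F g = conv F E g" for g
      using fun_cong[OF comm[OF EF], of g] conv[OF c, of g] conv[OF c(2,1), of g] by simp
    show "{g. conv E F g = k} \<in> {E. indicator E \<in> S}" if "k > 0" for k
      unfolding mem_Collect_eq ind
    proof (intro conjI ballI subsetI)
      fix g assume "g \<in> {g. conv E F g = k}"
      then show "g \<in> carrier ?G"
        using m1[of g] \<open>k > 0\<close> by simp
    next
      fix D x y assume "D \<in> P" "x \<in> D" "y \<in> D"
      then have "conv E F x = conv E F y" by (rule m2)
      then show "conv E F x = k \<longleftrightarrow> conv E F y = k" by simp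
    qed
  next
    have tT: "transvection B ` V0 = transvections B" by (auto simp: transvections_def)
    have part: "disjoint P" using sr by (simp add: schur_ring_def partition_on_def)
    obtain Q where Q: "Q \<subseteq> P" "transvections B = \<Union>Q" using T by (auto simp: schur_set_def)
    have "transvections B \<subseteq> carrier ?G"
      by (auto simp: transvections_def carrier_Sp_isom[OF B])
    moreover have "x \<in> transvections B \<longleftrightarrow> y \<in> transvections B" if "D \<in> P" "x \<in> D" "y \<in> D" for D x y
    proof -
      have "z \<in> transvections B \<longleftrightarrow> D \<in> Q" if z: "z \<in> D" for z
      proof
        assume "z \<in> transvections B"
        then obtain D' where D': "D' \<in> Q" "z \<in> D'" using Q(2) by auto
        then have "D' = D" using disjointD[OF part, of D' D] Q(1) \<open>D \<in> P\<close> z by auto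
        then show "D \<in> Q" using D'(1) by simp
      qed (use Q(2) z in auto)
      then show ?thesis using that by simp
    qed
    ultimately show "transvection B ` V0 \<in> {E. indicator E \<in> S}"
      unfolding tT mem_Collect_eq ind by blast
  qed
qed

theorem theorem1p2:
  fixes B :: "bit ^ 'n \<Rightarrow> bit ^ 'n \<Rightarrow> bit"
    and S :: "((bit ^ 'n \<Rightarrow> bit ^ 'n) \<Rightarrow> rat) set"
    and P :: "(bit ^ 'n \<Rightarrow> bit ^ 'n) set set"
    and C :: "nat \<Rightarrow> (bit ^ 'n \<Rightarrow> bit ^ 'n) set"
    and r :: nat
  assumes "CARD('n) \<ge> 14" and "even CARD('n)"
    and "symplectic_form B"
    and "commutative_schur_ring (Sp B) S P"
    and "schur_set P (transvections B)"
    and "bij_betw C {1..r} {D \<in> P. D \<subseteq> transvections B}"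
  shows "r = 1 \<and> C 1 = transvections B"
proof -
  interpret schur_sets B "{E. indicator E \<in> S}"
    by (rule schur_sets_of_schur_ring) (rule assms)+
  have sr: "schur_ring (Sp B) S P" using assms(4) by (simp add: commutative_schur_ring_def)
  have part: "disjoint P" "{} \<notin> P" "\<Union>P = carrier (Sp B)"
    using sr by (auto simp: schur_ring_def partition_on_def)
  have tT: "transvection B ` V0 = transvections B" by (auto simp: transvections_def)
  have "D = transvections B" if D: "D \<in> P" "D \<subseteq> transvections B" for D
  proof -
    define X where "X = {v. v \<noteq> 0 \<and> transvection B v \<in> D}"
    have X: "transvection B ` X = D" using D(2) by (auto simp: X_def transvections_def)
    have "(indicator D :: _ \<Rightarrow> rat) \<in> S"
      unfolding schur_ring_mem_iff[OF finite_carrier_Sp sr] using D(1) part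
      by (auto simp: group_algebra_simps indicator_def disjoint_def)
    then have "X \<in> VV" unfolding VV_def using X by (simp add: X_def)
    moreover have "X \<noteq> {}" using X D(1) part(2) by auto
    ultimately show ?thesis using VV_trivial X tT by blast
  qed
  moreover have "\<exists>D\<in>P. D \<subseteq> transvections B"
  proof -
    obtain Q where Q: "Q \<subseteq> P" "transvections B = \<Union>Q" using assms(5) by (auto simp: schur_set_def)
    \<comment> \<open>A non-zero vector exists, so some principal set consists of transvections and
      \<open>r\<close> is not 0.\<close>
    have "transvection B (axis undefined 1) \<in> transvections B"
      unfolding transvections_def
      by (intro CollectI exI[of _ "axis undefined 1"] conjI refl) (simp only: axis_eq_0_iff, simp)
    then obtain D where "D \<in> Q" using Q(2) by auto
    then show ?thesis using Q by auto
  qed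
  ultimately have "{D \<in> P. D \<subseteq> transvections B} = {transvections B}" by blast
  then have b: "bij_betw C {1..r} {transvections B}" using assms(6) by simp
  then have "card {1..r} = 1" using bij_betw_same_card[OF b] by simp
  then have "r = 1" by simp
  then show ?thesis using b by (simp add: bij_betw_def)
qed

end
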